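(* Let $\mathfrak{X}$ be a Banach space and let $T: L_1\to\mathfrak{X}$ be an operator that is not completely continuous. Then there exist a linear isometry $A: L_1\to L_1$ (not necessarily onto) and an operator $B:\mathfrak{X}\to\ell_\infty$ such that $$B\,T\,A=T_0 .$$ Furthermore, if $\mathfrak{X}$ is separable, then $T_0$ and $B$ may be viewed as operators into $c_0$; that is, $T_0$ takes values in $c_0$, and $A$ and $B$ may be chosen so that $BTA=T_0$ with $B$ taking values in $c_0$.
   Context: Scalars are real. "Operator" means bounded linear operator between Banach spaces. An operator is completely continuous if it carries weakly convergent sequences into norm convergent sequences. $L_1=L_1([0,1],\mu)$ with $\mu$ Lebesgue measure. The operator $T_0: L_1\to\ell_\infty$ is defined by $T_0(f)=\left\{\int r_n f\,d\mu\right\}_{n=0}^\infty$, where $r_n$ is the $n$-th Rademacher function: $r_0=1$, and for $n\ge 1$, $r_n$ equals $(-1)^{k-1}$ on the dyadic interval $\left[\frac{k-1}{2^n},\frac{k}{2^n}\right)$, $k=1,\ldots,2^n$. *)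

theory Defs
  imports "HOL-Analysis.Analysis"
begin

abbreviation leb01 :: "real measure" where
  "leb01 \<equiv> lebesgue_on {0..1}"

quotient_type L1 = "real \<Rightarrow> real" / partial:
  "\<lambda>f g. integrable leb01 f \<and> integrable leb01 g \<and> (AE t in leb01. f t = g t)"
proof (rule part_equivpI)
  show "\<exists>f. integrable leb01 f \<and> integrable leb01 f \<and> (AE t in leb01. f t = (f t :: real))"
    by (rule exI[of _ "\<lambda>_. 0"]) simp
next
  show "symp (\<lambda>f g. integrable leb01 f \<and> integrable leb01 g \<and> (AE t in leb01. f t = (g t :: real)))"
    by (rule sympI) (auto elim: eventually_mono)
next
  show "transp (\<lambda>f g. integrable leb01 f \<and> integrable leb01 g \<and> (AE t in leb01. f t = (g t :: real)))"
  proof (rule transpI, intro conjI)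
    fix f g h :: "real \<Rightarrow> real"
    assume fg: "integrable leb01 f \<and> integrable leb01 g \<and> (AE t in leb01. f t = g t)"
      and gh: "integrable leb01 g \<and> integrable leb01 h \<and> (AE t in leb01. g t = h t)"
    from fg have "AE t in leb01. f t = g t" by blast
    moreover from gh have "AE t in leb01. g t = h t" by blast
    ultimately show "AE t in leb01. f t = h t"
      by eventually_elim simp
  qed blast+
qed

instantiation L1 :: real_normed_vector
begin

lift_definition zero_L1 :: L1 is "\<lambda>_. 0" by simp

lift_definition plus_L1 :: "L1 \<Rightarrow> L1 \<Rightarrow> L1" is "\<lambda>f g t. f t + g t"
  by (auto elim: eventually_elim2)

lift_definition minus_L1 :: "L1 \<Rightarrow> L1 \<Rightarrow> L1" is "\<lambda>f g t. f t - g t"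
  by (auto elim: eventually_elim2)

lift_definition uminus_L1 :: "L1 \<Rightarrow> L1" is "\<lambda>f t. - f t"
  by (auto elim: eventually_mono)

lift_definition scaleR_L1 :: "real \<Rightarrow> L1 \<Rightarrow> L1" is "\<lambda>c f t. c * f t"
  by (auto elim: eventually_mono)

lift_definition norm_L1 :: "L1 \<Rightarrow> real" is "\<lambda>f. \<integral>t. \<bar>f t\<bar> \<partial>leb01"
proof -
  fix f g :: "real \<Rightarrow> real"
  assume fg: "integrable leb01 f \<and> integrable leb01 g \<and> (AE t in leb01. f t = g t)"
  show "(\<integral>t. \<bar>f t\<bar> \<partial>leb01) = (\<integral>t. \<bar>g t\<bar> \<partial>leb01)"
  proof (rule integral_cong_AE)
    show "(\<lambda>t. \<bar>f t\<bar>) \<in> borel_measurable leb01" "(\<lambda>t. \<bar>g t\<bar>) \<in> borel_measurable leb01"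
      using fg by (auto dest: borel_measurable_integrable)
    from fg have "AE t in leb01. f t = g t" by blast
    then show "AE t in leb01. \<bar>f t\<bar> = \<bar>g t\<bar>" by eventually_elim simp
  qed
qed

definition dist_L1 :: "L1 \<Rightarrow> L1 \<Rightarrow> real" where
  "dist_L1 f g = norm (f - g)"

definition sgn_L1 :: "L1 \<Rightarrow> L1" where
  "sgn_L1 f = inverse (norm f) *\<^sub>R f"

definition uniformity_L1 :: "(L1 \<times> L1) filter" where
  "uniformity_L1 = (INF e\<in>{0 <..}. principal {(f, g). dist f g < e})"

definition open_L1 :: "L1 set \<Rightarrow> bool" where
  "open_L1 S = (\<forall>f\<in>S. \<forall>\<^sub>F (f', g) in uniformity. f' = f \<longrightarrow> g \<in> S)"

instance
proof
  fix f g h :: L1 and a b :: real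
  show "f + g + h = f + (g + h)" by transfer (simp add: add.assoc)
  show "f + g = g + f" by transfer (simp add: add.commute)
  show "0 + f = f" by transfer simp
  show "- f + f = 0" by transfer simp
  show "f - g = f + - g" by transfer simp
  show "a *\<^sub>R (f + g) = a *\<^sub>R f + a *\<^sub>R g" by transfer (simp add: algebra_simps)
  show "(a + b) *\<^sub>R f = a *\<^sub>R f + b *\<^sub>R f" by transfer (simp add: algebra_simps)
  show "a *\<^sub>R b *\<^sub>R f = (a * b) *\<^sub>R f" by transfer (simp add: mult.assoc)
  show "1 *\<^sub>R f = f" by transfer simp
  show "dist f g = norm (f - g)" by (rule dist_L1_def)
  show "sgn f = inverse (norm f) *\<^sub>R f" by (simp add: sgn_L1_def)
  show "(uniformity :: (L1 \<times> L1) filter) = (INF e\<in>{0 <..}. principal {(x, y). dist x y < e})"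
    by (rule uniformity_L1_def)
  show "open U = (\<forall>x\<in>U. \<forall>\<^sub>F (x', y) in uniformity. x' = x \<longrightarrow> y \<in> U)" for U :: "L1 set"
    by (rule open_L1_def)
  show "(norm f = 0) = (f = 0)"
  proof transfer
    fix f :: "real \<Rightarrow> real"
    assume f: "integrable leb01 f \<and> integrable leb01 f \<and> (AE t in leb01. f t = f t)"
    then have "((\<integral>t. \<bar>f t\<bar> \<partial>leb01) = 0) = (AE t in leb01. \<bar>f t\<bar> = 0)"
      by (intro integral_nonneg_eq_0_iff_AE) auto
    with f show "((\<integral>t. \<bar>f t\<bar> \<partial>leb01) = 0) =
      (integrable leb01 f \<and> integrable leb01 (\<lambda>_. 0 :: real) \<and> (AE t in leb01. f t = 0))"
      by simp
  qed
  show "norm (f + g) \<le> norm f + norm g"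
  proof transfer
    fix f g :: "real \<Rightarrow> real"
    assume f: "integrable leb01 f \<and> integrable leb01 f \<and> (AE t in leb01. f t = f t)"
      and g: "integrable leb01 g \<and> integrable leb01 g \<and> (AE t in leb01. g t = g t)"
    have "(\<integral>t. \<bar>f t + g t\<bar> \<partial>leb01) \<le> (\<integral>t. \<bar>f t\<bar> + \<bar>g t\<bar> \<partial>leb01)"
      using f g by (intro integral_mono) auto
    also have "\<dots> = (\<integral>t. \<bar>f t\<bar> \<partial>leb01) + (\<integral>t. \<bar>g t\<bar> \<partial>leb01)"
      using f g by (intro Bochner_Integration.integral_add) auto
    finally show "(\<integral>t. \<bar>f t + g t\<bar> \<partial>leb01) \<le> (\<integral>t. \<bar>f t\<bar> \<partial>leb01) + (\<integral>t. \<bar>g t\<bar> \<partial>leb01)" .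
  qed
  show "norm (a *\<^sub>R f) = \<bar>a\<bar> * norm f"
    by transfer (simp add: abs_mult)
qed

end

text \<open>For $n \ge 1$ the dyadic intervals leave out the point $1$, where the value is set to $0$.\<close>

definition rademacher :: "nat \<Rightarrow> real \<Rightarrow> real" where
  "rademacher n t = (if n = 0 then 1 else
     (\<Sum>k=1..2^n. (-1)^(k-1) * indicator {(real k - 1) / 2^n ..< real k / 2^n} t))"

lemma rademacher_measurable [measurable]: "rademacher n \<in> borel_measurable leb01"
proof -
  have "rademacher n \<in> borel_measurable borel"
    unfolding rademacher_def by measurable
  then show ?thesis
    by (intro measurable_restrict_space1 measurable_completion) simp
qed

lemma abs_rademacher_le_1: "\<bar>rademacher n t\<bar> \<le> 1"
proof (cases "\<exists>k\<in>{1..2^n}. t \<in> {(real k - 1) / 2^n ..< real k / 2^n}")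
  case True
  then obtain k where k: "k \<in> {1..2^n}" "t \<in> {(real k - 1) / 2^n ..< real k / 2^n}" by blast
  have "t \<notin> {(real j - 1) / 2^n ..< real j / 2^n}" if "j \<noteq> k" for j
  proof
    assume "t \<in> {(real j - 1) / 2^n ..< real j / 2^n}"
    with k(2) have "real j - 1 < real k" "real k - 1 < real j"
      by (auto simp: field_simps)
    with that show False by linarith
  qed
  then have "(\<Sum>j=1..2^n. (-1)^(j-1) * indicator {(real j - 1) / 2^n ..< real j / 2^n} t) =
      (\<Sum>j=1..2^n. if j = k then (-1)^(k-1) else (0::real))"
    using k(2) by (intro sum.cong) (auto simp: indicator_def)
  also have "\<dots> = (-1)^(k-1)" using k(1) by (subst sum.delta) auto
  finally show ?thesis by (simp add: rademacher_def power_abs)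
next
  case False
  then have "(\<Sum>j=1..2^n. (-1)^(j-1) * indicator {(real j - 1) / 2^n ..< real j / 2^n} t) = (0::real)"
    by (intro sum.neutral) (auto simp: indicator_def)
  then show ?thesis by (simp add: rademacher_def)
qed

text \<open>
  As the topology of \<^typ>\<open>nat\<close> is discrete, \<^typ>\<open>nat \<Rightarrow>\<^sub>C real\<close> consists of all bounded real
  sequences with the supremum norm, i.e. it is the Banach space $\ell_\infty$.
\<close>

instance bcontfun :: (metric_space, banach) banach ..

type_synonym linf = "nat \<Rightarrow>\<^sub>C real"

definition c0 :: "linf set" where
  "c0 = {x. apply_bcontfun x \<longlonglongrightarrow> 0}"

lemma integrable_rademacher_mult:
  assumes "integrable leb01 f"
  shows "integrable leb01 (\<lambda>t. rademacher n t * f t)"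
proof (rule Bochner_Integration.integrable_bound[OF assms])
  show "(\<lambda>t. rademacher n t * f t) \<in> borel_measurable leb01"
    using assms by (intro borel_measurable_times rademacher_measurable) auto
  have "\<bar>rademacher n t\<bar> * \<bar>f t\<bar> \<le> 1 * \<bar>f t\<bar>" for t
    by (intro mult_right_mono abs_rademacher_le_1) simp
  then show "AE t in leb01. norm (rademacher n t * f t) \<le> norm (f t)"
    by (simp add: abs_mult)
qed

lift_definition rademacher_coeff :: "L1 \<Rightarrow> nat \<Rightarrow> real" is
  "\<lambda>f n. \<integral>t. rademacher n t * f t \<partial>leb01"
proof (rule ext)
  fix f g :: "real \<Rightarrow> real" and n
  assume fg: "integrable leb01 f \<and> integrable leb01 g \<and> (AE t in leb01. f t = g t)"
  then have "AE t in leb01. f t = g t" by blast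
  then have "AE t in leb01. rademacher n t * f t = rademacher n t * g t"
    by eventually_elim simp
  then show "(\<integral>t. rademacher n t * f t \<partial>leb01) = (\<integral>t. rademacher n t * g t \<partial>leb01)"
    using fg by (intro integral_cong_AE borel_measurable_integrable integrable_rademacher_mult) auto
qed

definition T0 :: "L1 \<Rightarrow> linf" where
  "T0 f = Bcontfun (rademacher_coeff f)"

lemma abs_rademacher_coeff_le: "\<bar>rademacher_coeff f n\<bar> \<le> norm f"
proof transfer
  fix f :: "real \<Rightarrow> real" and n
  assume "integrable leb01 f \<and> integrable leb01 f \<and> (AE t in leb01. f t = f t)"
  then have f: "integrable leb01 f" by blast
  have "\<bar>rademacher n t\<bar> * \<bar>f t\<bar> \<le> 1 * \<bar>f t\<bar>" for t
    by (intro mult_right_mono abs_rademacher_le_1) simp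
  then have "(\<integral>t. \<bar>rademacher n t * f t\<bar> \<partial>leb01) \<le> (\<integral>t. \<bar>f t\<bar> \<partial>leb01)"
    using f by (intro integral_mono integrable_abs integrable_rademacher_mult) (auto simp: abs_mult)
  with integral_abs_bound[of leb01 "\<lambda>t. rademacher n t * f t"]
  show "\<bar>\<integral>t. rademacher n t * f t \<partial>leb01\<bar> \<le> (\<integral>t. \<bar>f t\<bar> \<partial>leb01)"
    by linarith
qed

lemma apply_T0: "apply_bcontfun (T0 f) = rademacher_coeff f"
  unfolding T0_def
  by (intro Bcontfun_inverse bcontfun_normI[where b = "norm f"])
    (auto simp: continuous_on_discrete abs_rademacher_coeff_le)

definition weakly_convergent_to :: "(nat \<Rightarrow> 'a::real_normed_vector) \<Rightarrow> 'a \<Rightarrow> bool" where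
  "weakly_convergent_to x l \<longleftrightarrow>
     (\<forall>\<phi> :: 'a \<Rightarrow> real. bounded_linear \<phi> \<longrightarrow> (\<lambda>n. \<phi> (x n)) \<longlonglongrightarrow> \<phi> l)"

definition completely_continuous ::
    "('a::real_normed_vector \<Rightarrow> 'b::real_normed_vector) \<Rightarrow> bool" where
  "completely_continuous T \<longleftrightarrow>
     (\<forall>x. (\<exists>l. weakly_convergent_to x l) \<longrightarrow> convergent (\<lambda>n. T (x n)))"

definition linear_isometry :: "('a::real_normed_vector \<Rightarrow> 'b::real_normed_vector) \<Rightarrow> bool" where
  "linear_isometry A \<longleftrightarrow> linear A \<and> (\<forall>x. norm (A x) = norm x)"

end

theory Submission
  imports Defs
begin


text \<open>
  Let $T$ be an operator on $L_1$ that is not completely continuous. It is enough to find a bounded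
  sequence of functionals $z_n$ on the target space, an isometry $A$ of $L_1$ and a constant
  $a > 0$ with $z_n(T(A f)) = a \int r_n f$ for all $f$ and $n$: then $B x = (z_n(x)/a)_n$ does what
  is wanted. When $z_n \to 0$ pointwise, $B$ takes values in $c_0$, and so does $T_0 = B T A$.

  \<^emph>\<open>Functionals.\<close> Some weakly null sequence $f_n$ satisfies $\|T f_n\| \ge d > 0$, and norming
  functionals $x_n$ give $x_n(T f_n) \ge d$. The functional $x_n \circ T$ on $L_1$ is integration
  against a bounded function. For fixed $m$ the densities of $x_n \circ T$ and $x_m \circ T$ cannot
  be close in the $L_1$-norm for large $n$: the difference, integrated against $f_n$, stays away
  from zero, whereas a weakly null sequence is uniformly integrable
  (\<open>weakly_null_equi_integrable\<close>). After passing to a subsequence along which the $x_n$ converge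
  on a countable set, differences $y_m = x_{n(m)} - x_m$ have densities $v_m$ that are uniformly
  bounded, weak-star null and bounded below in $L_1$-norm. Using differences makes the limit zero
  although the limit of the $x_n$ need not come from a functional, and it makes $y_m$ converge to
  zero on the closure of any prescribed countable set. A weak-star limit of $|v_m|$ is bounded below
  on some set $B$ of positive measure (\<open>weak_star_null_functionals_localized\<close>).

  \<^emph>\<open>Signs.\<close> One constructs successively functionals $z_n$, small perturbations of terms of the
  sequence $y_m$, with densities $u_n$, and measurable signs $s_n$ such that on every atom of the
  partition of $B$ into the level sets of $(s_0, \ldots, s_{n-1})$ the functions $u_n$, $s_n$ and
  $s_n u_j$ for $j < n$ have integral zero and $s_n u_n$ has mean $a$ (\<open>splitting_step\<close>). Half the
  difference of two functions sgn $v_k$ satisfies these relations approximately. They can be made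
  exact by subtracting small combinations of earlier members of the sequence, and the resulting
  function with values in $[-1,1]$ is replaced by a sign function with the same integrals, which is
  Lyapunov's theorem (\<open>lyapunov_sign_function\<close>). Exactness matters, since closeness to a multiple
  of $T_0$ does not by itself give a factorization of $T_0$.

  \<^emph>\<open>The isometry.\<close> On $B$ with normalized measure the $s_n$ are independent fair signs, and the
  conditional expectation of $u_n$ given all of them is $a s_n$. The signs $s_0 s_{i+1}$ are the binary
  digits of a map $\varphi$ from $B$ to the unit interval that carries normalized measure to Lebesgue
  measure, and $A f = s_0 \cdot (f \circ \varphi) / |B|$ on $B$ is an isometry. The factor $s_0$
  accounts for $r_0 = 1$: the conditional expectation of $s_0 u_0$ is $a$, and that of $s_0 u_n$ is
  $a s_0 s_n = a\, (r_n \circ \varphi)$ for $n \ge 1$ (\<open>factorization_through_T0\<close>).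
\<close>

section \<open>Norming functionals\<close>

text \<open>
  A linear functional below the norm is a subspace of the product with the real line all of whose
  points $(x, r)$ satisfy $r \le \|x\|$; single-valuedness is then automatic, and unions of chains
  stay of this form. Zorn's lemma gives a maximal one, and the usual choice of a value between two
  bounds shows that its domain is everything.
\<close>

lemma norming_functional:
  fixes z :: "'a::real_normed_vector"
  obtains f :: "'a \<Rightarrow>\<^sub>L real" where "norm f \<le> 1" "f z = norm z"
proof -
  define D where "D = {G :: ('a \<times> real) set. subspace G \<and> (\<forall>(x, r)\<in>G. r \<le> norm x)}"
  define G0 where "G0 = range (\<lambda>c. (c *\<^sub>R z, c * norm z))"
  have "subspace G0"
  proof -
    have "linear (\<lambda>c::real. (c *\<^sub>R z, c * norm z))"
      by (intro linearI) (auto simp: algebra_simps)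
    from linear_subspace_image[OF this subspace_UNIV] show ?thesis by (simp add: G0_def)
  qed
  moreover have "c * norm z \<le> norm (c *\<^sub>R z)" for c
    by (simp add: mult_right_mono)
  ultimately have G0: "G0 \<in> D" by (auto simp: D_def G0_def)
  have D_r: "r \<le> norm x" if "G \<in> D" "(x, r) \<in> G" for G x r
    using that by (auto simp: D_def)
  have D_sub: "subspace G" if "G \<in> D" for G
    using that by (simp add: D_def)
  have chain_up: "\<Union>C \<in> {G \<in> D. G0 \<subseteq> G}"
    if C: "subset.chain {G \<in> D. G0 \<subseteq> G} C" and ne: "C \<noteq> {}" for C
  proof -
    have CD: "C \<subseteq> D" and CG: "\<And>G. G \<in> C \<Longrightarrow> G0 \<subseteq> G" and
      lin: "\<And>G H. G \<in> C \<Longrightarrow> H \<in> C \<Longrightarrow> G \<subseteq> H \<or> H \<subseteq> G"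
      using C unfolding subset.chain_def by blast+
    have "subspace (\<Union>C)"
    proof (rule subspaceI)
      show "0 \<in> \<Union>C" using ne CD D_sub subspace_0 by blast
      show "v + w \<in> \<Union>C" if "v \<in> \<Union>C" "w \<in> \<Union>C" for v w
      proof -
        from that obtain G H where GH: "G \<in> C" "v \<in> G" "H \<in> C" "w \<in> H" by blast
        with lin[of G H] have "v \<in> H \<and> w \<in> H \<or> v \<in> G \<and> w \<in> G" by blast
        with GH CD D_sub[of G] D_sub[of H] subspace_add[of G v w] subspace_add[of H v w]
        show ?thesis by blast
      qed
      show "c *\<^sub>R v \<in> \<Union>C" if "v \<in> \<Union>C" for c v
      proof -
        from that obtain G where "G \<in> C" "v \<in> G" by blast
        with CD D_sub[of G] subspace_scale[of G v c] show ?thesis by blast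
      qed
    qed
    then show "\<Union>C \<in> {G \<in> D. G0 \<subseteq> G}"
      using CD CG ne by (auto simp: D_def subset_iff split_beta)
  qed
  obtain G where G: "G \<in> D" "G0 \<subseteq> G" and
    max: "\<And>H. H \<in> D \<Longrightarrow> G \<subseteq> H \<Longrightarrow> H = G"
  proof -
    have "{G \<in> D. G0 \<subseteq> G} \<noteq> {}" using G0 by blast
    from subset_Zorn_nonempty[OF this chain_up] obtain G where
      "G \<in> D" "G0 \<subseteq> G" "\<forall>X\<in>{G \<in> D. G0 \<subseteq> G}. G \<subseteq> X \<longrightarrow> X = G" by blast
    then show ?thesis by (intro that[of G]) (blast dest: subset_trans)+
  qed
  note subG = D_sub[OF G(1)] and leG = D_r[OF G(1)]
  have uniq: "r = s" if "(x, r) \<in> G" "(x, s) \<in> G" for x r s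
    using leG[of 0 "r - s"] leG[of 0 "s - r"] subspace_diff[OF subG that]
      subspace_diff[OF subG that(2,1)] by simp
  have total: "\<exists>r. (x, r) \<in> G" for x
  proof -
    have sep: "s - norm (y - x) \<le> norm (w + x) - r" if "(w, r) \<in> G" "(y, s) \<in> G" for w r y s
    proof -
      have "r + s \<le> norm (w + y)" using leG[of "w + y" "r + s"] subspace_add[OF subG that] by simp
      also have "\<dots> \<le> norm (w + x) + norm (y - x)"
        using norm_triangle_ineq[of "w + x" "y - x"] by simp
      finally show ?thesis by simp
    qed
    \<comment> \<open>The admissible values at x form the interval from Sup L to the infimum of norm (w + x) - r.\<close>
    define L where "L = (\<lambda>(y, s). s - norm (y - x)) ` G"
    have z: "(0, 0) \<in> G" using subspace_0[OF subG] by (simp add: zero_prod_def)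
    have Lne: "L \<noteq> {}" using z by (auto simp: L_def)
    have bdd: "bdd_above L" unfolding L_def by (rule bdd_aboveI[of _ "norm x"]) (use sep[OF z] in auto)
    define q where "q = Sup L"
    have q1: "s - norm (y - x) \<le> q" if "(y, s) \<in> G" for y s
      unfolding q_def by (rule cSup_upper[OF _ bdd]) (use that in \<open>force simp: L_def\<close>)
    have q2: "q \<le> norm (w + x) - r" if "(w, r) \<in> G" for w r
      unfolding q_def by (rule cSup_least[OF Lne]) (use sep[OF that] in \<open>auto simp: L_def\<close>)
    define H where "H = {g + h | g h. g \<in> G \<and> h \<in> range (\<lambda>c. c *\<^sub>R (x, q))}"
    have "subspace H"
      unfolding H_def
      by (intro subspace_sums subG linear_subspace_image[OF _ subspace_UNIV] linearI)
        (auto simp: algebra_simps)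
    moreover have "r + c * q \<le> norm (w + c *\<^sub>R x)" if wr: "(w, r) \<in> G" for w r c
    proof (cases c "0::real" rule: linorder_cases)
      case equal
      then show ?thesis using leG[OF wr] by simp
    next
      case greater
      have "((1/c) *\<^sub>R w, r/c) \<in> G" using subspace_scale[OF subG wr, of "1/c"] by simp
      from q2[OF this] have "r / c + q \<le> norm ((1/c) *\<^sub>R w + x)" by simp
      then have "c * (r / c + q) \<le> c * norm ((1/c) *\<^sub>R w + x)"
        using greater by (intro mult_left_mono) auto
      also have "\<dots> = norm (c *\<^sub>R ((1/c) *\<^sub>R w + x))" using greater by simp
      finally show ?thesis using greater by (simp add: algebra_simps)
    next
      case less
      have "((-1/c) *\<^sub>R w, -r/c) \<in> G" using subspace_scale[OF subG wr, of "-1/c"] by simp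
      from q1[OF this] have "-r / c - q \<le> norm ((-1/c) *\<^sub>R w - x)" by simp
      then have "(-c) * (-r / c - q) \<le> (-c) * norm ((-1/c) *\<^sub>R w - x)"
        using less by (intro mult_left_mono) auto
      also have "\<dots> = norm ((-c) *\<^sub>R ((-1/c) *\<^sub>R w - x))" using less by simp
      finally show ?thesis using less by (simp add: algebra_simps)
    qed
    ultimately have "H \<in> D" by (auto simp: D_def H_def)
    moreover have "G \<subseteq> H"
    proof
      fix g assume "g \<in> G"
      then show "g \<in> H" unfolding H_def by (intro CollectI exI[of _ g] exI[of _ 0]) (auto simp: image_iff zero_prod_def intro: exI[of _ 0])
    qed
    ultimately have "H = G" by (rule max)
    moreover have "(0, 0) + 1 *\<^sub>R (x, q) \<in> H" using z unfolding H_def by blast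
    ultimately show ?thesis by auto
  qed
  define f where "f x = (THE r. (x, r) \<in> G)" for x
  have f: "(x, r) \<in> G \<longleftrightarrow> f x = r" for x r
    unfolding f_def using total[of x] uniq the_equality[of "\<lambda>r. (x, r) \<in> G"] by metis
  have "f (x + y) = f x + f y" for x y
    using subspace_add[OF subG, of "(x, f x)" "(y, f y)"] f by simp
  moreover have "f (c *\<^sub>R x) = c *\<^sub>R f x" for c x
    using subspace_scale[OF subG, of "(x, f x)" c] f by simp
  ultimately have lin: "linear f" by (rule linearI)
  have bd: "\<bar>f x\<bar> \<le> norm x" for x
    using leG[of x "f x"] leG[of "-x" "f (-x)"] f linear_neg[OF lin, of x] by auto
  have bl: "bounded_linear f"
    by (rule bounded_linear_intro[where K = 1]) (use lin bd in \<open>auto simp: linear_add linear_scale\<close>)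
  show ?thesis
  proof
    show "norm (Blinfun f) \<le> 1"
      by (rule norm_blinfun_bound) (use bl bd in \<open>auto simp: bounded_linear_Blinfun_apply\<close>)
    have "(1 *\<^sub>R z, 1 * norm z) \<in> G" using G(2) unfolding G0_def by blast
    then show "Blinfun f z = norm z" using f bl by (simp add: bounded_linear_Blinfun_apply)
  qed
qed

section \<open>The space of integrable functions on the unit interval\<close>

interpretation leb01: finite_measure leb01
  by (rule finite_measure_lebesgue_on) auto

text \<open>
  The representatives of the elements of the ball of radius $K$ in $L_\infty$. The bound is required
  everywhere, which is harmless for densities and spares null sets later.
\<close>

abbreviation integral01 :: "(real \<Rightarrow> real) \<Rightarrow> real"  (binder "\<I>" 10) where
  "integral01 f \<equiv> integral\<^sup>L leb01 f"

lemmas integral_congI = Bochner_Integration.integral_cong[OF refl]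

abbreviation L1_bounded :: "real \<Rightarrow> (real \<Rightarrow> real) \<Rightarrow> bool" where
  "L1_bounded K u \<equiv> u \<in> borel_measurable leb01 \<and> (\<forall>t. \<bar>u t\<bar> \<le> K)"

lemma borel_sets_leb01: "A \<in> sets borel \<Longrightarrow> {0..1} \<inter> A \<in> sets leb01"
  by (auto simp: sets_restrict_space)

lemma borel_measurable_leb01: "f \<in> borel_measurable borel \<Longrightarrow> f \<in> borel_measurable leb01"
  by (intro measurable_restrict_space1 measurable_completion) simp

lemma abs_L1_eq_iff:
  assumes "integrable leb01 f" "integrable leb01 g"
  shows "abs_L1 f = abs_L1 g \<longleftrightarrow> (AE t in leb01. f t = g t)"
  using Quotient_rel[OF Quotient_L1, of f g] assms by auto

lemma abs_L1_cong: "integrable leb01 f \<Longrightarrow> integrable leb01 g \<Longrightarrow> AE t in leb01. f t = g t \<Longrightarrow> abs_L1 f = abs_L1 g"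
  by (simp add: abs_L1_eq_iff)

lemma L1_cases:
  obtains f where "integrable leb01 f" "x = abs_L1 f"
  using Quotient_rep_reflp[OF Quotient_L1] Quotient_abs_rep[OF Quotient_L1] by metis

lemma L1_simps:
  assumes "integrable leb01 f"
  shows "norm (abs_L1 f) = (\<I> t. \<bar>f t\<bar>)"
    and "c *\<^sub>R abs_L1 f = abs_L1 (\<lambda>t. c * f t)"
    and "integrable leb01 g \<Longrightarrow> abs_L1 f + abs_L1 g = abs_L1 (\<lambda>t. f t + g t)"
    and "integrable leb01 g \<Longrightarrow> abs_L1 f - abs_L1 g = abs_L1 (\<lambda>t. f t - g t)"
    and "rademacher_coeff (abs_L1 f) n = (\<I> t. rademacher n t * f t)"
  using assms
  by (simp_all add: norm_L1.abs_eq scaleR_L1.abs_eq plus_L1.abs_eq minus_L1.abs_eq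
      rademacher_coeff.abs_eq)

lemma integrable_bounded_mult:
  assumes "L1_bounded K u" "integrable leb01 f"
  shows "integrable leb01 (\<lambda>t. u t * f t)"
proof (rule Bochner_Integration.integrable_bound)
  show "integrable leb01 (\<lambda>t. K * f t)" using assms by simp
  show "(\<lambda>t. u t * f t) \<in> borel_measurable leb01" using assms by auto
  have "\<bar>u t\<bar> * \<bar>f t\<bar> \<le> \<bar>K\<bar> * \<bar>f t\<bar>" for t
    by (rule mult_right_mono) (use assms(1) in \<open>auto intro: order_trans[OF _ abs_ge_self]\<close>)
  then show "AE t in leb01. norm (u t * f t) \<le> norm (K * f t)"
    by (simp add: abs_mult)
qed

lemma abs_integral_bounded_mult:
  assumes u: "L1_bounded K u" and f: "integrable leb01 f"
  shows "\<bar>\<I> t. u t * f t\<bar> \<le> K * (\<I> t. \<bar>f t\<bar>)"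
proof -
  have "\<bar>u t * f t\<bar> \<le> K * \<bar>f t\<bar>" for t
    unfolding abs_mult by (rule mult_right_mono) (use u in auto)
  then have "(\<I> t. \<bar>u t * f t\<bar>) \<le> (\<I> t. K * \<bar>f t\<bar>)"
    using f integrable_bounded_mult[OF u f] by (intro integral_mono) auto
  also have "(\<I> t. K * \<bar>f t\<bar>) = K * (\<I> t. \<bar>f t\<bar>)" by simp
  finally show ?thesis
    by (rule order_trans[OF integral_abs_bound])
qed

lemma integrable_bounded: "L1_bounded K u \<Longrightarrow> integrable leb01 u"
  using integrable_bounded_mult[of u K "\<lambda>_. 1"] by simp

lemma integrable_indicator_mult:
  fixes f :: "real \<Rightarrow> real"
  assumes "A \<in> sets borel \<or> A \<in> sets leb01" "integrable leb01 f"
  shows "integrable leb01 (\<lambda>t. indicator A t * f t)"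
  using assms
  by (intro integrable_bounded_mult[of "indicator A" 1 f])
    (auto simp: indicator_def intro: borel_measurable_leb01 borel_measurable_indicator)

lemma integrable_indicator_leb01: "A \<in> sets borel \<or> A \<in> sets leb01 \<Longrightarrow> integrable leb01 (indicator A :: real \<Rightarrow> real)"
  using integrable_indicator_mult[of A "\<lambda>_. 1"] leb01.integrable_const[of "1::real"]
  by (simp only: mult_1_right)

lemma abs_L1_tendsto:
  assumes s: "\<And>i. integrable leb01 (s i)" and f: "f \<in> borel_measurable leb01"
    and w: "integrable leb01 w"
    and lim: "AE t in leb01. (\<lambda>i. s i t) \<longlonglongrightarrow> f t"
    and bd: "\<And>i. AE t in leb01. \<bar>s i t\<bar> \<le> w t"
  shows "(\<lambda>i. abs_L1 (s i)) \<longlonglongrightarrow> abs_L1 f"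
proof -
  have fi: "integrable leb01 f"
    by (rule integrable_dominated_convergence[OF f _ w lim]) (use s bd in auto)
  have "(\<lambda>i. \<I> t. \<bar>s i t - f t\<bar>) \<longlonglongrightarrow> (\<I> t. 0)"
  proof (rule integral_dominated_convergence[where w = "\<lambda>t. w t + \<bar>f t\<bar>"])
    show "AE t in leb01. (\<lambda>i. \<bar>s i t - f t\<bar>) \<longlonglongrightarrow> 0"
      using lim by eventually_elim (simp add: tendsto_rabs_zero LIM_zero)
    show "AE t in leb01. norm \<bar>s i t - f t\<bar> \<le> w t + \<bar>f t\<bar>" for i
      using bd[of i] by eventually_elim auto
  qed (use s f w fi in auto)
  then have "(\<lambda>i. norm (abs_L1 (s i) - abs_L1 f)) \<longlonglongrightarrow> 0"
    using s fi by (simp add: L1_simps)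
  then show ?thesis by (simp add: tendsto_norm_zero_iff LIM_zero_iff)
qed

text \<open>
  This carries countable additivity into the norm of $L_1$, so that every continuous functional
  yields a countably additive set function.
\<close>

lemma abs_L1_indicator_sums:
  assumes A: "\<And>i::nat. A i \<in> sets leb01" and dis: "disjoint_family A"
  shows "(\<lambda>i. abs_L1 (indicator (A i))) sums abs_L1 (indicator (\<Union>i. A i))"
proof -
  have part: "(\<Sum>i<n. abs_L1 (indicator (A i))) = abs_L1 (indicator (\<Union>i<n. A i))" for n
  proof (induction n)
    case 0
    show ?case by (simp add: zero_L1_def indicator_def)
  next
    case (Suc n)
    have "indicator (\<Union>i<Suc n. A i) = (\<lambda>t. indicator (\<Union>i<n. A i) t + indicator (A n) t :: real)"
    proof -
      have "(\<Union>i<n. A i) \<inter> A n = {}"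
        using disjoint_family_onD[OF dis, of _ n] by fastforce
      then show ?thesis by (auto simp: indicator_def fun_eq_iff lessThan_Suc)
    qed
    moreover have "(\<Union>i<n. A i) \<in> sets leb01" using A by auto
    ultimately have "abs_L1 (indicator (\<Union>i<Suc n. A i)) = abs_L1 (indicator (\<Union>i<n. A i)) + abs_L1 (indicator (A n))"
      using A by (simp only: L1_simps integrable_indicator_leb01 simp_thms)
    then show ?case using Suc by simp
  qed
  have "(\<lambda>n. abs_L1 (indicator (\<Union>i<n. A i))) \<longlonglongrightarrow> abs_L1 (indicator (\<Union>i. A i))"
  proof (rule abs_L1_tendsto[where w = "\<lambda>_. 1"])
    show "integrable leb01 (indicator (\<Union>i<n. A i) :: real \<Rightarrow> real)" for n
      using A by (intro integrable_indicator_leb01) auto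
    show "(indicator (\<Union>i. A i) :: real \<Rightarrow> real) \<in> borel_measurable leb01"
      using A by auto
    show "AE t in leb01. (\<lambda>n. indicator (\<Union>i<n. A i) t) \<longlonglongrightarrow> (indicator (\<Union>i. A i) t :: real)"
      using LIMSEQ_indicator_UN[of A] by auto
  qed (auto simp: indicator_def)
  then show ?thesis by (simp add: sums_def part)
qed

text \<open>
  A statement about a closed subspace of $L_1$, such as the domain of convergence of a sequence of
  functionals or the set where two functionals agree, needs to be checked on countably many
  indicators only. The half-lines are closed under intersection and generate the Borel sets, so a
  Dynkin-system argument reaches all Borel sets; null sets and simple functions do the rest.
\<close>

lemma L1_closed_subspace_eq_UNIV:
  assumes sub: "subspace D" and cl: "closed D"
    and half: "\<And>x. x \<in> \<rat> \<Longrightarrow> abs_L1 (indicator {..x}) \<in> D"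
  shows "D = UNIV"
proof -
  have lim: "x \<in> D" if "\<And>i. s i \<in> D" "s \<longlonglongrightarrow> x" for s x
    using closed_sequentially[OF cl] that by blast
  \<comment> \<open>Arbitrary half-lines are limits of rational ones from the right.\<close>
  have half': "abs_L1 (indicator {..x}) \<in> D" for x :: real
  proof -
    have "\<exists>r\<in>\<rat>. x < r \<and> r < x + 1 / Suc n" for n
      using Rats_dense_in_real[of x "x + 1 / Suc n"] by auto
    then obtain r where r: "\<And>n. r n \<in> \<rat>" "\<And>n. x < r n" "\<And>n. r n < x + 1 / Suc n" by metis
    have rx: "r \<longlonglongrightarrow> x"
      by (rule tendsto_sandwich[of "\<lambda>_. x" _ _ "\<lambda>n. x + 1 / Suc n"])
        (use r(2,3)[THEN less_imp_le] LIMSEQ_inverse_real_of_nat_add[of x] in \<open>auto simp: inverse_eq_divide\<close>)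
    show ?thesis
    proof (rule lim[where s = "\<lambda>n. abs_L1 (indicator {..r n})"])
      show "(\<lambda>n. abs_L1 (indicator {..r n})) \<longlonglongrightarrow> abs_L1 (indicator {..x})"
      proof (rule abs_L1_tendsto[where w = "\<lambda>_. 1"])
        have "(\<lambda>i. indicator {..r i} t) \<longlonglongrightarrow> (indicator {..x} t :: real)" for t
        proof (cases "t \<le> x")
          case True
          then have "t \<le> r i" for i using r(2)[of i] by linarith
          with True show ?thesis by (simp add: indicator_def)
        next
          case False
          then have "\<forall>\<^sub>F i in sequentially. r i < t" using order_tendstoD(2)[OF rx, of t] by simp
          then have "\<forall>\<^sub>F i in sequentially. indicator {..r i} t = (0::real)"
            by eventually_elim auto
          with False show ?thesis by (simp add: tendsto_eventually)
        qed
        then show "AE t in leb01. (\<lambda>i. indicator {..r i} t) \<longlonglongrightarrow> (indicator {..x} t :: real)" by simp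
      qed (auto simp: indicator_def intro!: integrable_indicator_leb01 borel_measurable_leb01)
    qed (use r half in auto)
  qed
  have univ: "abs_L1 (\<lambda>_. 1) \<in> D"
  proof -
    have "abs_L1 (indicator {..1}) = abs_L1 (\<lambda>_. 1)"
      by (intro abs_L1_cong integrable_indicator_leb01) (auto simp: AE_restrict_space_iff)
    then show ?thesis using half'[of 1] by simp
  qed
  have borel: "abs_L1 (indicator ({0..1} \<inter> A)) \<in> D" if "A \<in> sets borel" for A
  proof -
    have "A \<in> sigma_sets UNIV (range (\<lambda>a::real. {..a}))"
      using that unfolding borel_eq_atMost by simp
    moreover have "Int_stable (range (\<lambda>a::real. {..a}))"
      by (auto simp: Int_stable_def intro!: image_eqI[of _ _ "min _ _"])
    moreover have "range (\<lambda>a::real. {..a}) \<subseteq> Pow UNIV" by simp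
    ultimately have "Int_stable (range (\<lambda>a::real. {..a}))" "range (\<lambda>a::real. {..a}) \<subseteq> Pow UNIV"
      "A \<in> sigma_sets UNIV (range (\<lambda>a::real. {..a}))" by blast+
    then show ?thesis
    proof (induction rule: sigma_sets_induct_disjoint)
      case (basic A)
      then obtain x where A: "A = {..x}" by auto
      have "abs_L1 (indicator ({0..1} \<inter> A)) = abs_L1 (indicator A)"
      proof (rule abs_L1_cong)
        show "integrable leb01 (indicator ({0..1} \<inter> A) :: real \<Rightarrow> real)"
          unfolding A by (intro integrable_indicator_leb01 disjI2 borel_sets_leb01) simp
        show "integrable leb01 (indicator A :: real \<Rightarrow> real)"
          unfolding A by (intro integrable_indicator_leb01 disjI1) simp
      qed (auto simp: AE_restrict_space_iff indicator_def)
      then show ?case using half' A by simp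
    next
      case empty
      show ?case using subspace_0[OF sub] by (simp add: zero_L1_def indicator_def)
    next
      case (compl A)
      then have A: "A \<in> sets borel" by (simp add: borel_eq_atMost)
      have "abs_L1 (indicator ({0..1} \<inter> (UNIV - A))) = abs_L1 (\<lambda>t. 1 - indicator ({0..1} \<inter> A) t)"
        using A by (intro abs_L1_cong integrable_indicator_leb01 disjI2 borel_sets_leb01 Bochner_Integration.integrable_diff)
          (auto simp: AE_restrict_space_iff indicator_def intro!: AE_I2)
      also have "\<dots> = abs_L1 (\<lambda>_. 1) - abs_L1 (indicator ({0..1} \<inter> A))"
        using A by (simp add: L1_simps borel_sets_leb01 integrable_indicator_leb01)
      finally show ?case using univ compl subspace_diff[OF sub] by simp
    next
      case (union A)
      then have A: "range A \<subseteq> sets borel" by (auto simp: borel_eq_atMost)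
      have "(\<lambda>i. abs_L1 (indicator ({0..1} \<inter> A i))) sums abs_L1 (indicator (\<Union>i. {0..1} \<inter> A i))"
        using A union.hyps(1)
        by (intro abs_L1_indicator_sums borel_sets_leb01) (auto simp: disjoint_family_on_def)
      then have "(\<lambda>n. \<Sum>i<n. abs_L1 (indicator ({0..1} \<inter> A i))) \<longlonglongrightarrow> abs_L1 (indicator (\<Union>i. {0..1} \<inter> A i))"
        by (simp only: sums_def)
      moreover have "(\<Sum>i<n. abs_L1 (indicator ({0..1} \<inter> A i))) \<in> D" for n
        using union.IH by (intro subspace_sum[OF sub]) auto
      ultimately have "abs_L1 (indicator (\<Union>i. {0..1} \<inter> A i)) \<in> D" by (rule lim[rotated])
      then show ?case by (simp only: Int_UN_distrib)
    qed
  qed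
  have leb: "abs_L1 (indicator A) \<in> D" if "A \<in> sets leb01" for A
  proof -
    from that have A: "A \<in> sets lebesgue" "A \<subseteq> {0..1}" by (auto simp: sets_restrict_space_iff)
    then obtain S N N' where SN: "A = S \<union> N" "N \<subseteq> N'" "N' \<in> null_sets lborel" "S \<in> sets borel"
      by (auto elim!: completionE simp: sets_completion)
    have "N' \<in> null_sets lebesgue" using SN by (simp add: null_sets_completionI)
    then have "AE t in lebesgue. t \<notin> N'" by (rule AE_not_in)
    then have "AE t in leb01. indicator ({0..1} \<inter> S) t = (indicator A t :: real)"
      using SN A by (auto simp: AE_restrict_space_iff indicator_def elim!: eventually_mono)
    then have "abs_L1 (indicator ({0..1} \<inter> S)) = abs_L1 (indicator A)"
      using that SN by (intro abs_L1_cong integrable_indicator_leb01 disjI2 borel_sets_leb01)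
    then show ?thesis using borel[OF SN(4)] by simp
  qed
  have "abs_L1 f \<in> D" if "integrable leb01 f" for f
    using that
  proof (induction rule: integrable_induct)
    case (base A c)
    then have "abs_L1 (\<lambda>t. indicator A t *\<^sub>R c) = c *\<^sub>R abs_L1 (indicator A)"
      by (simp add: L1_simps integrable_indicator_leb01 mult.commute)
    then show ?case using subspace_scale[OF sub leb] base by simp
  next
    case (add f g)
    then show ?case using subspace_add[OF sub, of "abs_L1 f" "abs_L1 g"] by (simp add: L1_simps)
  next
    case (lim f s)
    have "(\<lambda>i. abs_L1 (s i)) \<longlonglongrightarrow> abs_L1 f"
      by (rule abs_L1_tendsto[where w = "\<lambda>t. 2 * \<bar>f t\<bar>"]) (use lim in auto)
    then show ?case using closed_sequentially[OF cl, of "\<lambda>i. abs_L1 (s i)"] lim.IH by blast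
  qed
  then show ?thesis using L1_cases by (metis UNIV_eq_I)
qed

text \<open>
  Three epsilons: pointwise convergence of an equicontinuous sequence passes to limit points.
\<close>

lemma closed_convergent_set:
  fixes F :: "nat \<Rightarrow> 'a::real_normed_vector \<Rightarrow>\<^sub>L real"
  assumes "\<And>m. norm (F m) \<le> K"
  shows "closed {x. convergent (\<lambda>m. F m x)}"
proof -
  have "convergent (\<lambda>m. F m x)" if s: "\<And>i. convergent (\<lambda>m. F m (s i))" and lim: "s \<longlonglongrightarrow> x" for s x
  proof (rule Cauchy_convergent, rule metric_CauchyI)
    fix e :: real assume e: "e > 0"
    have K: "K \<ge> 0" using order_trans[OF norm_ge_zero assms] .
    have "\<forall>\<^sub>F i in sequentially. dist (s i) x < e / (3 * (K + 1))"
      using lim e K by (intro tendstoD) auto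
    then obtain i where i: "norm (s i - x) < e / (3 * (K + 1))"
      by (auto simp: dist_norm eventually_sequentially)
    have close: "\<bar>F m (s i) - F m x\<bar> < e / 3" for m
    proof -
      have "\<bar>F m (s i) - F m x\<bar> \<le> norm (F m) * norm (s i - x)"
        using norm_blinfun[of "F m" "s i - x"] by (simp add: blinfun.diff_right)
      also have "\<dots> \<le> (K + 1) * norm (s i - x)" using assms[of m] by (intro mult_right_mono) auto
      also have "\<dots> < (K + 1) * (e / (3 * (K + 1)))" using i K by (intro mult_strict_left_mono) auto
      also have "\<dots> = e / 3" using K by (simp add: field_simps)
      finally show ?thesis .
    qed
    obtain M where M: "\<And>m n. m \<ge> M \<Longrightarrow> n \<ge> M \<Longrightarrow> dist (F m (s i)) (F n (s i)) < e / 3"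
      using convergent_Cauchy[OF s[of i]] metric_CauchyD[of _ "e / 3"] e by (metis divide_pos_pos zero_less_numeral)
    have "dist (F m x) (F n x) < e" if "m \<ge> M" "n \<ge> M" for m n
      using M[OF that] close[of m] close[of n] unfolding dist_real_def by linarith
    then show "\<exists>M. \<forall>m\<ge>M. \<forall>n\<ge>M. dist (F m x) (F n x) < e" by blast
  qed
  then show ?thesis by (auto simp: closed_sequential_limits)
qed

lemma subspace_convergent_set:
  fixes F :: "nat \<Rightarrow> 'a::real_normed_vector \<Rightarrow>\<^sub>L real"
  shows "subspace {x. convergent (\<lambda>m. F m x)}"
  by (auto simp: subspace_def blinfun.add_right blinfun.scaleR_right intro: convergent_add convergent_mult convergent_const)

section \<open>The dual space\<close>

lemma integral_indicator_leb01: "A \<in> sets leb01 \<Longrightarrow> (\<I> t. indicator A t) = measure leb01 A"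
  by (simp only: Bochner_Integration.integral_indicator sets.Int_space_eq2)

lemma blinfun_eq_on_L1:
  fixes F G :: "L1 \<Rightarrow>\<^sub>L real"
  assumes "\<And>x. x \<in> \<rat> \<Longrightarrow> F (abs_L1 (indicator {..x})) = G (abs_L1 (indicator {..x}))"
  shows "F = G"
proof -
  have "{f. F f = G f} = UNIV"
  proof (rule L1_closed_subspace_eq_UNIV)
    show "subspace {f. F f = G f}"
      by (auto simp: subspace_def blinfun.add_right blinfun.scaleR_right)
    show "closed {f. F f = G f}"
      by (intro closed_Collect_eq continuous_intros)
  qed (use assms in auto)
  then show ?thesis by (intro blinfun_eqI) blast
qed

lemma L1_pairing_blinfun:
  assumes "L1_bounded K u" "K \<ge> 0"
  obtains F :: "L1 \<Rightarrow>\<^sub>L real" where "\<And>f. integrable leb01 f \<Longrightarrow> F (abs_L1 f) = (\<I> t. u t * f t)"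
    "norm F \<le> K"
proof -
  define F where "F x = (\<I> t. u t * rep_L1 x t)" for x
  have rep: "integrable leb01 (rep_L1 x) \<and> abs_L1 (rep_L1 x) = x" for x
    using Quotient_rep_reflp[OF Quotient_L1] Quotient_abs_rep[OF Quotient_L1] by metis
  have F: "F (abs_L1 f) = (\<I> t. u t * f t)" if f: "integrable leb01 f" for f
  proof -
    have "AE t in leb01. rep_L1 (abs_L1 f) t = f t"
      using rep[of "abs_L1 f"] f abs_L1_eq_iff by blast
    then have "AE t in leb01. u t * rep_L1 (abs_L1 f) t = u t * f t" by eventually_elim simp
    then show ?thesis unfolding F_def
      using assms f rep[of "abs_L1 f"]
      by (intro integral_cong_AE borel_measurable_integrable[OF integrable_bounded_mult]) auto
  qed
  have bl: "bounded_linear F"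
  proof (rule bounded_linear_intro[where K = K])
    fix x y :: L1 and c :: real
    obtain f g where fg: "integrable leb01 f" "x = abs_L1 f" "integrable leb01 g" "y = abs_L1 g"
      by (metis L1_cases)
    note m = integrable_bounded_mult[OF assms(1)]
    show "F (x + y) = F x + F y"
      using fg m[of f] m[of g] by (simp add: L1_simps F distrib_left)
    show "F (c *\<^sub>R x) = c *\<^sub>R F x"
      using fg m[of f] by (simp add: L1_simps F mult.left_commute)
    show "norm (F x) \<le> norm x * K"
      using fg abs_integral_bounded_mult[OF assms(1), of f] by (simp add: F L1_simps mult.commute[of _ K])
  qed
  show ?thesis
  proof
    show "Blinfun F (abs_L1 f) = (\<I> t. u t * f t)" if "integrable leb01 f" for f
      using F[OF that] bl by (simp add: bounded_linear_Blinfun_apply)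
    show "norm (Blinfun F) \<le> K"
    proof (rule norm_blinfun_bound[OF assms(2)])
      fix x :: L1
      obtain f where f: "integrable leb01 f" "x = abs_L1 f" by (metis L1_cases)
      show "norm (Blinfun F x) \<le> K * norm x"
        using f abs_integral_bounded_mult[OF assms(1) f(1)] bl
        by (simp add: F L1_simps bounded_linear_Blinfun_apply)
    qed
  qed
qed

text \<open>
  Adding $K$ times Lebesgue measure to the set function of $F$ makes it a positive measure, whose
  Radon-Nikodym derivative minus $K$ is the density. The bound $|F(1_A)| \le K |A|$ for all $A$
  forces the density into $[-K, K]$ almost everywhere, after which it may be truncated.
\<close>

lemma L1_dual:
  fixes F :: "L1 \<Rightarrow>\<^sub>L real"
  assumes K: "norm F \<le> K"
  obtains u where "L1_bounded K u" "\<And>f. integrable leb01 f \<Longrightarrow> F (abs_L1 f) = (\<I> t. u t * f t)"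
proof -
  have K0: "K \<ge> 0" using K norm_ge_zero order_trans by blast
  define \<nu> where "\<nu> A = F (abs_L1 (indicator A)) + K * measure leb01 A" for A
  have bound: "\<bar>F (abs_L1 (indicator A))\<bar> \<le> K * measure leb01 A" if "A \<in> sets leb01" for A
  proof -
    have "\<bar>F (abs_L1 (indicator A))\<bar> \<le> norm F * norm (abs_L1 (indicator A))"
      using norm_blinfun[of F "abs_L1 (indicator A)"] by simp
    also have "\<dots> \<le> K * norm (abs_L1 (indicator A))" using K by (intro mult_right_mono) auto
    also have "norm (abs_L1 (indicator A)) = measure leb01 A"
      using that by (simp add: L1_simps integrable_indicator_leb01 integral_indicator_leb01 del: Bochner_Integration.integral_indicator)
    finally show ?thesis .
  qed
  have \<nu>0: "\<nu> A \<ge> 0" if "A \<in> sets leb01" for A using bound[OF that] unfolding \<nu>_def by linarith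
  define N where "N = measure_of (space leb01) (sets leb01) (\<lambda>A. ennreal (\<nu> A))"
  have N: "emeasure N A = ennreal (\<nu> A)" if A: "A \<in> sets leb01" for A
    unfolding N_def
  proof (rule emeasure_measure_of_sigma[OF sets.sigma_algebra_axioms _ _ A])
    have "(indicator {} :: real \<Rightarrow> real) = (\<lambda>_. 0)" by auto
    then have "abs_L1 (indicator {}) = 0" by (simp add: zero_L1_def)
    then show "positive (sets leb01) (\<lambda>A. ennreal (\<nu> A))"
      by (simp add: positive_def \<nu>_def blinfun.zero_right)
    show "countably_additive (sets leb01) (\<lambda>A. ennreal (\<nu> A))"
    proof (rule countably_additiveI)
      fix B :: "nat \<Rightarrow> real set"
      assume B: "range B \<subseteq> sets leb01" "disjoint_family B" "\<Union> (range B) \<in> sets leb01"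
      then have "(\<lambda>i. abs_L1 (indicator (B i))) sums abs_L1 (indicator (\<Union>i. B i))"
        by (intro abs_L1_indicator_sums) auto
      then have "(\<lambda>i. F (abs_L1 (indicator (B i)))) sums F (abs_L1 (indicator (\<Union>i. B i)))"
        by (rule bounded_linear.sums[OF blinfun.bounded_linear_right])
      moreover have "(\<lambda>i. K * measure leb01 (B i)) sums (K * measure leb01 (\<Union>i. B i))"
        using B by (intro sums_mult leb01.finite_measure_UNION)
      ultimately have "(\<lambda>i. \<nu> (B i)) sums \<nu> (\<Union>i. B i)"
        unfolding \<nu>_def by (rule sums_add)
      then show "(\<Sum>i. ennreal (\<nu> (B i))) = ennreal (\<nu> (\<Union> (range B)))"
        using B by (intro suminf_ennreal_eq) (auto intro: \<nu>0)
    qed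
  qed
  have setsN: "sets N = sets leb01"
    unfolding N_def sets_measure_of[OF sets.space_closed] by (rule sets.sigma_sets_eq)
  then have spN: "space N = space leb01" by (rule sets_eq_imp_space_eq)
  have Nsp: "emeasure N (space leb01) = ennreal (\<nu> (space leb01))" by (rule N[OF sets.top])
  have finN: "finite_measure N"
    by (rule finite_measureI) (simp only: spN Nsp infinity_ennreal_def ennreal_neq_top not_False_eq_True)
  have ac: "absolutely_continuous leb01 N"
    unfolding absolutely_continuous_def
  proof
    fix A assume "A \<in> null_sets leb01"
    then have A: "A \<in> sets leb01" "measure leb01 A = 0" by (blast intro: measure_eq_0_null_sets)+
    with bound[OF A(1)] have "F (abs_L1 (indicator A)) = 0" by (simp only: A(2) mult_zero_right abs_le_zero_iff)
    then have "\<nu> A = 0" by (simp only: \<nu>_def A(2) mult_zero_right add_0)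
    then have "emeasure N A = 0" using N[OF A(1)] by simp
    then show "A \<in> null_sets N" using A(1) setsN by (intro null_setsI) simp_all
  qed
  obtain D where D: "D \<in> borel_measurable leb01" "AE x in leb01. RN_deriv leb01 N x = ennreal (D x)"
    "\<And>x. 0 \<le> D x"
    by (rule leb01.real_RN_deriv[OF finN ac setsN]) blast
  have Dm: "(\<lambda>x. ennreal (D x)) \<in> borel_measurable leb01"
    using D(1) by (rule measurable_compose) (rule measurable_ennreal)
  have dens: "density leb01 (\<lambda>x. ennreal (D x)) = N"
  proof -
    have "density leb01 (RN_deriv leb01 N) = density leb01 (\<lambda>x. ennreal (D x))"
      by (rule density_cong[OF borel_measurable_RN_deriv Dm D(2)])
    then show ?thesis by (simp only: leb01.density_RN_deriv[OF ac setsN])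
  qed
  have N': "ennreal (\<nu> A) = (\<integral>\<^sup>+t. ennreal (D t) * indicator A t \<partial>leb01)" if A: "A \<in> sets leb01" for A
    unfolding N[OF A, symmetric] dens[symmetric] by (rule emeasure_density[OF Dm A])
  have Dint: "integrable leb01 D"
  proof (rule integrableI_nonneg)
    have "(\<integral>\<^sup>+x. ennreal (D x) \<partial>leb01) = (\<integral>\<^sup>+x. ennreal (D x) * indicator (space leb01) x \<partial>leb01)"
      by (rule nn_integral_cong) (simp only: indicator_simps mult_1_right)
    also have "\<dots> = ennreal (\<nu> (space leb01))" by (rule N'[symmetric]) (rule sets.top)
    also have "\<dots> < \<infinity>" by (simp only: ennreal_less_top infinity_ennreal_def)
    finally show "(\<integral>\<^sup>+x. ennreal (D x) \<partial>leb01) < \<infinity>" .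
    show "AE x in leb01. 0 \<le> D x" using D(3) by (intro AE_I2)
  qed (rule D(1))
  define v where "v t = D t - K" for t
  have vint: "integrable leb01 v" unfolding v_def using Dint by simp
  have v: "F (abs_L1 (indicator A)) = (\<I> t. indicator A t * v t)" if A: "A \<in> sets leb01" for A
  proof -
    have "ennreal (\<nu> A) = (\<integral>\<^sup>+t. ennreal (D t) * indicator A t \<partial>leb01)"
      by (rule N'[OF A])
    also have "\<dots> = (\<integral>\<^sup>+t. ennreal (indicator A t * D t) \<partial>leb01)"
      by (intro nn_integral_cong) (auto simp: indicator_def)
    also have "\<dots> = ennreal (\<I> t. indicator A t * D t)"
      using D A Dint by (intro nn_integral_eq_integral integrable_indicator_mult) auto
    finally have "\<nu> A = (\<I> t. indicator A t * D t)"
      using \<nu>0[OF A] D(3) by (subst (asm) ennreal_inj) (auto intro!: integral_nonneg_AE)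
    moreover have "(\<I> t. indicator A t * v t) = (\<I> t. indicator A t * D t) - (\<I> t. K * indicator A t)"
      using A Dint integrable_indicator_mult[of A D] integrable_indicator_leb01[of A]
      by (subst Bochner_Integration.integral_diff[symmetric])
        (auto simp: v_def algebra_simps simp del: integrable_indicator_iff)
    ultimately show ?thesis
      using integral_indicator_leb01[OF A] by (simp add: \<nu>_def del: Bochner_Integration.integral_indicator)
  qed
  have sgn_null: "AE t in leb01. \<not> s * v t > K" if s: "\<bar>s\<bar> = 1" for s :: real
  proof -
    define A where "A = {t \<in> space leb01. s * v t > K}"
    have A: "A \<in> sets leb01" unfolding A_def using vint by measurable
    have i1: "integrable leb01 (\<lambda>t. indicator A t * v t)" and i2: "integrable leb01 (\<lambda>t. K * indicator A t)"
      using A vint integrable_indicator_mult[of A v] integrable_indicator_leb01[of A] by (auto simp del: integrable_indicator_iff)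
    have "(\<I> t. s * (indicator A t * v t) - K * indicator A t)
      = s * F (abs_L1 (indicator A)) - K * measure leb01 A"
      using i1 i2 v[OF A] integral_indicator_leb01[OF A] by (simp del: Bochner_Integration.integral_indicator)
    also have "\<dots> \<le> 0" using bound[OF A] s by (auto simp: abs_if split: if_splits)
    finally have le: "(\<I> t. s * (indicator A t * v t) - K * indicator A t) \<le> 0" .
    have nn: "AE t in leb01. 0 \<le> s * (indicator A t * v t) - K * indicator A t"
      by (intro AE_I2) (auto simp: A_def indicator_def)
    have "(\<I> t. s * (indicator A t * v t) - K * indicator A t) = 0"
      using le integral_nonneg_AE[OF nn] by linarith
    then have "AE t in leb01. s * (indicator A t * v t) - K * indicator A t = 0"
      by (subst (asm) integral_nonneg_eq_0_iff_AE[OF _ nn]) (use i1 i2 in auto)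
    then show ?thesis by (rule AE_mp) (auto simp: A_def indicator_def intro!: AE_I2)
  qed
  \<comment> \<open>Truncation changes the density on a null set only.\<close>
  define u where "u t = max (-K) (min K (v t))" for t
  have uv: "AE t in leb01. u t = v t"
    using sgn_null[of 1, simplified] sgn_null[of "-1", simplified]
    by eventually_elim (auto simp: u_def)
  have ub: "L1_bounded K u"
    using vint K0 unfolding u_def by (auto simp: abs_le_iff)
  obtain G :: "L1 \<Rightarrow>\<^sub>L real" where G: "\<And>f. integrable leb01 f \<Longrightarrow> G (abs_L1 f) = (\<I> t. u t * f t)"
    using L1_pairing_blinfun[OF ub K0] by metis
  have "F = G"
  proof (rule blinfun_eq_on_L1)
    fix x :: real
    define A where "A = {0..1} \<inter> {..x}"
    have A: "A \<in> sets leb01" unfolding A_def by (rule borel_sets_leb01) simp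
    have eq: "abs_L1 (indicator {..x}) = abs_L1 (indicator A)"
      by (rule abs_L1_cong)
        (use A in \<open>auto simp: A_def AE_restrict_space_iff indicator_def intro!: integrable_indicator_leb01 simp del: integrable_indicator_iff\<close>)
    have "(\<I> t. indicator A t * v t) = (\<I> t. u t * indicator A t)"
    proof (rule integral_cong_AE)
      show "AE t in leb01. indicator A t * v t = u t * indicator A t"
        using uv by eventually_elim simp
    qed (use A ub vint in auto)
    then show "F (abs_L1 (indicator {..x})) = G (abs_L1 (indicator {..x}))"
      unfolding eq v[OF A] using A by (subst G) (auto intro!: integrable_indicator_leb01 simp del: integrable_indicator_iff)
  qed
  with that[OF ub] G show ?thesis by blast
qed

section \<open>Weak-star compactness and uniform integrability\<close>

text \<open>
  A bounded sequence of points lies in a compact metrizable product of intervals.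
\<close>

lemma pointwise_convergent_subseq:
  fixes x :: "nat \<Rightarrow> 'a \<Rightarrow> real"
  assumes S: "countable S" and bd: "\<And>m s. s \<in> S \<Longrightarrow> \<bar>x m s\<bar> \<le> K s"
  obtains r where "strict_mono (r :: nat \<Rightarrow> nat)" "\<And>s. s \<in> S \<Longrightarrow> convergent (\<lambda>m. x (r m) s)"
proof (cases "S = {}")
  case True
  then show ?thesis using that[of id] by (auto simp: strict_mono_id)
next
  case False
  define e where "e = from_nat_into S"
  have e: "e i \<in> S" for i unfolding e_def using False by (rule from_nat_into)
  define C where "C = PiE UNIV (\<lambda>i. {- K (e i)..K (e i)})"
  have "compactin (product_topology (\<lambda>_. euclidean) UNIV) C"
    unfolding C_def by (subst compactin_PiE) auto
  then have "compact C" by (simp add: euclidean_product_topology)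
  then have "seq_compact C" by (rule compact_imp_seq_compact)
  moreover have "\<forall>m. (\<lambda>i. x m (e i)) \<in> C"
    using bd[OF e] unfolding C_def by (auto simp: abs_le_iff minus_le_iff)
  ultimately obtain l r where r: "strict_mono (r :: nat \<Rightarrow> nat)" "((\<lambda>m i. x m (e i)) \<circ> r) \<longlonglongrightarrow> l"
    by (rule seq_compactE)
  have conv: "convergent (\<lambda>m. x (r m) (e i))" for i
  proof -
    have "isCont (\<lambda>f :: nat \<Rightarrow> real. f i) l"
      by (rule continuous_on_interior[OF continuous_on_product_coordinates[of i]]) simp
    from isCont_tendsto_compose[OF this r(2)] show ?thesis
      by (auto simp: convergent_def o_def)
  qed
  show ?thesis
  proof (rule that[OF r(1)])
    fix s assume "s \<in> S"
    then obtain i where "s = e i" unfolding e_def using from_nat_into_surj[OF S] by metis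
    then show "convergent (\<lambda>m. x (r m) s)" using conv by simp
  qed
qed

lemma L1_functionals_convergent_subseq:
  fixes F :: "nat \<Rightarrow> L1 \<Rightarrow>\<^sub>L real"
  assumes K: "\<And>m. norm (F m) \<le> K"
    and half: "\<And>x. x \<in> \<rat> \<Longrightarrow> convergent (\<lambda>m. F m (abs_L1 (indicator {..x})))"
  shows "convergent (\<lambda>m. F m f)"
proof -
  have "{f. convergent (\<lambda>m. F m f)} = UNIV"
    by (rule L1_closed_subspace_eq_UNIV[OF subspace_convergent_set closed_convergent_set[OF K]])
      (simp add: half)
  then have "f \<in> {f. convergent (\<lambda>m. F m f)}" by (simp only: UNIV_I)
  then show ?thesis by (rule CollectD)
qed

lemma L1_pairing_blinfun_seq:
  assumes u: "\<And>m. L1_bounded K (u m)"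
  obtains F :: "nat \<Rightarrow> L1 \<Rightarrow>\<^sub>L real" where
    "\<And>m f. integrable leb01 f \<Longrightarrow> F m (abs_L1 f) = (\<I> t. u m t * f t)" "\<And>m. norm (F m) \<le> K"
proof -
  have "\<bar>u 0 0\<bar> \<le> K" using u by blast
  then have K: "K \<ge> 0" using abs_ge_zero order_trans by blast
  have "\<forall>m. \<exists>F :: L1 \<Rightarrow>\<^sub>L real. (\<forall>f. integrable leb01 f \<longrightarrow> blinfun_apply F (abs_L1 f) = (\<I> t. u m t * f t)) \<and> norm F \<le> K"
    using L1_pairing_blinfun[OF u K] by blast
  from choice[OF this] obtain F :: "nat \<Rightarrow> L1 \<Rightarrow>\<^sub>L real" where
    "\<forall>m. (\<forall>f. integrable leb01 f \<longrightarrow> F m (abs_L1 f) = (\<I> t. u m t * f t)) \<and> norm (F m) \<le> K" by blast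
  then have F: "integrable leb01 f \<Longrightarrow> F m (abs_L1 f) = (\<I> t. u m t * f t)"
    "norm (F m) \<le> K" for m f by blast+
  show thesis by (rule that) (rule F, assumption, rule F)
qed

lemma L1_weak_star_subseq:
  assumes u: "\<And>m. L1_bounded K (u m)"
  obtains r where "strict_mono (r :: nat \<Rightarrow> nat)"
    "\<And>f. integrable leb01 f \<Longrightarrow> convergent (\<lambda>m. \<I> t. u (r m) t * f t)"
proof -
  obtain F :: "nat \<Rightarrow> L1 \<Rightarrow>\<^sub>L real" where
    F: "\<And>m f. integrable leb01 f \<Longrightarrow> F m (abs_L1 f) = (\<I> t. u m t * f t)" "\<And>m. norm (F m) \<le> K"
  proof (rule L1_pairing_blinfun_seq[OF u])
    fix F :: "nat \<Rightarrow> L1 \<Rightarrow>\<^sub>L real"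
    assume 1: "\<And>m f. integrable leb01 f \<Longrightarrow> F m (abs_L1 f) = (\<I> t. u m t * f t)" and 2: "\<And>m. norm (F m) \<le> K"
    show thesis by (rule that[OF 1 2])
  qed
  obtain r where r: "strict_mono (r :: nat \<Rightarrow> nat)"
    "\<And>x. x \<in> \<rat> \<Longrightarrow> convergent (\<lambda>m. F (r m) (abs_L1 (indicator {..x})))"
  proof (rule pointwise_convergent_subseq[of \<rat> "\<lambda>m x. F m (abs_L1 (indicator {..x}))"
        "\<lambda>x. K * norm (abs_L1 (indicator {..x}))"])
    show "\<bar>F m (abs_L1 (indicator {..x}))\<bar> \<le> K * norm (abs_L1 (indicator {..x}))" for m x
      using order_trans[OF norm_blinfun mult_right_mono[OF F(2) norm_ge_zero]] by simp
  qed (auto simp: countable_rat)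
  show ?thesis
  proof (rule that[OF r(1)])
    fix f :: "real \<Rightarrow> real" assume "integrable leb01 f"
    then show "convergent (\<lambda>m. \<I> t. u (r m) t * f t)"
      using L1_functionals_convergent_subseq[of "\<lambda>m. F (r m)" K "abs_L1 f"] F r(2) by simp
  qed
qed

text \<open>
  Absolute continuity of the integral of a single function, tested by functions that are small in
  $L_1$-norm instead of by sets of small measure.
\<close>

lemma integral_abs_mult_small:
  assumes g: "integrable leb01 g" and e: "e > 0"
  obtains r where "r > 0"
    "\<And>h. L1_bounded 1 h \<Longrightarrow> (\<I> t. \<bar>h t\<bar>) < r \<Longrightarrow> (\<I> t. \<bar>h t\<bar> * \<bar>g t\<bar>) < e"
proof -
  define tail where "tail c t = (if \<bar>g t\<bar> > real c then \<bar>g t\<bar> else 0)" for c t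
  have tailm: "tail c \<in> borel_measurable leb01" for c
    unfolding tail_def using g by measurable
  have taili: "integrable leb01 (tail c)" for c
    by (rule Bochner_Integration.integrable_bound[OF g tailm]) (auto simp: tail_def)
  have "(\<lambda>c. \<I> t. tail c t) \<longlonglongrightarrow> (\<I> t. 0)"
  proof (rule integral_dominated_convergence[where w = "\<lambda>t. \<bar>g t\<bar>"])
    have "(\<lambda>c. tail c t) \<longlonglongrightarrow> 0" for t
    proof (rule tendsto_eventually)
      obtain N where "\<bar>g t\<bar> \<le> real N" using real_arch_simple by blast
      then show "\<forall>\<^sub>F c in sequentially. tail c t = 0"
        unfolding eventually_sequentially tail_def by (intro exI[of _ N]) auto
    qed
    then show "AE t in leb01. (\<lambda>c. tail c t) \<longlonglongrightarrow> 0" by simp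
  qed (use g tailm in \<open>auto simp: tail_def\<close>)
  then have "\<forall>\<^sub>F c in sequentially. (\<I> t. tail c t) < e / 2"
    using e by (intro order_tendstoD(2)) auto
  then obtain c where c: "(\<I> t. tail c t) < e / 2"
    by (auto simp: eventually_sequentially)
  show ?thesis
  proof (rule that[of "e / (2 * (real c + 1))"])
    fix h assume h: "L1_bounded 1 h" "(\<I> t. \<bar>h t\<bar>) < e / (2 * (real c + 1))"
    have hi: "integrable leb01 (\<lambda>t. \<bar>h t\<bar>)" using integrable_bounded[OF h(1)] by simp
    have pt: "\<bar>h t\<bar> * \<bar>g t\<bar> \<le> (real c + 1) * \<bar>h t\<bar> + tail c t" for t
    proof (cases "\<bar>g t\<bar> > real c")
      case True
      have "\<bar>h t\<bar> * \<bar>g t\<bar> \<le> 1 * \<bar>g t\<bar>" using h(1) by (intro mult_right_mono) auto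
      moreover have "(real c + 1) * \<bar>h t\<bar> \<ge> 0" by simp
      moreover have "tail c t = \<bar>g t\<bar>" using True by (simp add: tail_def)
      ultimately show ?thesis by linarith
    next
      case False
      then have "\<bar>h t\<bar> * \<bar>g t\<bar> \<le> \<bar>h t\<bar> * (real c + 1)" by (intro mult_left_mono) auto
      then show ?thesis using False by (simp add: tail_def mult.commute)
    qed
    have "(\<I> t. \<bar>h t\<bar> * \<bar>g t\<bar>) \<le> (\<I> t. (real c + 1) * \<bar>h t\<bar> + tail c t)"
    proof (rule integral_mono)
      show "integrable leb01 (\<lambda>t. \<bar>h t\<bar> * \<bar>g t\<bar>)"
        using integrable_abs[OF integrable_bounded_mult[OF h(1) g]] by (simp add: abs_mult)
    qed (use hi taili pt in auto)
    also have "\<dots> = (real c + 1) * (\<I> t. \<bar>h t\<bar>) + (\<I> t. tail c t)"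
      using hi taili by simp
    also have "\<dots> < (real c + 1) * (e / (2 * (real c + 1))) + e / 2"
      by (intro add_strict_mono mult_strict_left_mono h(2) c) auto
    also have "\<dots> = e" by (simp add: field_simps)
    finally show "(\<I> t. \<bar>h t\<bar> * \<bar>g t\<bar>) < e" .
  qed (use e in auto)
qed

text \<open>
  Uniform integrability of weakly null sequences, by a gliding hump: otherwise there are indices $n_j$
  and functions $h_j$ with values in $[-1,1]$ and rapidly decreasing $L_1$-norm such that
  $\int h_j f_{n_j}$ stays large. Starting from $g$ with values in $[-1,1]$, let $a$ be $g + h_j$
  truncated to $[-1,1]$ and $b = a - h_j$. Both stay in $[-1,1]$ and within $|h_j|$ of $g$, and one of
  them has a large integral against $f_{n_j}$ as they differ by $h_j$. Iteration converges to one
  function $G$ with values in $[-1,1]$ whose integrals against the $f_{n_j}$ do not tend to zero.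
\<close>

lemma weakly_null_equi_integrable:
  fixes f :: "nat \<Rightarrow> real \<Rightarrow> real"
  assumes f: "\<And>n. integrable leb01 (f n)"
    and null: "\<And>h. L1_bounded 1 h \<Longrightarrow> (\<lambda>n. \<I> t. h t * f n t) \<longlonglongrightarrow> 0"
    and e: "e > 0"
  obtains r N where "r > 0"
    "\<And>n h. n \<ge> N \<Longrightarrow> L1_bounded 1 h \<Longrightarrow> (\<I> t. \<bar>h t\<bar>) < r \<Longrightarrow> \<bar>\<I> t. h t * f n t\<bar> < e"
proof (rule ccontr)
  assume "\<not> thesis"
  with that have neg: "\<exists>n\<ge>N. \<exists>h. L1_bounded 1 h \<and> (\<I> t. \<bar>h t\<bar>) < r \<and> e \<le> \<bar>\<I> t. h t * f n t\<bar>"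
    if "r > 0" for r N using that by (meson not_less)
  \<comment> \<open>A state is the current index with the current function; all earlier integrals are protected.\<close>
  define Q where "Q j p q \<longleftrightarrow> fst p < fst q \<and> L1_bounded 1 (snd q) \<and>
      e / 2 \<le> \<bar>\<I> t. snd q t * f (fst q) t\<bar> \<and>
      (\<I> t. \<bar>snd q t - snd p t\<bar>) \<le> (1/2)^j \<and>
      (\<forall>l\<le>fst p. (\<I> t. \<bar>snd q t - snd p t\<bar> * \<bar>f l t\<bar>) \<le> e / 8 * (1/2)^j)"
    for j :: nat and p q :: "nat \<times> (real \<Rightarrow> real)"
  have step: "\<exists>q. L1_bounded 1 (snd q) \<and> Q j p q" if p: "L1_bounded 1 (snd p)" for j p
  proof -
    obtain N g where Ng: "p = (N, g)" by force
    note g = p[unfolded Ng snd_conv]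
    define F where "F t = (\<Sum>l\<le>N. \<bar>f l t\<bar>)" for t
    have Fi: "integrable leb01 F" unfolding F_def using f by auto
    have eta: "e / 8 * (1/2)^j > 0" using e by simp
    obtain r where r: "r > 0" "\<And>h. L1_bounded 1 h \<Longrightarrow> (\<I> t. \<bar>h t\<bar>) < r \<Longrightarrow>
        (\<I> t. \<bar>h t\<bar> * \<bar>F t\<bar>) < e / 8 * (1/2)^j"
      using integral_abs_mult_small[OF Fi eta] by blast
    obtain n h where nh: "n \<ge> Suc N" "L1_bounded 1 h" "(\<I> t. \<bar>h t\<bar>) < min r ((1/2)^j)"
      "e \<le> \<bar>\<I> t. h t * f n t\<bar>"
      using neg[of "min r ((1/2)^j)" "Suc N"] r(1) by auto
    define a where "a t = max (-1) (min 1 (g t + h t))" for t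
    define b where "b t = a t - h t" for t
    have g1: "- 1 \<le> g t" "g t \<le> 1" and h1: "- 1 \<le> h t" "h t \<le> 1" for t
      using g nh(2) by (auto simp: abs_le_iff minus_le_iff)
    have ab: "L1_bounded 1 a" "L1_bounded 1 b"
    proof -
      show "L1_bounded 1 a" unfolding a_def using g nh(2) by (auto simp: abs_le_iff)
      have "\<bar>b t\<bar> \<le> 1" for t unfolding b_def a_def abs_le_iff using g1[of t] h1[of t] by linarith
      then show "L1_bounded 1 b" unfolding b_def a_def using g nh(2) by auto
    qed
    have near: "\<bar>a t - g t\<bar> \<le> \<bar>h t\<bar>" "\<bar>b t - g t\<bar> \<le> \<bar>h t\<bar>" for t
      unfolding b_def a_def using g1[of t] h1[of t] by linarith+
    have "(\<I> t. h t * f n t) = (\<I> t. a t * f n t) - (\<I> t. b t * f n t)"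
      unfolding Bochner_Integration.integral_diff[OF integrable_bounded_mult[OF ab(1) f] integrable_bounded_mult[OF ab(2) f], symmetric]
      by (rule Bochner_Integration.integral_cong) (auto simp: b_def algebra_simps)
    with nh(4) have "e / 2 \<le> \<bar>\<I> t. a t * f n t\<bar> \<or> e / 2 \<le> \<bar>\<I> t. b t * f n t\<bar>"
      by linarith
    then obtain c where c: "L1_bounded 1 c" "\<And>t. \<bar>c t - g t\<bar> \<le> \<bar>h t\<bar>"
      "e / 2 \<le> \<bar>\<I> t. c t * f n t\<bar>" using ab near by blast
    have hi: "integrable leb01 (\<lambda>t. \<bar>h t\<bar>)" and ci: "integrable leb01 (\<lambda>t. \<bar>c t - g t\<bar>)"
      using integrable_bounded[OF nh(2)] integrable_bounded[OF c(1)] integrable_bounded[OF g] by auto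
    have "(\<I> t. \<bar>c t - g t\<bar>) \<le> (\<I> t. \<bar>h t\<bar>)"
      by (rule integral_mono[OF ci hi c(2)])
    moreover have "(\<I> t. \<bar>c t - g t\<bar> * \<bar>f l t\<bar>) \<le> e / 8 * (1/2)^j" if l: "l \<le> N" for l
    proof -
      have hF: "integrable leb01 (\<lambda>t. \<bar>h t\<bar> * \<bar>F t\<bar>)"
        using integrable_abs[OF integrable_bounded_mult[OF nh(2) Fi]] by (simp only: abs_mult)
      have "(\<I> t. \<bar>c t - g t\<bar> * \<bar>f l t\<bar>) \<le> (\<I> t. \<bar>h t\<bar> * \<bar>F t\<bar>)"
      proof (rule integral_mono'[OF hF])
        fix t
        have "\<bar>f l t\<bar> \<le> F t" unfolding F_def using l by (intro member_le_sum) auto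
        then show "\<bar>c t - g t\<bar> * \<bar>f l t\<bar> \<le> \<bar>h t\<bar> * \<bar>F t\<bar>" by (intro mult_mono c(2)) auto
      qed auto
      also have "\<dots> \<le> e / 8 * (1/2)^j" using r(2)[OF nh(2)] nh(3) by (intro less_imp_le) auto
      finally show ?thesis .
    qed
    ultimately have "L1_bounded 1 (snd (n, c)) \<and> Q j p (n, c)"
      unfolding Q_def Ng fst_conv snd_conv using nh(1,3) c by auto
    then show ?thesis by blast
  qed
  have "\<exists>s. \<forall>j. L1_bounded 1 (snd (s j)) \<and> Q j (s j) (s (Suc j))"
  proof (rule dependent_nat_choice)
    show "\<exists>p :: nat \<times> (real \<Rightarrow> real). L1_bounded 1 (snd p)"
      by (rule exI[of _ "(0, \<lambda>_. 0)"]) auto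
  qed (use step in blast)
  then obtain s where s: "\<And>j. L1_bounded 1 (snd (s j))" "\<And>j. Q j (s j) (s (Suc j))" by blast
  define n where "n j = fst (s j)" for j
  define g where "g j = snd (s j)" for j
  have g: "L1_bounded 1 (g j)" for j unfolding g_def by (rule s(1))
  have Qs: "n j < n (Suc j) \<and> L1_bounded 1 (g (Suc j)) \<and>
      e / 2 \<le> \<bar>\<I> t. g (Suc j) t * f (n (Suc j)) t\<bar> \<and>
      (\<I> t. \<bar>g (Suc j) t - g j t\<bar>) \<le> (1/2)^j \<and>
      (\<forall>l\<le>n j. (\<I> t. \<bar>g (Suc j) t - g j t\<bar> * \<bar>f l t\<bar>) \<le> e / 8 * (1/2)^j)" for j
    using s(2)[of j] unfolding Q_def n_def g_def .
  note n = Qs[THEN conjunct1] and big = Qs[THEN conjunct2, THEN conjunct2, THEN conjunct1]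
    and close = Qs[THEN conjunct2, THEN conjunct2, THEN conjunct2, THEN conjunct1]
    and closef = Qs[THEN conjunct2, THEN conjunct2, THEN conjunct2, THEN conjunct2, rule_format]
  have smn: "strict_mono n" using n by (simp add: strict_mono_Suc_iff)
  have di: "integrable leb01 (\<lambda>t. \<bar>g (Suc j) t - g j t\<bar>)" for j
    using integrable_bounded[OF g[of j]] integrable_bounded[OF g[of "Suc j"]] by auto
  have AEconv: "AE t in leb01. convergent (\<lambda>j. g j t)"
  proof -
    have gm: "\<And>j. g j \<in> borel_measurable leb01" using g by blast
    have "(\<integral>\<^sup>+t. (\<Sum>j. ennreal \<bar>g (Suc j) t - g j t\<bar>) \<partial>leb01) = (\<Sum>j. \<integral>\<^sup>+t. ennreal \<bar>g (Suc j) t - g j t\<bar> \<partial>leb01)"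
      by (rule nn_integral_suminf) (use gm in measurable)
    also have "\<dots> = (\<Sum>j. ennreal (\<I> t. \<bar>g (Suc j) t - g j t\<bar>))"
      by (intro suminf_cong nn_integral_eq_integral di) auto
    also have "\<dots> \<le> (\<Sum>j. ennreal ((1/2)^j))"
      by (intro suminf_le ennreal_leI close) auto
    also have "\<dots> = ennreal (\<Sum>j. (1/2)^j)"
      by (rule suminf_ennreal2) (auto intro: summable_geometric)
    also have "\<dots> < \<infinity>" by simp
    finally have fin: "(\<integral>\<^sup>+t. (\<Sum>j. ennreal \<bar>g (Suc j) t - g j t\<bar>) \<partial>leb01) < \<infinity>" .
    have "(\<lambda>t. (\<Sum>j. ennreal \<bar>g (Suc j) t - g j t\<bar>)) \<in> borel_measurable leb01"
      using gm by measurable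
    then have "AE t in leb01. (\<Sum>j. ennreal \<bar>g (Suc j) t - g j t\<bar>) \<noteq> \<infinity>"
      using less_imp_neq[OF fin] by (rule nn_integral_PInf_AE)
    then show ?thesis
    proof eventually_elim
      case (elim t)
      have "summable (\<lambda>j. \<bar>g (Suc j) t - g j t\<bar>)"
        by (rule summable_suminf_not_top) (use elim in auto)
      then have "summable (\<lambda>j. g (Suc j) t - g j t)" by (rule summable_rabs_cancel)
      then have "convergent (\<lambda>m. (\<Sum>j<m. g (Suc j) t - g j t) + g 0 t)"
        by (intro convergent_add convergent_const) (simp add: summable_iff_convergent)
      then show ?case by (simp add: sum_lessThan_telescope[of "\<lambda>j. g j t"])
    qed
  qed
  \<comment> \<open>The truncation only serves points where the sequence diverges.\<close>
  define G where "G t = max (-1) (min 1 (lim (\<lambda>j. g j t)))" for t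
  have Gb: "L1_bounded 1 G"
  proof
    have gm: "\<And>j. g j \<in> borel_measurable leb01" using g by blast
    have "(\<lambda>t. lim (\<lambda>j. g j t)) \<in> borel_measurable leb01"
      by (rule borel_measurable_lim_metric[OF gm])
    then show "G \<in> borel_measurable leb01" unfolding G_def by measurable
  qed (auto simp: G_def abs_le_iff)
  have limG: "AE t in leb01. (\<lambda>j. g j t) \<longlonglongrightarrow> G t"
    using AEconv
  proof eventually_elim
    case (elim t)
    then have L: "(\<lambda>j. g j t) \<longlonglongrightarrow> lim (\<lambda>j. g j t)" by (simp add: convergent_LIMSEQ_iff)
    have b: "-1 \<le> g j t" "g j t \<le> 1" for j using g[of j] by (auto simp: abs_le_iff minus_le_iff)
    have "-1 \<le> lim (\<lambda>j. g j t)" "lim (\<lambda>j. g j t) \<le> 1"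
      using LIMSEQ_le_const[OF L, of "-1"] LIMSEQ_le_const2[OF L, of 1] b by auto
    then show ?case using L by (simp add: G_def)
  qed
  \<comment> \<open>All corrections made after step j together change the j-th integral by at most e / 4.\<close>
  have low: "e / 4 \<le> \<bar>\<I> t. G t * f (n (Suc j)) t\<bar>" for j
  proof -
    let ?f = "f (n (Suc j))"
    let ?I = "\<lambda>i. \<I> t. g i t * ?f t"
    have gi: "integrable leb01 (\<lambda>t. g i t * ?f t)" for i by (rule integrable_bounded_mult[OF g f])
    have diff: "\<bar>?I (Suc j + d) - ?I (Suc j)\<bar> \<le> e / 8 * (\<Sum>k<d. (1/2)^k)" for d
    proof (induction d)
      case (Suc d)
      let ?i = "Suc j + d"
      have "\<bar>?I (Suc ?i) - ?I ?i\<bar> = \<bar>\<I> t. g (Suc ?i) t * ?f t - g ?i t * ?f t\<bar>"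
        by (subst Bochner_Integration.integral_diff[OF gi gi]) simp
      also have "\<dots> \<le> (\<I> t. \<bar>g (Suc ?i) t * ?f t - g ?i t * ?f t\<bar>)"
        by (rule integral_abs_bound)
      also have "\<dots> = (\<I> t. \<bar>g (Suc ?i) t - g ?i t\<bar> * \<bar>?f t\<bar>)"
        by (simp only: abs_mult[symmetric] left_diff_distrib)
      also have "\<dots> \<le> e / 8 * (1/2)^?i"
        by (rule closef) (use smn in \<open>simp add: strict_mono_less_eq\<close>)
      also have "\<dots> \<le> e / 8 * (1/2)^d"
        using e by (intro mult_left_mono power_decreasing) auto
      finally show ?case using Suc
        unfolding sum.lessThan_Suc distrib_left add_Suc_right by linarith
    qed simp
    have geo: "(\<Sum>k<d. (1/2)^k) \<le> (2::real)" for d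
    proof -
      have "(\<Sum>k<d. (1/2)^k) = 2 - 2 * (1/2 :: real)^d" by (induction d) simp_all
      then show ?thesis by simp
    qed
    have far: "e / 4 \<le> \<bar>?I i\<bar>" if ij: "i \<ge> Suc j" for i
    proof -
      obtain d where i: "i = Suc j + d" using le_Suc_ex[OF ij] by blast
      have "e / 8 * (\<Sum>k<d. (1/2)^k) \<le> e / 8 * 2"
        using e geo[of d] by (intro mult_left_mono) auto
      then have "\<bar>?I i - ?I (Suc j)\<bar> \<le> e / 4" using diff[of d] unfolding i by linarith
      moreover have "e / 2 \<le> \<bar>?I (Suc j)\<bar>" by (rule big)
      ultimately show ?thesis by arith
    qed
    have "?I \<longlonglongrightarrow> (\<I> t. G t * ?f t)"
    proof (rule integral_dominated_convergence[where w = "\<lambda>t. \<bar>?f t\<bar>"])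
      show "AE t in leb01. (\<lambda>i. g i t * ?f t) \<longlonglongrightarrow> G t * ?f t"
        using limG by eventually_elim (intro tendsto_intros)
      have "\<bar>g i t\<bar> * \<bar>?f t\<bar> \<le> 1 * \<bar>?f t\<bar>" for i t using g[of i] by (intro mult_right_mono) auto
      then show "AE t in leb01. norm (g i t * ?f t) \<le> \<bar>?f t\<bar>" for i by (simp add: abs_mult)
      show "(\<lambda>t. G t * ?f t) \<in> borel_measurable leb01"
        using integrable_bounded_mult[OF Gb f] by (rule borel_measurable_integrable)
      show "(\<lambda>t. g i t * ?f t) \<in> borel_measurable leb01" for i
        using gi by (rule borel_measurable_integrable)
    qed (use f in auto)
    then have "(\<lambda>i. \<bar>?I i\<bar>) \<longlonglongrightarrow> \<bar>\<I> t. G t * ?f t\<bar>" by (rule tendsto_rabs)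
    then show ?thesis by (rule LIMSEQ_le_const) (use far in blast)
  qed
  have "(\<lambda>j. \<I> t. G t * f (n (Suc j)) t) \<longlonglongrightarrow> 0"
  proof -
    have "strict_mono (\<lambda>j. n (Suc j))" unfolding strict_mono_Suc_iff using n by blast
    from LIMSEQ_subseq_LIMSEQ[OF null[OF Gb] this] show ?thesis by (simp only: o_def)
  qed
  from order_tendstoD(2)[OF tendsto_rabs_zero[OF this], of "e / 4"] e
  have "\<forall>\<^sub>F j in sequentially. \<bar>\<I> t. G t * f (n (Suc j)) t\<bar> < e / 4" by simp
  then have "\<exists>j. \<bar>\<I> t. G t * f (n (Suc j)) t\<bar> < e / 4"
    by (rule eventually_happens'[OF sequentially_bot])
  then show False using low not_le by blast
qed

section \<open>Operators that are not completely continuous\<close>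

text \<open>
  The pointwise limit of the functionals is a bounded functional and so has a density.
\<close>

lemma L1_weak_star_limit:
  assumes u: "\<And>m. L1_bounded K (u m)"
    and conv: "\<And>f. integrable leb01 f \<Longrightarrow> convergent (\<lambda>m. \<I> t. u m t * f t)"
  obtains \<rho> where "L1_bounded K \<rho>"
    "\<And>f. integrable leb01 f \<Longrightarrow> (\<lambda>m. \<I> t. u m t * f t) \<longlonglongrightarrow> (\<I> t. \<rho> t * f t)"
proof -
  obtain F :: "nat \<Rightarrow> L1 \<Rightarrow>\<^sub>L real" where
    F: "\<And>m f. integrable leb01 f \<Longrightarrow> F m (abs_L1 f) = (\<I> t. u m t * f t)" "\<And>m. norm (F m) \<le> K"
  proof (rule L1_pairing_blinfun_seq[OF u])
    fix F :: "nat \<Rightarrow> L1 \<Rightarrow>\<^sub>L real"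
    assume 1: "\<And>m f. integrable leb01 f \<Longrightarrow> F m (abs_L1 f) = (\<I> t. u m t * f t)" and 2: "\<And>m. norm (F m) \<le> K"
    show thesis by (rule that[OF 1 2])
  qed
  have K: "K \<ge> 0" using F(2) norm_ge_zero order_trans by blast
  have Fc: "(\<lambda>m. F m x) \<longlonglongrightarrow> lim (\<lambda>m. F m x)" for x
  proof -
    obtain f where f: "integrable leb01 f" "x = abs_L1 f" by (rule L1_cases)
    have "convergent (\<lambda>m. F m x)" using conv[OF f(1)] by (simp add: F(1)[OF f(1)] f(2))
    then show ?thesis by (simp add: convergent_LIMSEQ_iff)
  qed
  define L where "L x = lim (\<lambda>m. F m x)" for x
  have bl: "bounded_linear L"
  proof (rule bounded_linear_intro[where K = K])
    show "L (x + y) = L x + L y" for x y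
      using LIMSEQ_unique[OF Fc[of "x + y"]] tendsto_add[OF Fc[of x] Fc[of y]]
      by (simp add: L_def blinfun.add_right)
    show "L (c *\<^sub>R x) = c *\<^sub>R L x" for c x
      using LIMSEQ_unique[OF Fc[of "c *\<^sub>R x"]] tendsto_mult_left[OF Fc[of x], of c]
      by (simp add: L_def blinfun.scaleR_right)
    show "norm (L x) \<le> norm x * K" for x
    proof -
      have "norm (F m x) \<le> norm x * K" for m
        using order_trans[OF norm_blinfun mult_right_mono[OF F(2) norm_ge_zero]]
        by (simp add: mult.commute)
      then show ?thesis unfolding L_def using tendsto_norm[OF Fc[of x]]
        by (intro LIMSEQ_le_const2) auto
    qed
  qed
  have "norm (Blinfun L) \<le> K"
  proof (rule norm_blinfun_bound[OF K])
    fix x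
    have "norm (F m x) \<le> K * norm x" for m
      by (rule order_trans[OF norm_blinfun mult_right_mono[OF F(2) norm_ge_zero]])
    then have "norm (L x) \<le> K * norm x" unfolding L_def using tendsto_norm[OF Fc[of x]]
      by (intro LIMSEQ_le_const2) auto
    then show "norm (Blinfun L x) \<le> K * norm x" using bl by (simp add: bounded_linear_Blinfun_apply)
  qed
  then obtain \<rho> where \<rho>: "L1_bounded K \<rho>"
    "\<And>f. integrable leb01 f \<Longrightarrow> Blinfun L (abs_L1 f) = (\<I> t. \<rho> t * f t)"
    by (rule L1_dual) blast
  show ?thesis
  proof (rule that[OF \<rho>(1)])
    fix f :: "real \<Rightarrow> real" assume f: "integrable leb01 f"
    show "(\<lambda>m. \<I> t. u m t * f t) \<longlonglongrightarrow> (\<I> t. \<rho> t * f t)"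
      using Fc[of "abs_L1 f"] \<rho>(2)[OF f] bl
      by (simp add: F(1)[OF f] L_def bounded_linear_Blinfun_apply)
  qed
qed

lemma not_completely_continuous_witness:
  fixes T :: "'b::real_normed_vector \<Rightarrow> 'a::real_normed_vector"
  assumes T: "bounded_linear T" and ncc: "\<not> completely_continuous T"
  obtains g :: "nat \<Rightarrow> 'b" and x :: "nat \<Rightarrow> 'a \<Rightarrow>\<^sub>L real" and d where "d > 0"
    "\<And>\<phi> :: 'b \<Rightarrow> real. bounded_linear \<phi> \<Longrightarrow> (\<lambda>n. \<phi> (g n)) \<longlonglongrightarrow> 0"
    "\<And>n. norm (x n) \<le> 1" "\<And>n. x n (T (g n)) \<ge> d"
proof -
  interpret T: bounded_linear T by (rule T)
  obtain f l where f: "weakly_convergent_to f l" "\<not> convergent (\<lambda>n. T (f n))"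
    using ncc unfolding completely_continuous_def by blast
  have "\<not> (\<lambda>n. T (f n - l)) \<longlonglongrightarrow> 0"
  proof
    assume "(\<lambda>n. T (f n - l)) \<longlonglongrightarrow> 0"
    then have "(\<lambda>n. T (f n)) \<longlonglongrightarrow> T l" by (simp add: T.diff LIM_zero_iff)
    then show False using f(2) by (auto simp: convergent_def)
  qed
  then obtain d where d: "d > 0" "\<And>N. \<exists>n\<ge>N. d \<le> norm (T (f n - l))"
    unfolding LIMSEQ_iff by (auto simp: not_less)
  have "\<exists>\<^sub>\<infinity>n. d \<le> norm (T (f n - l))" using d(2) by (simp add: INFM_nat_le)
  then have inf: "infinite {n. d \<le> norm (T (f n - l))}" by (simp add: INFM_iff_infinite)
  define r where "r = enumerate {n. d \<le> norm (T (f n - l))}"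
  have r: "strict_mono r" "\<And>n. d \<le> norm (T (f (r n) - l))"
    unfolding r_def using strict_mono_enumerate[OF inf] enumerate_in_set[OF inf] by auto
  have "\<forall>n. \<exists>x :: 'a \<Rightarrow>\<^sub>L real. norm x \<le> 1 \<and> blinfun_apply x (T (f (r n) - l)) = norm (T (f (r n) - l))"
    using norming_functional by metis
  from choice[OF this] obtain x :: "nat \<Rightarrow> 'a \<Rightarrow>\<^sub>L real" where
    x: "\<forall>n. norm (x n) \<le> 1 \<and> x n (T (f (r n) - l)) = norm (T (f (r n) - l))" by blast
  show ?thesis
  proof (rule that[OF d(1)])
    fix \<phi> :: "'b \<Rightarrow> real" assume \<phi>: "bounded_linear \<phi>"
    then have "(\<lambda>n. \<phi> (f n)) \<longlonglongrightarrow> \<phi> l" using f(1) unfolding weakly_convergent_to_def by blast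
    from LIMSEQ_subseq_LIMSEQ[OF this r(1)] show "(\<lambda>n. \<phi> (f (r n) - l)) \<longlonglongrightarrow> 0"
      by (simp add: bounded_linear.linear[OF \<phi>] linear_diff o_def LIM_zero_iff)
  next
    show "norm (x n) \<le> 1" for n using x by blast
    show "d \<le> x n (T (f (r n) - l))" for n using x r(2)[of n] by simp
  qed
qed

text \<open>
  If $u_n$ were close to $u_m$ in $L_1$-norm for large $n$, then by uniform integrability
  $\int (u_n - u_m) g_n$ would be small; but $\int u_n g_n \ge d$ and $\int u_m g_n \to 0$.
\<close>

lemma L1_separation_of_norming:
  fixes g u :: "nat \<Rightarrow> real \<Rightarrow> real"
  assumes g: "\<And>n. integrable leb01 (g n)"
    and null: "\<And>h. L1_bounded 1 h \<Longrightarrow> (\<lambda>n. \<I> t. h t * g n t) \<longlonglongrightarrow> 0"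
    and u: "\<And>n. L1_bounded K (u n)" and K: "K > 0"
    and d: "d > 0" "\<And>n. d \<le> (\<I> t. u n t * g n t)"
  obtains c where "c > 0" "\<And>m. \<exists>n\<ge>m. c \<le> (\<I> t. \<bar>u n t - u m t\<bar>)"
proof -
  have dK: "d / (4 * K) > 0" using d K by simp
  obtain r N where r: "r > 0" and rN: "\<And>n h. n \<ge> N \<Longrightarrow> L1_bounded 1 h \<Longrightarrow> (\<I> t. \<bar>h t\<bar>) < r \<Longrightarrow>
      \<bar>\<I> t. h t * g n t\<bar> < d / (4 * K)"
  proof (rule weakly_null_equi_integrable[OF g null dK])
    fix r N assume "r > 0" "\<And>n h. n \<ge> N \<Longrightarrow> L1_bounded 1 h \<Longrightarrow> (\<I> t. \<bar>h t\<bar>) < r \<Longrightarrow>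
      \<bar>\<I> t. h t * g n t\<bar> < d / (4 * K)"
    then show thesis by (rule that)
  qed
  show ?thesis
  proof (rule that[of "2 * K * r"])
    fix m
    define h where "h t = u m t / K" for t
    have h: "L1_bounded 1 h" using u[of m] K by (auto simp: h_def[abs_def] field_simps)
    have "\<forall>\<^sub>F n in sequentially. \<bar>\<I> t. h t * g n t\<bar> < d / (2 * K)"
      using d K by (intro order_tendstoD(2)[OF tendsto_rabs_zero[OF null[OF h]]]) auto
    then have "\<forall>\<^sub>F n in sequentially. n \<ge> max N m \<and> \<bar>\<I> t. h t * g n t\<bar> < d / (2 * K)"
      using eventually_ge_at_top by (rule eventually_conj[rotated])
    then obtain n where n: "n \<ge> N" "n \<ge> m" "\<bar>\<I> t. h t * g n t\<bar> < d / (2 * K)"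
      by (auto simp: eventually_sequentially)
    define k where "k t = (u n t - u m t) / (2 * K)" for t
    have kb: "\<bar>k t\<bar> \<le> 1" for t
    proof -
      have "\<bar>u n t\<bar> \<le> K" "\<bar>u m t\<bar> \<le> K" using u by blast+
      then have "\<bar>u n t - u m t\<bar> \<le> 2 * K" by linarith
      then show ?thesis using K by (simp add: k_def)
    qed
    have k: "L1_bounded 1 k" using u[of n] u[of m] kb by (auto simp: k_def[abs_def])
    have "2 * K * (\<I> t. k t * g n t) = (\<I> t. u n t * g n t - K * (h t * g n t))"
      unfolding integral_mult_right_zero[symmetric]
      by (rule Bochner_Integration.integral_cong) (use K in \<open>auto simp: k_def h_def field_simps\<close>)
    also have "\<dots> = (\<I> t. u n t * g n t) - K * (\<I> t. h t * g n t)"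
      using integrable_bounded_mult[OF u g] integrable_bounded_mult[OF h g] by simp
    finally have eq: "2 * K * (\<I> t. k t * g n t) = \<dots>" .
    have "K * (\<I> t. h t * g n t) \<le> K * (d / (2 * K))"
      using n(3) K by (intro mult_left_mono) auto
    also have "\<dots> = d / 2" using K by simp
    finally have "d / 2 \<le> 2 * K * (\<I> t. k t * g n t)" using eq d(2)[of n] by linarith
    then have "d / (4 * K) \<le> (\<I> t. k t * g n t)" using K by (simp add: field_simps)
    then have "\<not> (\<I> t. \<bar>k t\<bar>) < r" using rN[OF n(1) k] by linarith
    moreover have "2 * K * (\<I> t. \<bar>k t\<bar>) = (\<I> t. \<bar>u n t - u m t\<bar>)"
      unfolding integral_mult_right_zero[symmetric]
      by (rule Bochner_Integration.integral_cong) (use K in \<open>auto simp: k_def\<close>)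
    ultimately have "2 * K * r \<le> (\<I> t. \<bar>u n t - u m t\<bar>)"
      using K by (metis mult_le_cancel_left_pos mult_pos_pos not_less zero_less_numeral)
    then show "\<exists>n\<ge>m. 2 * K * r \<le> (\<I> t. \<bar>u n t - u m t\<bar>)" using n(2) by blast
  qed (use r K in auto)
qed

lemma bounded_linear_L1_pairing:
  assumes "L1_bounded K h" "K \<ge> 0"
  obtains \<phi> :: "L1 \<Rightarrow> real" where "bounded_linear \<phi>"
    "\<And>f. integrable leb01 f \<Longrightarrow> \<phi> (abs_L1 f) = (\<I> t. h t * f t)"
proof -
  obtain F :: "L1 \<Rightarrow>\<^sub>L real" where
    "\<And>f. integrable leb01 f \<Longrightarrow> F (abs_L1 f) = (\<I> t. h t * f t)"
    using L1_pairing_blinfun[OF assms] by blast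
  then show ?thesis by (rule that[OF blinfun.bounded_linear_right])
qed

text \<open>
  The subsequence is chosen to converge on $S$ and on the images of the rational half-lines, which
  decides convergence on the closure of $S$ and of all the functionals $x_n \circ T$. Differences of
  far apart members then tend to zero there and are separated in $L_1$-norm.
\<close>

lemma weak_star_null_functionals:
  fixes T :: "L1 \<Rightarrow> 'a::real_normed_vector"
  assumes T: "bounded_linear T" and ncc: "\<not> completely_continuous T" and S: "countable S"
  obtains y :: "nat \<Rightarrow> 'a \<Rightarrow>\<^sub>L real" and v K c where "K > 0" "c > 0"
    "\<And>m. norm (y m) \<le> 2" "\<And>x. x \<in> closure S \<Longrightarrow> (\<lambda>m. y m x) \<longlonglongrightarrow> 0"
    "\<And>m. L1_bounded K (v m)"
    "\<And>m f. integrable leb01 f \<Longrightarrow> y m (T (abs_L1 f)) = (\<I> t. v m t * f t)"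
    "\<And>f. integrable leb01 f \<Longrightarrow> (\<lambda>m. \<I> t. v m t * f t) \<longlonglongrightarrow> 0"
    "\<And>m. c \<le> (\<I> t. \<bar>v m t\<bar>)"
proof -
  interpret T: bounded_linear T by (rule T)
  obtain K where K: "K > 0" "\<And>x. norm (T x) \<le> norm x * K" using T.pos_bounded by blast
  obtain g :: "nat \<Rightarrow> L1" and x :: "nat \<Rightarrow> 'a \<Rightarrow>\<^sub>L real" and d where d: "d > 0"
    and gnull: "\<And>\<phi> :: L1 \<Rightarrow> real. bounded_linear \<phi> \<Longrightarrow> (\<lambda>n. \<phi> (g n)) \<longlonglongrightarrow> 0"
    and x: "\<And>n. norm (x n) \<le> 1" and xd: "\<And>n. x n (T (g n)) \<ge> d"
    by (rule not_completely_continuous_witness[OF T ncc]) blast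
  have xb: "\<bar>x n z\<bar> \<le> norm z" for n z
    using order_trans[OF norm_blinfun mult_right_mono[OF x norm_ge_zero], of n z] by simp
  define S' where "S' = S \<union> (\<lambda>q. T (abs_L1 (indicator {..q}))) ` \<rat>"
  have "countable S'" unfolding S'_def by (intro countable_Un S countable_image countable_rat)
  then obtain r where r: "strict_mono (r :: nat \<Rightarrow> nat)"
    and rS: "\<And>s. s \<in> S' \<Longrightarrow> convergent (\<lambda>m. x (r m) s)"
    by (rule pointwise_convergent_subseq[where x = "\<lambda>m s. x m s" and K = norm]) (auto intro: xb)
  define F where "F m = x (r m) o\<^sub>L Blinfun T" for m
  have F: "F m f = x (r m) (T f)" for m f
    by (simp add: F_def bounded_linear_Blinfun_apply[OF T])
  have FK: "norm (F m) \<le> K" for m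
  proof (rule norm_blinfun_bound)
    show "norm (F m f) \<le> K * norm f" for f
      using order_trans[OF xb K(2), of "r m" f] by (simp add: F mult.commute)
  qed (use K in simp)
  have "\<forall>m. \<exists>u. L1_bounded K u \<and> (\<forall>f. integrable leb01 f \<longrightarrow> F m (abs_L1 f) = (\<I> t. u t * f t))"
  proof
    fix m
    obtain u where "L1_bounded K u" "\<And>f. integrable leb01 f \<Longrightarrow> F m (abs_L1 f) = (\<I> t. u t * f t)"
      by (rule L1_dual[OF FK[of m]]) blast
    then show "\<exists>u. L1_bounded K u \<and> (\<forall>f. integrable leb01 f \<longrightarrow> F m (abs_L1 f) = (\<I> t. u t * f t))"
      by (intro exI[of _ u]) simp
  qed
  from choice[OF this] obtain u where u': "\<forall>m. L1_bounded K (u m) \<and> (\<forall>f. integrable leb01 f \<longrightarrow> F m (abs_L1 f) = (\<I> t. u m t * f t))"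
    by (elim exE)
  have u: "L1_bounded K (u m)" for m using u'[rule_format, of m] by (rule conjunct1)
  have uF: "F m (abs_L1 f) = (\<I> t. u m t * f t)" if "integrable leb01 f" for m f
    using u'[rule_format, of m, THEN conjunct2] that by simp
  have Fconv: "convergent (\<lambda>m. F m f)" for f
    by (rule L1_functionals_convergent_subseq[OF FK]) (auto simp: F S'_def intro!: rS)
  have "\<forall>n. \<exists>f. integrable leb01 f \<and> g (r n) = abs_L1 f"
  proof
    show "\<exists>f. integrable leb01 f \<and> g (r n) = abs_L1 f" for n by (rule L1_cases[of "g (r n)"]) blast
  qed
  from choice[OF this] obtain h where h: "\<And>n. integrable leb01 (h n)" "\<And>n. g (r n) = abs_L1 (h n)" by blast
  obtain c where c: "c > 0" "\<And>m. \<exists>n\<ge>m. c \<le> (\<I> t. \<bar>u n t - u m t\<bar>)"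
  proof (rule L1_separation_of_norming[OF h(1) _ u K(1) d])
    show "d \<le> (\<I> t. u n t * h n t)" for n
      using xd[of "r n"] by (simp add: h F uF[OF h(1), symmetric])
    fix k assume k: "L1_bounded 1 k"
    obtain \<phi> :: "L1 \<Rightarrow> real" where \<phi>: "bounded_linear \<phi>"
      "\<And>f. integrable leb01 f \<Longrightarrow> \<phi> (abs_L1 f) = (\<I> t. k t * f t)"
      using bounded_linear_L1_pairing[OF k zero_le_one] by blast
    from LIMSEQ_subseq_LIMSEQ[OF gnull[OF \<phi>(1)] r]
    show "(\<lambda>n. \<I> t. k t * h n t) \<longlonglongrightarrow> 0"
      by (simp add: o_def h(2) \<phi>(2)[OF h(1)])
  qed blast
  from c(2) have "\<forall>m. \<exists>n. m \<le> n \<and> c \<le> (\<I> t. \<bar>u n t - u m t\<bar>)" by blast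
  from choice[OF this] obtain k where k: "\<And>m. m \<le> k m" "\<And>m. c \<le> (\<I> t. \<bar>u (k m) t - u m t\<bar>)" by blast
  have ktop: "filterlim k sequentially sequentially"
    by (rule filterlim_at_top_mono[OF filterlim_ident]) (simp add: k(1))
  define y where "y m = x (r (k m)) - x (r m)" for m
  define v where "v m t = u (k m) t - u m t" for m t
  have diff0: "(\<lambda>m. a (k m) - a m) \<longlonglongrightarrow> 0" if cv: "convergent a" for a :: "nat \<Rightarrow> real"
  proof -
    obtain l where l: "a \<longlonglongrightarrow> l" using cv unfolding convergent_def by blast
    from tendsto_diff[OF filterlim_compose[OF l ktop] l] show ?thesis by simp
  qed
  show ?thesis
  proof (rule that[where K = "2 * K" and c = c and y = y and v = v])
    show "norm (y m) \<le> 2" for m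
      using norm_triangle_ineq4[of "x (r (k m))" "x (r m)"] x[of "r (k m)"] x[of "r m"]
      unfolding y_def by linarith
    show "(\<lambda>m. y m z) \<longlonglongrightarrow> 0" if "z \<in> closure S" for z
    proof -
      have "S \<subseteq> {z. convergent (\<lambda>m. x (r m) z)}" using rS by (auto simp: S'_def)
      then have "closure S \<subseteq> {z. convergent (\<lambda>m. x (r m) z)}"
        by (rule closure_minimal) (rule closed_convergent_set[OF x])
      then show ?thesis using that diff0[of "\<lambda>m. x (r m) z"] by (auto simp: y_def blinfun.diff_left)
    qed
    show vb: "L1_bounded (2 * K) (v m)" for m
    proof -
      have "\<bar>u (k m) t - u m t\<bar> \<le> 2 * K" for t
      proof -
        have "\<bar>u (k m) t\<bar> \<le> K" "\<bar>u m t\<bar> \<le> K" using u by blast+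
        then show ?thesis by linarith
      qed
      then show ?thesis using u[of "k m"] u[of m] by (auto simp: v_def[abs_def])
    qed
    have split: "(\<I> t. v m t * f t) = F (k m) (abs_L1 f) - F m (abs_L1 f)"
      if f: "integrable leb01 f" for m f
      unfolding uF[OF f] Bochner_Integration.integral_diff[OF integrable_bounded_mult[OF u f] integrable_bounded_mult[OF u f], symmetric]
      by (simp add: v_def left_diff_distrib)
    show "y m (T (abs_L1 f)) = (\<I> t. v m t * f t)" if f: "integrable leb01 f" for m f
      by (simp add: split[OF f] F y_def blinfun.diff_left)
    show "(\<lambda>m. \<I> t. v m t * f t) \<longlonglongrightarrow> 0" if f: "integrable leb01 f" for f
      unfolding split[OF f] by (rule diff0[OF Fconv])
    show "c \<le> (\<I> t. \<bar>v m t\<bar>)" for m unfolding v_def by (rule k(2))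
  qed (use K c in auto)
qed

text \<open>
  All that the construction of the signs needs to know about $T$. The bound on the limits of the
  integrals of $|v_m|$ says that every weak-star limit of $|v_m|$ is at least $b$ on $B$.
  Convergence of the sgn $v_m$ makes their differences weak-star null.
\<close>

locale norming_functionals =
  fixes T :: "L1 \<Rightarrow> 'a::real_normed_vector" and y :: "nat \<Rightarrow> 'a \<Rightarrow>\<^sub>L real"
    and v :: "nat \<Rightarrow> real \<Rightarrow> real" and K b :: real and B :: "real set"
  assumes bpos: "b > 0"
    and y_le: "\<And>m. norm (y m) \<le> 2"
    and v_bounded: "\<And>m. L1_bounded K (v m)"
    and y_T: "\<And>m f. integrable leb01 f \<Longrightarrow> y m (T (abs_L1 f)) = (\<I> t. v m t * f t)"
    and v_null: "\<And>f. integrable leb01 f \<Longrightarrow> (\<lambda>m. \<I> t. v m t * f t) \<longlonglongrightarrow> 0"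
    and sgn_conv: "\<And>f. integrable leb01 f \<Longrightarrow> convergent (\<lambda>m. \<I> t. sgn (v m t) * f t)"
    and B_sets: "B \<in> sets leb01" and B_pos: "measure leb01 B > 0"
    and abs_lim: "\<And>E. E \<in> sets leb01 \<Longrightarrow> E \<subseteq> B \<Longrightarrow>
      \<exists>l. b * measure leb01 E \<le> l \<and> (\<lambda>m. \<I> t. \<bar>v m t\<bar> * indicator E t) \<longlonglongrightarrow> l"

text \<open>
  A weak-star limit of $|v_m|$ has integral at least $c$, so it cannot be below $c/2$ almost
  everywhere; $B$ is where it is at least $c/2$.
\<close>

lemma weak_star_null_functionals_localized:
  fixes T :: "L1 \<Rightarrow> 'a::real_normed_vector"
  assumes T: "bounded_linear T" and ncc: "\<not> completely_continuous T" and S: "countable S"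
  obtains y :: "nat \<Rightarrow> 'a \<Rightarrow>\<^sub>L real" and v K b B where "norming_functionals T y v K b B"
    "\<And>x. x \<in> closure S \<Longrightarrow> (\<lambda>m. y m x) \<longlonglongrightarrow> 0"
proof -
  obtain y :: "nat \<Rightarrow> 'a \<Rightarrow>\<^sub>L real" and v K c where K: "K > 0" and c: "c > 0"
    and y: "\<And>m. norm (y m) \<le> 2" "\<And>x. x \<in> closure S \<Longrightarrow> (\<lambda>m. y m x) \<longlonglongrightarrow> 0"
    and v: "\<And>m. L1_bounded K (v m)"
    and yv: "\<And>m f. integrable leb01 f \<Longrightarrow> y m (T (abs_L1 f)) = (\<I> t. v m t * f t)"
    and v0: "\<And>f. integrable leb01 f \<Longrightarrow> (\<lambda>m. \<I> t. v m t * f t) \<longlonglongrightarrow> 0"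
    and vc: "\<And>m. c \<le> (\<I> t. \<bar>v m t\<bar>)"
    by (rule weak_star_null_functionals[OF T ncc S]) blast
  have sv: "L1_bounded 1 (\<lambda>t. sgn (v m t))" for m
    using v[of m] by (auto simp: sgn_if)
  have av: "L1_bounded K (\<lambda>t. \<bar>v m t\<bar>)" for m using v[of m] by auto
  obtain r1 where r1: "strict_mono (r1 :: nat \<Rightarrow> nat)"
    "\<And>f. integrable leb01 f \<Longrightarrow> convergent (\<lambda>m. \<I> t. sgn (v (r1 m) t) * f t)"
  proof (rule L1_weak_star_subseq[where K = 1 and u = "\<lambda>m t. sgn (v m t)", OF sv])
    fix r :: "nat \<Rightarrow> nat"
    assume "strict_mono r"
      "\<And>f. integrable leb01 f \<Longrightarrow> convergent (\<lambda>m. \<I> t. sgn (v (r m) t) * f t)"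
    then show thesis by (rule that)
  qed
  obtain r2 where r2: "strict_mono (r2 :: nat \<Rightarrow> nat)"
    "\<And>f. integrable leb01 f \<Longrightarrow> convergent (\<lambda>m. \<I> t. \<bar>v (r1 (r2 m)) t\<bar> * f t)"
  proof (rule L1_weak_star_subseq[where K = K and u = "\<lambda>m t. \<bar>v (r1 m) t\<bar>", OF av])
    fix r :: "nat \<Rightarrow> nat"
    assume "strict_mono r"
      "\<And>f. integrable leb01 f \<Longrightarrow> convergent (\<lambda>m. \<I> t. \<bar>v (r1 (r m)) t\<bar> * f t)"
    then show thesis by (rule that)
  qed
  define r where "r m = r1 (r2 m)" for m
  have r: "strict_mono r" unfolding r_def using strict_mono_o[OF r1(1) r2(1)] by (simp add: o_def)
  obtain \<rho> where \<rho>: "L1_bounded K \<rho>"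
    "\<And>f. integrable leb01 f \<Longrightarrow> (\<lambda>m. \<I> t. \<bar>v (r m) t\<bar> * f t) \<longlonglongrightarrow> (\<I> t. \<rho> t * f t)"
  proof (rule L1_weak_star_limit[where K = K and u = "\<lambda>m t. \<bar>v (r m) t\<bar>", OF av])
    show "convergent (\<lambda>m. \<I> t. \<bar>v (r m) t\<bar> * f t)" if "integrable leb01 f" for f
      unfolding r_def by (rule r2(2)[OF that])
    fix \<rho> assume "L1_bounded K \<rho>"
      "\<And>f. integrable leb01 f \<Longrightarrow> (\<lambda>m. \<I> t. \<bar>v (r m) t\<bar> * f t) \<longlonglongrightarrow> (\<I> t. \<rho> t * f t)"
    then show thesis by (rule that)
  qed
  define B where "B = {t \<in> space leb01. c / 2 \<le> \<rho> t}"
  have B: "B \<in> sets leb01" using \<rho>(1)[THEN conjunct1] unfolding B_def by measurable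
  have cr: "c \<le> (\<I> t. \<rho> t)"
    using LIMSEQ_le_const[OF \<rho>(2)[of "\<lambda>_. 1"]] vc by simp
  have Bpos: "measure leb01 B > 0"
  proof (rule ccontr)
    assume "\<not> measure leb01 B > 0"
    then have "measure leb01 B = 0" using measure_nonneg[of leb01 B] by linarith
    then have "B \<in> null_sets leb01" using B by (intro null_setsI) (simp_all only: leb01.emeasure_eq_measure ennreal_0)
    then have "AE t in leb01. t \<notin> B" by (rule AE_not_in)
    then have "AE t in leb01. \<rho> t \<le> c / 2" by (rule AE_mp) (auto simp: B_def intro!: AE_I2)
    then have "(\<I> t. \<rho> t) \<le> (\<I> t. c / 2)"
      by (rule integral_mono_AE[rotated 2]) (use integrable_bounded[OF \<rho>(1)] in auto)
    also have "\<dots> = c / 2" by (simp add: measure_restrict_space)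
    finally show False using cr c by linarith
  qed
  show ?thesis
  proof (rule that[where b = "c / 2" and y = "\<lambda>m. y (r m)" and K = K and v = "\<lambda>m. v (r m)" and B = B], unfold_locales)
    show "(\<lambda>m. y (r m) x) \<longlonglongrightarrow> 0" if "x \<in> closure S" for x
      using LIMSEQ_subseq_LIMSEQ[OF y(2)[OF that] r] by (simp add: o_def)
    show "(\<lambda>m. \<I> t. v (r m) t * f t) \<longlonglongrightarrow> 0" if "integrable leb01 f" for f
      using LIMSEQ_subseq_LIMSEQ[OF v0[OF that] r] by (simp add: o_def)
    show "convergent (\<lambda>m. \<I> t. sgn (v (r m) t) * f t)" if "integrable leb01 f" for f
      using convergent_subseq_convergent[OF r1(2)[OF that] r2(1)] by (simp add: o_def r_def)
    show "\<exists>l. c / 2 * measure leb01 E \<le> l \<and> (\<lambda>m. \<I> t. \<bar>v (r m) t\<bar> * indicator E t) \<longlonglongrightarrow> l"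
      if E: "E \<in> sets leb01" "E \<subseteq> B" for E
    proof (intro exI conjI)
      have iE: "integrable leb01 (indicator E :: real \<Rightarrow> real)" using E by (intro integrable_indicator_leb01) blast
      show "(\<lambda>m. \<I> t. \<bar>v (r m) t\<bar> * indicator E t) \<longlonglongrightarrow> (\<I> t. \<rho> t * indicator E t)"
        by (rule \<rho>(2)[OF iE])
      have "c / 2 * measure leb01 E = (\<I> t. c / 2 * indicator E t)"
        using integral_indicator_leb01[OF E(1)] by (simp only: integral_mult_right_zero)
      also have "\<dots> \<le> (\<I> t. \<rho> t * indicator E t)"
      proof (rule integral_mono)
        show "c / 2 * indicator E t \<le> \<rho> t * indicator E t" for t
          using E(2) by (auto simp: B_def indicator_def)
      qed (use iE integrable_bounded_mult[OF \<rho>(1) iE] in \<open>auto simp del: integrable_indicator_iff\<close>)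
      finally show "c / 2 * measure leb01 E \<le> (\<I> t. \<rho> t * indicator E t)" .
    qed
    show "y (r m) (T (abs_L1 f)) = (\<I> t. v (r m) t * f t)" if "integrable leb01 f" for m f
      by (rule yv[OF that])
  qed (use c y v B Bpos in auto)
qed

section \<open>Sign functions, Walsh products and binary points\<close>

definition sign_function :: "(real \<Rightarrow> real) \<Rightarrow> bool" where
  "sign_function s \<longleftrightarrow> s \<in> borel_measurable leb01 \<and> (\<forall>t. s t = 1 \<or> s t = -1)"

definition walsh :: "(nat \<Rightarrow> real \<Rightarrow> real) \<Rightarrow> nat set \<Rightarrow> real \<Rightarrow> real" where
  "walsh s S t = (\<Prod>i\<in>S. s i t)"

text \<open>
  The number whose $i$-th binary digit is 0 where $s_i = 1$ and 1 where $s_i = -1$, which is how the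
  Rademacher functions encode the digits of a point.
\<close>

definition binary_point :: "(nat \<Rightarrow> real \<Rightarrow> real) \<Rightarrow> real \<Rightarrow> real" where
  "binary_point s t = (\<Sum>i. (1 - s i t) / 2 ^ (i + 2))"

lemma sign_functionD:
  assumes "sign_function s"
  shows "s \<in> borel_measurable leb01" "s t = 1 \<or> s t = -1" "\<bar>s t\<bar> = 1" "s t * s t = 1"
    "L1_bounded 1 s"
proof -
  show m: "s \<in> borel_measurable leb01" and v: "s t = 1 \<or> s t = -1" for t
    using assms by (auto simp: sign_function_def)
  show a: "\<bar>s t\<bar> = 1" for t using v[of t] by auto
  show "s t * s t = 1" using v[of t] by auto
  show "L1_bounded 1 s" using m a by simp
qed

lemma sign_function_mult: "sign_function r \<Longrightarrow> sign_function s \<Longrightarrow> sign_function (\<lambda>t. r t * s t)"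
  unfolding sign_function_def
proof (elim conjE, intro conjI allI borel_measurable_times)
  fix t assume "\<forall>t. r t = 1 \<or> r t = -1" "\<forall>t. s t = 1 \<or> s t = -1"
  then have "r t = 1 \<or> r t = -1" "s t = 1 \<or> s t = -1" by blast+
  then show "r t * s t = 1 \<or> r t * s t = -1" by auto
qed

lemma sign_function_walsh:
  assumes "\<And>i. sign_function (s i)" "finite S"
  shows "sign_function (walsh s S)"
  using assms(2)
proof (induction S)
  case empty
  show ?case by (simp add: sign_function_def walsh_def[abs_def])
next
  case (insert i S)
  have "walsh s (insert i S) = (\<lambda>t. s i t * walsh s S t)"
    using insert.hyps by (simp add: walsh_def fun_eq_iff)
  then show ?case using sign_function_mult[OF assms(1) insert.IH] by simp
qed

lemma walsh_insert: "finite S \<Longrightarrow> i \<notin> S \<Longrightarrow> walsh s (insert i S) t = s i t * walsh s S t"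
  by (simp add: walsh_def)

lemma L1_bounded_history:
  assumes "\<And>i. sign_function (s i)"
  shows "\<exists>K. L1_bounded K (\<lambda>t. F (map (\<lambda>i. s i t) [0..<N]) :: real)"
proof (induction N arbitrary: F)
  case 0
  show ?case by (rule exI[of _ "\<bar>F []\<bar>"]) simp
next
  case (Suc N)
  obtain K1 where K1: "L1_bounded K1 (\<lambda>t. F (map (\<lambda>i. s i t) [0..<N] @ [1]))"
    using Suc[of "\<lambda>l. F (l @ [1])"] by (elim exE)
  obtain K2 where K2: "L1_bounded K2 (\<lambda>t. F (map (\<lambda>i. s i t) [0..<N] @ [-1]))"
    using Suc[of "\<lambda>l. F (l @ [-1])"] by (elim exE)
  have eq: "F (map (\<lambda>i. s i t) [0..<Suc N]) =
    (if s N t = 1 then F (map (\<lambda>i. s i t) [0..<N] @ [1]) else F (map (\<lambda>i. s i t) [0..<N] @ [-1]))" for t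
    using sign_functionD(2)[OF assms, of N t] by auto
  have "L1_bounded (max K1 K2) (\<lambda>t. F (map (\<lambda>i. s i t) [0..<Suc N]))"
    unfolding eq
  proof
    have m1[measurable]: "(\<lambda>t. F (map (\<lambda>i. s i t) [0..<N] @ [1])) \<in> borel_measurable leb01"
      and m2[measurable]: "(\<lambda>t. F (map (\<lambda>i. s i t) [0..<N] @ [-1])) \<in> borel_measurable leb01"
      and m3[measurable]: "s N \<in> borel_measurable leb01"
      using K1 K2 sign_functionD(1)[OF assms] by (blast, blast, blast)
    show "(\<lambda>t. if s N t = 1 then F (map (\<lambda>i. s i t) [0..<N] @ [1]) else F (map (\<lambda>i. s i t) [0..<N] @ [-1]))
      \<in> borel_measurable leb01"
      by measurable
    show "\<forall>t. \<bar>if s N t = 1 then F (map (\<lambda>i. s i t) [0..<N] @ [1]) else F (map (\<lambda>i. s i t) [0..<N] @ [-1])\<bar> \<le> max K1 K2"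
      using K1 K2 by (auto simp: le_max_iff_disj)
  qed
  then show ?case by (rule exI)
qed

text \<open>
  Every function of the first $N$ signs is a linear combination of Walsh products, with coefficients
  that do not depend on the signs. Peeling off the last sign, whose values are 1 and -1, proves this
  without writing the combination down; the Walsh product of later signs carries what was peeled.
\<close>

lemma history_moments_eq:
  assumes s: "\<And>i. sign_function (s i)" and s': "\<And>i. sign_function (s' i)"
    and q: "integrable leb01 q" and q': "integrable leb01 q'"
    and mom: "\<And>S. finite S \<Longrightarrow> (\<I> t. walsh s S t * q t) = c * (\<I> t. walsh s' S t * q' t)"
  shows "finite S \<Longrightarrow> S \<inter> {..<N} = {} \<Longrightarrow>
    (\<I> t. F (map (\<lambda>i. s i t) [0..<N]) * (walsh s S t * q t)) =
    c * (\<I> t. F (map (\<lambda>i. s' i t) [0..<N]) * (walsh s' S t * q' t))"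
proof (induction N arbitrary: F S)
  case 0
  then show ?case using mom[of S] by simp
next
  case (Suc N)
  let ?D1 = "\<lambda>l. (F (l @ [1]) + F (l @ [-1])) / 2" and ?D2 = "\<lambda>l. (F (l @ [1]) - F (l @ [-1])) / 2"
  have S: "N \<notin> S" "S \<inter> {..<N} = {}" "insert N S \<inter> {..<N} = {}" "finite (insert N S)"
    using Suc.prems by (auto simp: lessThan_Suc)
  have split: "(\<I> t. F (map (\<lambda>i. r i t) [0..<Suc N]) * (walsh r S t * p t)) =
      (\<I> t. ?D1 (map (\<lambda>i. r i t) [0..<N]) * (walsh r S t * p t)) +
      (\<I> t. ?D2 (map (\<lambda>i. r i t) [0..<N]) * (walsh r (insert N S) t * p t))"
    if r: "\<And>i. sign_function (r i)" and p: "integrable leb01 p" for r p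
  proof -
    have int: "integrable leb01 (\<lambda>t. D (map (\<lambda>i. r i t) [0..<N]) * (walsh r R t * p t))"
      if R: "finite R" for D :: "real list \<Rightarrow> real" and R
    proof -
      obtain K where K: "L1_bounded K (\<lambda>t. D (map (\<lambda>i. r i t) [0..<N]))"
        using L1_bounded_history[of r D N, OF r] by (elim exE)
      show ?thesis
        by (rule integrable_bounded_mult[OF K integrable_bounded_mult[OF sign_functionD(5)[OF sign_function_walsh] p]])
          (rule r R)+
    qed
    have "(\<I> t. F (map (\<lambda>i. r i t) [0..<Suc N]) * (walsh r S t * p t)) =
      (\<I> t. ?D1 (map (\<lambda>i. r i t) [0..<N]) * (walsh r S t * p t) +
        ?D2 (map (\<lambda>i. r i t) [0..<N]) * (walsh r (insert N S) t * p t))"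
    proof (rule integral_congI)
      fix t
      have "r N t = 1 \<or> r N t = -1" by (rule sign_functionD(2)[OF r])
      then show "F (map (\<lambda>i. r i t) [0..<Suc N]) * (walsh r S t * p t) =
        ?D1 (map (\<lambda>i. r i t) [0..<N]) * (walsh r S t * p t) +
        ?D2 (map (\<lambda>i. r i t) [0..<N]) * (walsh r (insert N S) t * p t)"
        unfolding walsh_insert[OF Suc.prems(1) S(1)] by (elim disjE) (simp_all add: field_simps)
    qed
    also have "\<dots> = (\<I> t. ?D1 (map (\<lambda>i. r i t) [0..<N]) * (walsh r S t * p t)) +
      (\<I> t. ?D2 (map (\<lambda>i. r i t) [0..<N]) * (walsh r (insert N S) t * p t))"
      by (rule Bochner_Integration.integral_add) (rule int[of S ?D1] int[of "insert N S" ?D2], use S Suc.prems in simp)+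
    finally show ?thesis .
  qed
  show ?case
    unfolding split[of s q, OF s q] split[of s' q', OF s' q']
      Suc.IH[OF Suc.prems(1) S(2), of ?D1] Suc.IH[OF S(4,3), of ?D2]
    by (rule distrib_left[symmetric])
qed

lemma binary_point_sums:
  assumes "\<And>i. sign_function (s i)"
  shows "(\<lambda>i. (1 - s i t) / 2 ^ (i + 2)) sums binary_point s t"
    and "0 \<le> binary_point s t" "binary_point s t \<le> 1"
proof -
  have b: "0 \<le> (1 - s i t) / 2 ^ (i + 2)" "(1 - s i t) / 2 ^ (i + 2) \<le> (1/2) ^ Suc i" for i
    using sign_functionD(2)[OF assms, of i t] by (auto simp: power_divide field_simps)
  have g: "(\<lambda>i. (1/2::real) ^ Suc i) sums 1" by (rule power_half_series)
  have "summable (\<lambda>i. (1 - s i t) / 2 ^ (i + 2))"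
  proof (rule summable_comparison_test'[OF sums_summable[OF g], of 0])
    show "norm ((1 - s i t) / 2 ^ (i + 2)) \<le> (1/2) ^ Suc i" for i
      using b[of i] by (simp only: real_norm_def abs_of_nonneg)
  qed
  then show sm: "(\<lambda>i. (1 - s i t) / 2 ^ (i + 2)) sums binary_point s t"
    unfolding binary_point_def by (rule summable_sums)
  show "0 \<le> binary_point s t" by (rule sums_le[OF _ sums_zero sm]) (rule b)
  show "binary_point s t \<le> 1" by (rule sums_le[OF _ sm g]) (rule b)
qed

lemma binary_point_measurable:
  assumes "\<And>i. sign_function (s i)"
  shows "binary_point s \<in> borel_measurable leb01"
proof -
  have [measurable]: "\<And>i. s i \<in> borel_measurable leb01" by (rule sign_functionD(1)[OF assms])
  show ?thesis unfolding binary_point_def[abs_def] by measurable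
qed

text \<open>
  Two weighted systems of signs with proportional Walsh moments give proportional distributions to
  their binary points. Continuous functions of the partial sums are functions of finitely many
  signs; letting the number of signs grow and approximating the indicator of a half-line avoids any
  discussion of dyadic rationals, where binary expansions are not unique.
\<close>

lemma binary_point_halfline_transfer:
  assumes s: "\<And>i. sign_function (s i)" and s': "\<And>i. sign_function (s' i)"
    and q: "integrable leb01 q" and q': "integrable leb01 q'"
    and mom: "\<And>S. finite S \<Longrightarrow> (\<I> t. walsh s S t * q t) = c * (\<I> t. walsh s' S t * q' t)"
  shows "(\<I> t. indicator {..x} (binary_point s t) * q t) =
    c * (\<I> t. indicator {..x} (binary_point s' t) * q' t)"
proof -
  let ?P = "\<lambda>r N t. \<Sum>i<N. (1 - r i t) / 2 ^ (i + 2)"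
  have P: "(\<lambda>N. ?P r N t) \<longlonglongrightarrow> binary_point r t" if "\<And>i. sign_function (r i)" for r t
    using binary_point_sums(1)[of r t, OF that] by (simp only: sums_def)
  have Phist: "?P r N t = (\<Sum>i<length (map (\<lambda>i. r i t) [0..<N]). (1 - map (\<lambda>i. r i t) [0..<N] ! i) / 2 ^ (i + 2))" for r N t
    by (simp add: atLeast0LessThan)
  have Pm: "?P r N \<in> borel_measurable leb01" if "\<And>i. sign_function (r i)" for r N
  proof -
    have [measurable]: "\<And>i. r i \<in> borel_measurable leb01" by (rule sign_functionD(1)[OF that])
    show ?thesis by measurable
  qed
  have cont: "(\<I> t. f (binary_point s t) * q t) = c * (\<I> t. f (binary_point s' t) * q' t)"
    if f: "continuous_on UNIV f" and fb: "\<And>y. \<bar>f y\<bar> \<le> 1" for f :: "real \<Rightarrow> real"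
  proof -
    have fm: "f \<in> borel_measurable borel" by (rule borel_measurable_continuous_onI[OF f])
    have lim: "(\<lambda>N. \<I> t. f (?P r N t) * p t) \<longlonglongrightarrow> (\<I> t. f (binary_point r t) * p t)"
      if r: "\<And>i. sign_function (r i)" and p: "integrable leb01 p" for r p
    proof (rule integral_dominated_convergence[where w = "\<lambda>t. \<bar>p t\<bar>"])
      show "(\<lambda>t. f (binary_point r t) * p t) \<in> borel_measurable leb01"
        by (intro borel_measurable_times measurable_compose[OF binary_point_measurable fm] borel_measurable_integrable p r)
      show "(\<lambda>t. f (?P r N t) * p t) \<in> borel_measurable leb01" for N
        by (intro borel_measurable_times measurable_compose[OF Pm fm] borel_measurable_integrable p r)
      have "(\<lambda>N. f (?P r N t)) \<longlonglongrightarrow> f (binary_point r t)" for t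
        using continuous_on_tendsto_compose[OF f P[of r t, OF r]] by simp
      then show "AE t in leb01. (\<lambda>N. f (?P r N t) * p t) \<longlonglongrightarrow> f (binary_point r t) * p t"
        by (intro AE_I2 tendsto_mult tendsto_const)
      show "AE t in leb01. norm (f (?P r N t) * p t) \<le> \<bar>p t\<bar>" for N
        using mult_right_mono[OF fb abs_ge_zero] by (intro AE_I2) (simp add: abs_mult)
    qed (use p in simp)
    have "(\<I> t. f (?P s N t) * q t) = c * (\<I> t. f (?P s' N t) * q' t)" for N
      using history_moments_eq[of s s' q q' c "{}" N "\<lambda>l. f (\<Sum>i<length l. (1 - l ! i) / 2 ^ (i + 2))", OF s s' q q' mom]
      by (simp only: Phist[symmetric] walsh_def prod.empty mult_1_left finite.emptyI Int_empty_left simp_thms)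
    then have "(\<lambda>N. c * (\<I> t. f (?P s' N t) * q' t)) \<longlonglongrightarrow> (\<I> t. f (binary_point s t) * q t)"
      using lim[of s q, OF s q] by simp
    then show ?thesis
      using tendsto_mult_left[OF lim[of s' q', OF s' q'], of c] by (rule LIMSEQ_unique)
  qed
  define f where "f k y = max 0 (min 1 (1 - real k * (y - x)))" for k y
  have fc: "continuous_on UNIV (f k)" for k unfolding f_def by (intro continuous_intros)
  have fb: "\<bar>f k y\<bar> \<le> 1" for k y unfolding f_def by auto
  have flim: "(\<lambda>k. f k y) \<longlonglongrightarrow> indicator {..x} y" for y
  proof (cases "y \<le> x")
    case True
    then have "f k y = 1" for k using mult_nonneg_nonpos[of "real k" "y - x"] by (simp add: f_def)
    with True show ?thesis by simp
  next
    case False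
    obtain N where N: "1 < real N * (y - x)" using reals_Archimedean3[of "y - x"] False by auto
    have "f k y = 0" if "k \<ge> N" for k
    proof -
      have "real N * (y - x) \<le> real k * (y - x)" using that False by (intro mult_right_mono) auto
      then show ?thesis using N by (simp add: f_def)
    qed
    then have "\<forall>\<^sub>F k in sequentially. f k y = 0" unfolding eventually_sequentially by blast
    then show ?thesis using False by (simp add: tendsto_eventually)
  qed
  have lim: "(\<lambda>k. \<I> t. f k (binary_point r t) * p t) \<longlonglongrightarrow> (\<I> t. indicator {..x} (binary_point r t) * p t)"
    if r: "\<And>i. sign_function (r i)" and p: "integrable leb01 p" for r p
  proof (rule integral_dominated_convergence[where w = "\<lambda>t. \<bar>p t\<bar>"])
    have im: "(indicator {..x} :: real \<Rightarrow> real) \<in> borel_measurable borel" by measurable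
    show "(\<lambda>t. indicator {..x} (binary_point r t) * p t) \<in> borel_measurable leb01"
      by (intro borel_measurable_times measurable_compose[OF binary_point_measurable im] borel_measurable_integrable p r)
    show "(\<lambda>t. f k (binary_point r t) * p t) \<in> borel_measurable leb01" for k
      by (intro borel_measurable_times measurable_compose[OF binary_point_measurable borel_measurable_continuous_onI[OF fc]] borel_measurable_integrable p r)
    show "AE t in leb01. (\<lambda>k. f k (binary_point r t) * p t) \<longlonglongrightarrow> indicator {..x} (binary_point r t) * p t"
      by (intro AE_I2 tendsto_mult tendsto_const flim)
    show "AE t in leb01. norm (f k (binary_point r t) * p t) \<le> \<bar>p t\<bar>" for k
      using mult_right_mono[OF fb abs_ge_zero] by (intro AE_I2) (simp add: abs_mult)
  qed (use p in simp)
  have "(\<lambda>k. c * (\<I> t. f k (binary_point s' t) * q' t)) \<longlonglongrightarrow> (\<I> t. indicator {..x} (binary_point s t) * q t)"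
    using lim[of s q, OF s q] unfolding cont[OF fc fb] .
  then show ?thesis
    using tendsto_mult_left[OF lim[of s' q', OF s' q'], of c] by (rule LIMSEQ_unique)
qed

section \<open>The Rademacher functions\<close>

text \<open>
  The Rademacher function $r_{i+1}$, extended periodically to the real line.
\<close>

definition dyadic_sign :: "nat \<Rightarrow> real \<Rightarrow> real" where
  "dyadic_sign i t = (if even \<lfloor>2 ^ Suc i * t\<rfloor> then 1 else -1)"

lemma dyadic_sign_borel: "dyadic_sign i \<in> borel_measurable borel"
proof -
  have "(\<lambda>t::real. \<lfloor>2 ^ Suc i * t\<rfloor>) \<in> measurable borel (count_space UNIV)" by measurable
  then show ?thesis unfolding dyadic_sign_def[abs_def] by measurable
qed

lemma sign_function_dyadic: "sign_function (dyadic_sign i)"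
  unfolding sign_function_def using borel_measurable_leb01[OF dyadic_sign_borel]
  by (simp add: dyadic_sign_def)

lemma rademacher_eq_dyadic_sign:
  assumes t: "0 \<le> t" "t < 1"
  shows "rademacher (Suc i) t = dyadic_sign i t"
proof -
  let ?n = "Suc i"
  define m where "m = nat \<lfloor>2 ^ ?n * t\<rfloor>"
  have fl0: "0 \<le> \<lfloor>2 ^ ?n * t\<rfloor>" using t by simp
  then have m: "real m = of_int \<lfloor>2 ^ ?n * t\<rfloor>" by (simp add: m_def)
  have mle: "real m \<le> 2 ^ ?n * t" "2 ^ ?n * t < real m + 1" unfolding m by linarith+
  have "2 ^ ?n * t < 2 ^ ?n * 1" using t by (intro mult_strict_left_mono) auto
  then have "real m < 2 ^ ?n" using mle(1) by linarith
  then have "real m < real (2 ^ ?n)" by simp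
  then have m2: "m < 2 ^ ?n" by (simp only: of_nat_less_iff)
  have "(\<Sum>k=1..2^?n. (-1)^(k-1) * indicator {(real k - 1) / 2^?n ..< real k / 2^?n} t)
      = (\<Sum>k=1..2^?n. if k = Suc m then (-1)^m else (0::real))"
  proof (rule sum.cong[OF refl])
    fix k :: nat assume k: "k \<in> {1..2^?n}"
    have "t \<in> {(real k - 1) / 2^?n ..< real k / 2^?n} \<longleftrightarrow> real k - 1 \<le> 2^?n * t \<and> 2^?n * t < real k"
      by (auto simp: field_simps)
    also have "\<dots> \<longleftrightarrow> k = Suc m"
    proof
      assume "real k - 1 \<le> 2^?n * t \<and> 2^?n * t < real k"
      then have "real k < real m + 2" "real m < real k" using mle by linarith+
      then show "k = Suc m" by linarith
    qed (use mle in auto)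
    finally show "(-1)^(k-1) * indicator {(real k - 1) / 2^?n ..< real k / 2^?n} t = (if k = Suc m then (-1)^m else (0::real))"
      by (simp add: indicator_def)
  qed
  also have "\<dots> = (-1)^m" using m2 by (subst sum.delta) auto
  also have "\<dots> = dyadic_sign i t"
  proof -
    have "even m \<longleftrightarrow> even \<lfloor>2 ^ ?n * t\<rfloor>" using fl0 by (simp add: m_def even_nat_iff)
    then show ?thesis by (simp only: dyadic_sign_def minus_one_power_iff)
  qed
  finally show ?thesis by (simp add: rademacher_def)
qed

lemma AE_leb01_less_1: "AE t in leb01. 0 \<le> t \<and> t < 1"
proof -
  have "AE t in lebesgue. t \<noteq> (1::real)" by (intro AE_completion AE_lborel_singleton)
  then have "AE t in lebesgue. t \<in> {0..1} \<longrightarrow> 0 \<le> t \<and> t < (1::real)"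
    by eventually_elim auto
  then show ?thesis by (subst AE_restrict_space_iff) auto
qed

lemma binary_point_dyadic:
  assumes t: "0 \<le> t" "t < 1"
  shows "binary_point dyadic_sign t = t"
proof -
  have part: "(\<Sum>i<N. (1 - dyadic_sign i t) / 2 ^ (i + 2)) = of_int \<lfloor>2 ^ N * t\<rfloor> / 2 ^ N" for N
  proof (induction N)
    case 0
    have "\<lfloor>t\<rfloor> = 0" using t by (simp add: floor_eq_iff)
    then show ?case by simp
  next
    case (Suc N)
    define m where "m = \<lfloor>2 ^ Suc N * t\<rfloor>"
    have m: "of_int m \<le> 2 * (2 ^ N * t)" "2 * (2 ^ N * t) < of_int m + 1"
      unfolding m_def power_Suc mult.assoc by linarith+
    show ?case
    proof (cases "even m")
      case True
      then obtain k where k: "m = 2 * k" by (rule evenE)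
      have "\<lfloor>2 ^ N * t\<rfloor> = k" using m unfolding k by (intro floor_unique) auto
      moreover have "dyadic_sign N t = 1" using True unfolding dyadic_sign_def m_def by simp
      ultimately show ?thesis unfolding sum.lessThan_Suc Suc m_def[symmetric] k by simp
    next
      case False
      then obtain k where k: "m = 2 * k + 1" by (rule oddE)
      have "\<lfloor>2 ^ N * t\<rfloor> = k" using m unfolding k by (intro floor_unique) auto
      moreover have "dyadic_sign N t = -1" using False unfolding dyadic_sign_def m_def by simp
      ultimately show ?thesis unfolding sum.lessThan_Suc Suc m_def[symmetric] k by (simp add: field_simps)
    qed
  qed
  have lim: "(\<lambda>N. of_int \<lfloor>2 ^ N * t\<rfloor> / 2 ^ N) \<longlonglongrightarrow> t"
  proof (rule tendsto_sandwich[of "\<lambda>N. t - (1/2)^N" _ _ "\<lambda>_. t"])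
    have b: "2 ^ N * t - 1 \<le> of_int \<lfloor>2 ^ N * t\<rfloor>" "of_int \<lfloor>2 ^ N * t\<rfloor> \<le> 2 ^ N * t" for N by linarith+
    show "\<forall>\<^sub>F N in sequentially. t - (1/2)^N \<le> of_int \<lfloor>2 ^ N * t\<rfloor> / 2 ^ N"
    proof (intro always_eventually allI)
      fix N
      have "t - (1/2)^N = (2 ^ N * t - 1) / 2 ^ N" by (simp add: diff_divide_distrib power_divide)
      also have "\<dots> \<le> of_int \<lfloor>2 ^ N * t\<rfloor> / 2 ^ N" by (intro divide_right_mono b(1)) simp
      finally show "t - (1/2)^N \<le> of_int \<lfloor>2 ^ N * t\<rfloor> / 2 ^ N" .
    qed
    show "\<forall>\<^sub>F N in sequentially. of_int \<lfloor>2 ^ N * t\<rfloor> / 2 ^ N \<le> t"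
      using b(2) by (intro always_eventually allI) (simp add: field_simps)
    have "(\<lambda>N. t - (1/2)^N) \<longlonglongrightarrow> t - 0" by (intro tendsto_diff tendsto_const LIMSEQ_power_zero) simp
    then show "(\<lambda>N. t - (1/2)^N) \<longlonglongrightarrow> t" by simp
  qed simp
  have "(\<lambda>N. \<Sum>i<N. (1 - dyadic_sign i t) / 2 ^ (i + 2)) \<longlonglongrightarrow> binary_point dyadic_sign t"
    using binary_point_sums(1)[of dyadic_sign t, OF sign_function_dyadic] by (simp only: sums_def)
  with lim show ?thesis unfolding part by (rule LIMSEQ_unique[rotated])
qed

lemma integral_leb01_eq_lborel:
  fixes f :: "real \<Rightarrow> real"
  assumes f: "f \<in> borel_measurable borel"
  shows "(\<I> t. f t) = (\<integral>t. indicator {0..<1} t * f t \<partial>lborel)"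
proof -
  note f[measurable]
  have "(\<I> t. f t) = (\<integral>t. indicator {0..1} t * f t \<partial>lebesgue)"
    using integral_restrict_space[of "{0..1}" lebesgue f] by simp
  also have "\<dots> = (\<integral>t. indicator {0..1} t * f t \<partial>lborel)"
    by (rule integral_completion) measurable
  also have "\<dots> = (\<integral>t. indicator {0..<1} t * f t \<partial>lborel)"
  proof (rule integral_cong_AE)
    have "AE t in lborel. t \<noteq> (1::real)" by (rule AE_lborel_singleton)
    then show "AE t in lborel. indicator {0..1} t * f t = indicator {0..<1} t * f t"
      by eventually_elim (auto simp: indicator_def)
    show "(\<lambda>t. indicator {0..1} t * f t) \<in> borel_measurable lborel"
      "(\<lambda>t. indicator {0..<1} t * f t) \<in> borel_measurable lborel"
      by measurable
  qed
  finally show ?thesis .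
qed

text \<open>
  The substitutions $t \mapsto t/2$ and $t \mapsto (t+1)/2$ onto the two halves of the unit
  interval. They shift the index of a dyadic sign by one and make the first one constant.
\<close>

lemma integral_leb01_halves:
  fixes f :: "real \<Rightarrow> real"
  assumes f: "f \<in> borel_measurable borel" and b: "\<And>t. \<bar>f t\<bar> \<le> K"
  shows "(\<I> t. f t) = ((\<I> t. f (t / 2)) + (\<I> t. f ((t + 1) / 2))) / (2::real)"
proof -
  define a where "a x = indicator {0..<1} x * f (x / 2)" for x :: real
  define c where "c x = indicator {0..<1} x * f ((x + 1) / 2)" for x :: real
  have am: "a \<in> borel_measurable borel" "c \<in> borel_measurable borel"
    unfolding a_def c_def using f by measurable
  have int: "integrable lborel g" if "g \<in> borel_measurable borel" "\<And>x. \<bar>g x\<bar> \<le> K * indicator {0..<1} x" for g :: "real \<Rightarrow> real"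
  proof (rule Bochner_Integration.integrable_bound)
    show "integrable lborel (\<lambda>x. K * indicator {0..<1::real} x)" by simp
    show "AE x in lborel. norm (g x) \<le> norm (K * indicator {0..<1} x)"
      using that(2) by (intro AE_I2) (simp add: order_trans[OF _ abs_ge_self])
  qed (use that(1) in simp)
  have ai: "integrable lborel a" "integrable lborel c"
    by (rule int; use am b in \<open>auto simp: a_def c_def indicator_def\<close>)+
  have ia: "(\<integral>x. a x \<partial>lborel) = 2 * (\<integral>x. a (2 * x) \<partial>lborel)"
    using lborel_integral_real_affine[of 2 a 0] by simp
  have ic: "(\<integral>x. c x \<partial>lborel) = 2 * (\<integral>x. c (-1 + 2 * x) \<partial>lborel)"
    using lborel_integral_real_affine[of 2 c "-1"] by simp
  have aff: "integrable lborel (\<lambda>x. a (2 * x))" "integrable lborel (\<lambda>x. c (-1 + 2 * x))"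
    using lborel_integrable_real_affine[OF ai(1), of 2 0] lborel_integrable_real_affine[OF ai(2), of 2 "-1"] by simp_all
  have "(\<I> t. f t) = (\<integral>t. a (2 * t) + c (-1 + 2 * t) \<partial>lborel)"
    unfolding integral_leb01_eq_lborel[OF f]
    by (rule Bochner_Integration.integral_cong) (auto simp: a_def c_def indicator_def)
  also have "\<dots> = (\<integral>t. a (2 * t) \<partial>lborel) + (\<integral>t. c (-1 + 2 * t) \<partial>lborel)"
    by (rule Bochner_Integration.integral_add[OF aff])
  also have "\<dots> = ((\<integral>x. a x \<partial>lborel) + (\<integral>x. c x \<partial>lborel)) / 2"
    unfolding ia ic by simp
  also have "(\<integral>x. a x \<partial>lborel) = (\<I> t. f (t / 2))"
    unfolding a_def by (rule integral_leb01_eq_lborel[symmetric]) (use f in measurable)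
  also have "(\<integral>x. c x \<partial>lborel) = (\<I> t. f ((t + 1) / 2))"
    unfolding c_def by (rule integral_leb01_eq_lborel[symmetric]) (use f in measurable)
  finally show ?thesis .
qed

lemma dyadic_sign_halves:
  assumes x: "0 \<le> x" "x < 1"
  shows "dyadic_sign 0 (x / 2) = 1" "dyadic_sign 0 ((x + 1) / 2) = -1"
    "dyadic_sign (Suc i) (x / 2) = dyadic_sign i x" "dyadic_sign (Suc i) ((x + 1) / 2) = dyadic_sign i x"
proof -
  have "\<lfloor>x\<rfloor> = 0" "\<lfloor>x + 1\<rfloor> = 1" using x by (auto simp: floor_eq_iff)
  moreover have "2 ^ Suc 0 * (x / 2) = x" "2 ^ Suc 0 * ((x + 1) / 2) = x + 1" by simp_all
  ultimately show "dyadic_sign 0 (x / 2) = 1" "dyadic_sign 0 ((x + 1) / 2) = -1"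
    unfolding dyadic_sign_def by (simp_all only: even_zero odd_one if_True if_False simp_thms)
  have "2 ^ Suc (Suc i) * (x / 2) = 2 ^ Suc i * x" by simp
  then show "dyadic_sign (Suc i) (x / 2) = dyadic_sign i x" by (simp only: dyadic_sign_def)
  have "2 ^ Suc (Suc i) * ((x + 1) / 2) = 2 ^ Suc i * x + of_int (2 ^ Suc i)" by (simp add: field_simps)
  then have "\<lfloor>2 ^ Suc (Suc i) * ((x + 1) / 2)\<rfloor> = \<lfloor>2 ^ Suc i * x\<rfloor> + 2 ^ Suc i"
    by (simp only: floor_add_int[symmetric])
  then show "dyadic_sign (Suc i) ((x + 1) / 2) = dyadic_sign i x"
    unfolding dyadic_sign_def by (simp only:) simp
qed

text \<open>
  Passing to the halves shifts all indices down by one. If the index 0 occurs, the two halves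
  contribute opposite numbers; otherwise the integral is that of the shifted Walsh product.
\<close>

lemma integral_walsh_dyadic:
  assumes "finite S"
  shows "(\<I> t. walsh dyadic_sign S t) = (if S = {} then 1 else 0)"
proof -
  have one: "(\<I> t. 1) = (1::real)" by (simp add: measure_restrict_space)
  have "\<forall>S. S \<subseteq> {..<N} \<longrightarrow> S \<noteq> {} \<longrightarrow> (\<I> t. walsh dyadic_sign S t) = 0" for N
  proof (induction N)
    case (Suc N)
    show ?case
    proof (intro allI impI)
      fix S :: "nat set" assume S: "S \<subseteq> {..<Suc N}" "S \<noteq> {}"
      then have fS: "finite S" using finite_subset by blast
      define S' where "S' = {i. Suc i \<in> S}"
      have S'N: "S' \<subseteq> {..<N}" using S(1) by (auto simp: S'_def)
      have pos: "S - {0} = Suc ` S'"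
      proof
        show "S - {0} \<subseteq> Suc ` S'"
        proof
          fix j assume "j \<in> S - {0}"
          then show "j \<in> Suc ` S'" by (cases j) (auto simp: S'_def)
        qed
      qed (auto simp: S'_def)
      have red: "walsh r S t = (if 0 \<in> S then r 0 t else 1) * (\<Prod>i\<in>S'. r (Suc i) t)" for r t
      proof -
        have "(\<Prod>i\<in>S - {0}. r i t) = (\<Prod>i\<in>S'. r (Suc i) t)"
          unfolding pos by (subst prod.reindex) auto
        moreover have "0 \<notin> S \<Longrightarrow> S - {0} = S" by blast
        ultimately show ?thesis unfolding walsh_def
          using prod.remove[OF fS, of 0 "\<lambda>i. r i t"] by (cases "0 \<in> S") simp_all
      qed
      have wm: "walsh dyadic_sign S \<in> borel_measurable borel"
        unfolding walsh_def[abs_def] by (intro borel_measurable_prod dyadic_sign_borel)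
      have wb: "\<bar>walsh dyadic_sign S t\<bar> \<le> 1" for t
        using sign_functionD(3)[OF sign_function_walsh[OF sign_function_dyadic fS]] by simp
      have cong: "(\<I> t. f t) = (\<I> t. g t)"
        if "\<And>t. 0 \<le> t \<Longrightarrow> t < 1 \<Longrightarrow> f t = g t" "f \<in> borel_measurable leb01" "g \<in> borel_measurable leb01" for f g :: "real \<Rightarrow> real"
        using that(2,3)
      proof (rule integral_cong_AE)
        show "AE t in leb01. f t = g t"
          using AE_leb01_less_1 by eventually_elim (use that(1) in blast)
      qed
      have w'm: "walsh dyadic_sign S' \<in> borel_measurable leb01"
        unfolding walsh_def[abs_def] by (intro borel_measurable_prod sign_functionD(1) sign_function_dyadic)
      have wm1: "(\<lambda>t. walsh dyadic_sign S (t / 2)) \<in> borel_measurable leb01"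
        and wm2: "(\<lambda>t. walsh dyadic_sign S ((t + 1) / 2)) \<in> borel_measurable leb01"
        using wm by (auto intro!: borel_measurable_leb01 measurable_compose[OF _ wm])
      have i1: "(\<I> t. walsh dyadic_sign S (t / 2)) = (\<I> t. walsh dyadic_sign S' t)"
        by (rule cong[OF _ wm1 w'm]) (simp only: red, simp add: walsh_def dyadic_sign_halves)
      have i2: "(\<I> t. walsh dyadic_sign S ((t + 1) / 2)) = (\<I> t. (if 0 \<in> S then -1 else 1) * walsh dyadic_sign S' t)"
      proof (rule cong[OF _ wm2])
        show "(\<lambda>t. (if 0 \<in> S then -1 else 1) * walsh dyadic_sign S' t) \<in> borel_measurable leb01"
          by (intro borel_measurable_times borel_measurable_const w'm)
        show "walsh dyadic_sign S ((t + 1) / 2) = (if 0 \<in> S then -1 else 1) * walsh dyadic_sign S' t"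
          if "0 \<le> t" "t < 1" for t
          unfolding red using that by (simp add: walsh_def dyadic_sign_halves)
      qed
      have tot: "(\<I> t. walsh dyadic_sign S t) = ((\<I> t. walsh dyadic_sign S' t) +
          (if 0 \<in> S then -1 else 1) * (\<I> t. walsh dyadic_sign S' t)) / 2"
        unfolding integral_leb01_halves[OF wm wb] i1 i2 integral_mult_right_zero ..
      show "(\<I> t. walsh dyadic_sign S t) = 0"
      proof (cases "0 \<in> S")
        case False
        then have "S' \<noteq> {}" using S(2) pos by auto
        then show ?thesis unfolding tot using Suc S'N by simp
      qed (unfold tot, simp)
    qed
  qed simp
  moreover obtain N where "S \<subseteq> {..<N}" using finite_nat_iff_bounded assms by blast
  ultimately show ?thesis using one by (auto simp: walsh_def)
qed

lemma integral_walsh_mult_dyadic: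
  assumes S: "finite S"
  shows "(\<I> t. walsh dyadic_sign S t * dyadic_sign n t) = (if S = {n} then 1 else 0)"
proof (cases "n \<in> S")
  case True
  have "walsh dyadic_sign S t * dyadic_sign n t = walsh dyadic_sign (S - {n}) t" for t
    using walsh_insert[of "S - {n}" n dyadic_sign t] S True sign_functionD(4)[OF sign_function_dyadic, of n t]
    by (simp add: insert_absorb mult.commute mult.left_commute)
  then show ?thesis using integral_walsh_dyadic[of "S - {n}"] S True by auto
next
  case False
  have "walsh dyadic_sign S t * dyadic_sign n t = walsh dyadic_sign (insert n S) t" for t
    using walsh_insert[OF S False] by (simp add: mult.commute)
  then show ?thesis using integral_walsh_dyadic[of "insert n S"] S False by auto
qed

section \<open>Lyapunov's theorem\<close>

text \<open>
  Dependent choice where each step sees the list of all previous choices.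
\<close>

lemma history_choice:
  assumes step: "\<And>h. \<forall>w\<in>set h. R w \<Longrightarrow> \<exists>z. R z \<and> P h z"
  obtains s :: "nat \<Rightarrow> 'a" where "\<And>n. R (s n)" "\<And>n. P (map s [0..<n]) (s n)"
proof -
  define nxt where "nxt h = (SOME z. R z \<and> P h z)" for h
  define hist where "hist = rec_nat [] (\<lambda>_ h. h @ [nxt h])"
  define s where "s n = nxt (hist n)" for n
  have hist: "hist n = map s [0..<n]" for n
    by (induction n) (simp_all add: hist_def s_def)
  have nxt: "R (nxt h) \<and> P h (nxt h)" if "\<forall>w\<in>set h. R w" for h
    unfolding nxt_def using step[OF that] by (rule someI_ex)
  have R: "\<forall>w\<in>set (hist n). R w" for n
  proof (induction n)
    case (Suc n)
    have "hist (Suc n) = hist n @ [nxt (hist n)]" by (simp add: hist_def)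
    then show ?case using Suc nxt[OF Suc] by simp
  qed (simp add: hist_def)
  show ?thesis
    by (rule that[of s]) (use nxt[OF R] in \<open>simp_all only: s_def hist[symmetric]\<close>)
qed

lemma integral_finite_partition:
  fixes p :: "real \<Rightarrow> 'b" and G :: "'b \<Rightarrow> real"
  assumes P: "finite P" and pP: "\<And>t. p t \<in> P"
    and pm: "\<And>e. e \<in> P \<Longrightarrow> {t \<in> space leb01. p t = e} \<in> sets leb01"
    and f: "integrable leb01 f"
  shows "(\<I> t. G (p t) * f t) = (\<Sum>e\<in>P. G e * (\<I> t. indicator {t \<in> space leb01. p t = e} t * f t))"
proof -
  have "(\<I> t. G (p t) * f t) = (\<I> t. (\<Sum>e\<in>P. G e * (indicator {t \<in> space leb01. p t = e} t * f t)))"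
  proof (rule integral_congI)
    fix t assume t: "t \<in> space leb01"
    have "(\<Sum>e\<in>P. G e * (indicator {t \<in> space leb01. p t = e} t * f t)) = (\<Sum>e\<in>P. if e = p t then G (p t) * f t else 0)"
      by (rule sum.cong) (use t in \<open>auto simp: indicator_def\<close>)
    then show "G (p t) * f t = (\<Sum>e\<in>P. G e * (indicator {t \<in> space leb01. p t = e} t * f t))"
      using P pP[of t] by simp
  qed
  also have "\<dots> = (\<Sum>e\<in>P. \<I> t. G e * (indicator {t \<in> space leb01. p t = e} t * f t))"
    by (rule Bochner_Integration.integral_sum) (intro integrable_mult_right integrable_indicator_mult disjI2 pm f)
  finally show ?thesis by (simp only: integral_mult_right_zero)
qed

lemma history_partition:
  assumes h: "\<forall>w\<in>set h. sign_function w"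
  defines "P \<equiv> {l :: real list. set l \<subseteq> {1, -1} \<and> length l = length h}"
  shows "finite P" "map (\<lambda>w. w t) h \<in> P" "{t \<in> space leb01. map (\<lambda>w. w t) h = e} \<in> sets leb01"
proof -
  show "finite P" unfolding P_def by (rule finite_lists_length_eq) simp
  show "map (\<lambda>w. w t) h \<in> P" unfolding P_def using h by (auto simp: sign_function_def)
  show "{t \<in> space leb01. map (\<lambda>w. w t) h = e} \<in> sets leb01"
    using h
  proof (induction h arbitrary: e)
    case Nil
    show ?case
    proof (cases "e = []")
      case True
      then have "{t \<in> space leb01. map (\<lambda>w. w t) [] = e} = space leb01" by auto
      then show ?thesis by (simp only: sets.top)
    next
      case False
      then have "{t \<in> space leb01. map (\<lambda>w. w t) [] = e} = {}" by auto
      then show ?thesis by (simp only: sets.empty_sets)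
    qed
  next
    case (Cons w h)
    show ?case
    proof (cases e)
      case (Cons a e')
      have [measurable]: "w \<in> borel_measurable leb01" using Cons.prems by (simp add: sign_function_def)
      have "{t \<in> space leb01. w t = a} \<in> sets leb01" by measurable
      moreover have "{t \<in> space leb01. map (\<lambda>w. w t) h = e'} \<in> sets leb01"
        using Cons.IH Cons.prems by simp
      moreover have "{t \<in> space leb01. map (\<lambda>w. w t) (w # h) = e} =
        {t \<in> space leb01. w t = a} \<inter> {t \<in> space leb01. map (\<lambda>w. w t) h = e'}"
        unfolding Cons by auto
      ultimately show ?thesis by (simp only: sets.Int)
    qed simp
  qed
qed

text \<open>
  A scale is a level function that halves, thirds and so on simultaneously for all members of $Q$:
  the part of $E$ below level $x$ carries the fraction $x$ of the integral of each of them. Its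
  sublevel sets are the increasing family in elementary proofs of Lyapunov's theorem.
\<close>

definition scale :: "(real \<Rightarrow> real) set \<Rightarrow> real set \<Rightarrow> (real \<Rightarrow> real) \<Rightarrow> bool" where
  "scale Q E \<theta> \<longleftrightarrow> \<theta> \<in> borel_measurable leb01 \<and> (\<forall>t. 0 \<le> \<theta> t \<and> \<theta> t \<le> 1) \<and>
    (\<forall>q\<in>Q. \<forall>x. 0 \<le> x \<longrightarrow> x \<le> 1 \<longrightarrow>
      (\<I> t. indicator {..x} (\<theta> t) * (indicator E t * q t)) = x * (\<I> t. indicator E t * q t))"

lemma scaleD:
  assumes "scale Q E \<theta>" "q \<in> Q" "0 \<le> x" "x \<le> 1"
  shows "(\<I> t. indicator {..x} (\<theta> t) * (indicator E t * q t)) = x * (\<I> t. indicator E t * q t)"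
  using assms by (simp add: scale_def)

lemma sign_function_of_choice:
  assumes P: "finite P" and pP: "\<And>t. p t \<in> P"
    and pm: "\<And>e. {t \<in> space leb01. p t = e} \<in> sets leb01"
    and H: "\<And>e. H e \<in> sets leb01"
  shows "sign_function (\<lambda>t. if t \<in> space leb01 \<and> t \<in> H (p t) then 1 else -1)"
  unfolding sign_function_def
proof
  have "{t \<in> space leb01. t \<in> space leb01 \<and> t \<in> H (p t)} = (\<Union>e\<in>P. {t \<in> space leb01. p t = e} \<inter> H e)"
    using pP by auto
  also have "\<dots> \<in> sets leb01" by (rule sets.finite_UN[OF P]) (intro sets.Int pm H)
  finally have "{t \<in> space leb01. t \<in> space leb01 \<and> t \<in> H (p t)} \<in> sets leb01" .
  then show "(\<lambda>t. if t \<in> space leb01 \<and> t \<in> H (p t) then 1 else -1 :: real) \<in> borel_measurable leb01"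
    by (intro measurable_If borel_measurable_const)
qed simp

text \<open>
  Halving repeatedly all atoms obtained so far produces signs whose Walsh products are orthogonal on
  $E$ to all members of $Q$; the binary point of these signs is a scale.
\<close>

lemma halving_imp_scale:
  assumes Q: "\<And>q. q \<in> Q \<Longrightarrow> integrable leb01 q"
    and halve: "\<And>E. E \<in> sets leb01 \<Longrightarrow> \<exists>H. H \<in> sets leb01 \<and>
      (\<forall>q\<in>Q. 2 * (\<I> t. indicator (E \<inter> H) t * q t) = (\<I> t. indicator E t * q t))"
    and E: "E \<in> sets leb01"
  shows "\<exists>\<theta>. scale Q E \<theta>"
proof -
  have Eq: "integrable leb01 (\<lambda>t. indicator E t * q t)" if "q \<in> Q" for q
    using integrable_indicator_mult[OF disjI2[OF E] Q[OF that]] .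
  obtain s where s: "\<And>n. sign_function (s n)"
    and bal: "\<And>n. \<forall>q\<in>Q. \<forall>G :: real list \<Rightarrow> real. (\<I> t. G (map (\<lambda>w. w t) (map s [0..<n])) * (s n t * (indicator E t * q t))) = 0"
  proof (rule history_choice[where R = sign_function and P = "\<lambda>h \<sigma>. \<forall>q\<in>Q. \<forall>G :: real list \<Rightarrow> real.
        (\<I> t. G (map (\<lambda>w. w t) h) * (\<sigma> t * (indicator E t * q t))) = 0"])
    fix h :: "(real \<Rightarrow> real) list" assume h: "\<forall>w\<in>set h. sign_function w"
    note hp = history_partition[OF h]
    let ?p = "\<lambda>t. map (\<lambda>w. w t) h"
    let ?A = "\<lambda>e. {t \<in> space leb01. ?p t = e}"
    have "\<forall>e. \<exists>H. H \<in> sets leb01 \<and> (\<forall>q\<in>Q. 2 * (\<I> t. indicator ((E \<inter> ?A e) \<inter> H) t * q t) = (\<I> t. indicator (E \<inter> ?A e) t * q t))"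
      by (intro allI halve sets.Int E hp(3))
    from choice[OF this] obtain H where H': "\<forall>e. H e \<in> sets leb01 \<and>
      (\<forall>q\<in>Q. 2 * (\<I> t. indicator ((E \<inter> ?A e) \<inter> H e) t * q t) = (\<I> t. indicator (E \<inter> ?A e) t * q t))"
      by (elim exE)
    have H: "H e \<in> sets leb01" for e using H' by blast
    have half: "2 * (\<I> t. indicator ((E \<inter> ?A e) \<inter> H e) t * q t) = (\<I> t. indicator (E \<inter> ?A e) t * q t)"
      if "q \<in> Q" for e q using H' that by blast
    define \<sigma> where "\<sigma> t = (if t \<in> space leb01 \<and> t \<in> H (?p t) then 1 else -1 :: real)" for t
    have \<sigma>: "sign_function \<sigma>" unfolding \<sigma>_def by (rule sign_function_of_choice[OF hp(1,2,3) H])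
    have "(\<I> t. G (?p t) * (\<sigma> t * (indicator E t * q t))) = 0" if q: "q \<in> Q" for q G
    proof -
      have int: "integrable leb01 (\<lambda>t. \<sigma> t * (indicator E t * q t))"
        by (rule integrable_bounded_mult[OF sign_functionD(5)[OF \<sigma>] Eq[OF q]])
      have zero: "(\<I> t. indicator (?A e) t * (\<sigma> t * (indicator E t * q t))) = 0" for e
      proof -
        have i: "integrable leb01 (\<lambda>t. indicator B t * q t)" if "B \<in> sets leb01" for B
          by (rule integrable_indicator_mult[OF disjI2[OF that] Q[OF q]])
        have B: "E \<inter> ?A e \<in> sets leb01" "(E \<inter> ?A e) \<inter> H e \<in> sets leb01"
          by (intro sets.Int E hp(3) H)+
        have "(\<I> t. indicator (?A e) t * (\<sigma> t * (indicator E t * q t))) =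
          (\<I> t. 2 * (indicator ((E \<inter> ?A e) \<inter> H e) t * q t) - indicator (E \<inter> ?A e) t * q t)"
          by (rule integral_congI) (auto simp: \<sigma>_def indicator_def)
        also have "\<dots> = 2 * (\<I> t. indicator ((E \<inter> ?A e) \<inter> H e) t * q t) - (\<I> t. indicator (E \<inter> ?A e) t * q t)"
          unfolding integral_mult_right_zero[symmetric]
          by (rule Bochner_Integration.integral_diff[OF integrable_mult_right[OF i[OF B(2)]] i[OF B(1)]])
        also have "\<dots> = 0" using half[OF q] by simp
        finally show ?thesis .
      qed
      show ?thesis
        unfolding integral_finite_partition[OF hp(1,2,3) int, of G] zero by simp
    qed
    then show "\<exists>\<sigma>. sign_function \<sigma> \<and> (\<forall>q\<in>Q. \<forall>G :: real list \<Rightarrow> real. (\<I> t. G (?p t) * (\<sigma> t * (indicator E t * q t))) = 0)"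
      using \<sigma> by blast
  next
    fix s assume "\<And>n. sign_function (s n)" "\<And>n. \<forall>q\<in>Q. \<forall>G :: real list \<Rightarrow> real. (\<I> t. G (map (\<lambda>w. w t) (map s [0..<n])) * (s n t * (indicator E t * q t))) = 0"
    then show thesis by (rule that)
  qed
  have mom: "(\<I> t. walsh s S t * (indicator E t * q t)) = (\<I> t. indicator E t * q t) * (\<I> t. walsh dyadic_sign S t * 1)"
    if q: "q \<in> Q" and S: "finite S" for q S
  proof (cases "S = {}")
    case True
    then show ?thesis using integral_walsh_dyadic[of "{}"] by (simp add: walsh_def)
  next
    case False
    define n where "n = Max S"
    have n: "n \<in> S" "S - {n} \<subseteq> {..<n}" using S False Max_ge[OF S] by (auto simp: n_def le_less)
    have w: "walsh s S t = (\<Prod>i\<in>S - {n}. map (\<lambda>w. w t) (map s [0..<n]) ! i) * s n t" for t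
    proof -
      have "(\<Prod>i\<in>S - {n}. map (\<lambda>w. w t) (map s [0..<n]) ! i) = walsh s (S - {n}) t"
        unfolding walsh_def using n(2) by (intro prod.cong) auto
      then show ?thesis using walsh_insert[of "S - {n}" n s t] S n(1) by (simp add: insert_absorb mult.commute)
    qed
    have "(\<I> t. walsh s S t * (indicator E t * q t)) = 0"
      unfolding w mult.assoc using bal[of n, rule_format, OF q, of "\<lambda>l. \<Prod>i\<in>S - {n}. l ! i"] .
    then show ?thesis using integral_walsh_dyadic[OF S] False by simp
  qed
  have "scale Q E (binary_point s)"
    unfolding scale_def
  proof (intro conjI allI ballI impI)
    show "binary_point s \<in> borel_measurable leb01" by (rule binary_point_measurable[OF s])
    show "0 \<le> binary_point s t" for t by (rule binary_point_sums[OF s])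
    show "binary_point s t \<le> 1" for t by (rule binary_point_sums[OF s])
    fix q and x :: real assume q: "q \<in> Q" and x: "0 \<le> x" "x \<le> 1"
    have "(\<I> t. indicator {..x} (binary_point s t) * (indicator E t * q t)) =
      (\<I> t. indicator E t * q t) * (\<I> t. indicator {..x} (binary_point dyadic_sign t) * 1)"
      by (rule binary_point_halfline_transfer[OF s sign_function_dyadic Eq[OF q] _ mom[OF q]]) simp
    also have "(\<I> t. indicator {..x} (binary_point dyadic_sign t) * 1) = (\<I> t. indicator {0..x} t :: real)"
    proof (rule integral_cong_AE)
      show "AE t in leb01. indicator {..x} (binary_point dyadic_sign t) * 1 = (indicator {0..x} t :: real)"
        using AE_leb01_less_1 by eventually_elim (simp add: binary_point_dyadic indicator_def)
      have [measurable]: "binary_point dyadic_sign \<in> borel_measurable leb01"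
        by (rule binary_point_measurable[OF sign_function_dyadic])
      show "(\<lambda>t. indicator {..x} (binary_point dyadic_sign t) * 1 :: real) \<in> borel_measurable leb01"
        by measurable
    qed (rule borel_measurable_leb01, measurable)
    also have "\<dots> = x"
      using x by (simp add: measure_restrict_space)
    finally show "(\<I> t. indicator {..x} (binary_point s t) * (indicator E t * q t)) = x * (\<I> t. indicator E t * q t)"
      by (simp only: mult.commute)
  qed
  then show ?thesis by blast
qed

text \<open>
  The part of $E$ between the levels $x$ and $x + 1/2$ has an integral depending continuously on $x$.
  Its values at $0$ and $1/2$ add up to the whole integral, so half of it is attained in between.
\<close>

lemma halving_by_levels:
  fixes \<theta> q :: "real \<Rightarrow> real"
  assumes \<theta>: "\<theta> \<in> borel_measurable leb01" and E: "E \<in> sets leb01" and q: "integrable leb01 q"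
    and \<theta>01: "AE t in leb01. 0 \<le> \<theta> t \<and> \<theta> t \<le> 1"
    and cont: "\<And>x. 0 \<le> x \<Longrightarrow> x \<le> 1 \<Longrightarrow> AE t in leb01. t \<in> E \<longrightarrow> \<theta> t \<noteq> x"
  obtains \<alpha> where "0 \<le> \<alpha>" "\<alpha> \<le> 1/2"
    "2 * (\<I> t. indicator {\<alpha><..\<alpha> + 1/2} (\<theta> t) * (indicator E t * q t)) = (\<I> t. indicator E t * q t)"
proof -
  note \<theta>[measurable]
  have Eq: "integrable leb01 (\<lambda>t. indicator E t * q t)"
    by (rule integrable_indicator_mult[OF disjI2[OF E] q])
  have Iint: "integrable leb01 (\<lambda>t. indicator I (\<theta> t) * (indicator E t * q t))" if "I \<in> sets borel" for I :: "real set"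
  proof (rule integrable_bounded_mult[OF _ Eq])
    show "L1_bounded 1 (\<lambda>t. indicator I (\<theta> t))" using that by (auto simp: indicator_def[abs_def])
  qed
  define F where "F x = (\<I> t. indicator {..x} (\<theta> t) * (indicator E t * q t))" for x
  have Fc: "continuous_on {0..1} F"
    unfolding continuous_on_sequentially o_def
  proof (intro allI ballI impI)
    fix x :: "nat \<Rightarrow> real" and a assume a: "a \<in> {0..1}" and xa: "(\<forall>n. x n \<in> {0..1}) \<and> x \<longlonglongrightarrow> a"
    then have xa: "x \<longlonglongrightarrow> a" by blast
    have ae: "AE t in leb01. t \<in> E \<longrightarrow> \<theta> t \<noteq> a" using a by (intro cont) simp_all
    show "(\<lambda>n. F (x n)) \<longlonglongrightarrow> F a"
      unfolding F_def
    proof (rule integral_dominated_convergence[where w = "\<lambda>t. \<bar>indicator E t * q t\<bar>"])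
      show "AE t in leb01. (\<lambda>n. indicator {..x n} (\<theta> t) * (indicator E t * q t)) \<longlonglongrightarrow> indicator {..a} (\<theta> t) * (indicator E t * q t)"
        using ae
      proof eventually_elim
        case (elim t)
        show ?case
        proof (cases "t \<in> E")
          case True
          then have "\<theta> t < a \<or> a < \<theta> t" using elim a by auto
          then have "(\<lambda>n. indicator {..x n} (\<theta> t)) \<longlonglongrightarrow> (indicator {..a} (\<theta> t) :: real)"
          proof
            assume lt: "\<theta> t < a"
            have "\<forall>\<^sub>F n in sequentially. indicator {..x n} (\<theta> t) = (indicator {..a} (\<theta> t) :: real)"
              using order_tendstoD(1)[OF xa lt] by eventually_elim (use lt in simp)
            then show ?thesis by (rule tendsto_eventually)
          next
            assume gt: "a < \<theta> t"
            have "\<forall>\<^sub>F n in sequentially. indicator {..x n} (\<theta> t) = (indicator {..a} (\<theta> t) :: real)"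
              using order_tendstoD(2)[OF xa gt] by eventually_elim (use gt in simp)
            then show ?thesis by (rule tendsto_eventually)
          qed
          then show ?thesis by (intro tendsto_mult tendsto_const)
        qed simp
      qed
      show "AE t in leb01. norm (indicator {..x n} (\<theta> t) * (indicator E t * q t)) \<le> \<bar>indicator E t * q t\<bar>" for n
        by (intro AE_I2) (simp add: indicator_def)
      show "(\<lambda>t. indicator {..x n} (\<theta> t) * (indicator E t * q t)) \<in> borel_measurable leb01" for n
        by (rule borel_measurable_integrable[OF Iint]) simp
      show "(\<lambda>t. indicator {..a} (\<theta> t) * (indicator E t * q t)) \<in> borel_measurable leb01"
        by (rule borel_measurable_integrable[OF Iint]) simp
    qed (rule integrable_abs[OF Eq])
  qed
  define c where "c = (\<I> t. indicator E t * q t)"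
  have F0: "F 0 = 0"
  proof -
    have "F 0 = (\<I> t. 0)" unfolding F_def
    proof (rule integral_cong_AE)
      show "AE t in leb01. indicator {..0} (\<theta> t) * (indicator E t * q t) = 0"
        using cont[of 0, simplified] \<theta>01 by eventually_elim (auto simp: indicator_def)
      show "(\<lambda>t. indicator {..0} (\<theta> t) * (indicator E t * q t)) \<in> borel_measurable leb01"
        by (rule borel_measurable_integrable[OF Iint]) simp
    qed simp
    then show ?thesis by simp
  qed
  have F1: "F 1 = c" unfolding F_def c_def
  proof (rule integral_cong_AE)
    show "AE t in leb01. indicator {..1} (\<theta> t) * (indicator E t * q t) = indicator E t * q t"
      using \<theta>01 by eventually_elim (auto simp: indicator_def)
    show "(\<lambda>t. indicator {..1} (\<theta> t) * (indicator E t * q t)) \<in> borel_measurable leb01"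
      by (rule borel_measurable_integrable[OF Iint]) simp
  qed (rule borel_measurable_integrable[OF Eq])
  define D where "D \<alpha> = F (\<alpha> + 1/2) - F \<alpha>" for \<alpha>
  have Dc: "continuous_on {0..1/2} D"
    unfolding D_def by (intro continuous_intros continuous_on_compose2[OF Fc]) auto
  have sumD: "D 0 + D (1/2) = c" unfolding D_def by (simp add: F0 F1)
  have "\<exists>\<alpha>. 0 \<le> \<alpha> \<and> \<alpha> \<le> 1/2 \<and> D \<alpha> = c / 2"
  proof (cases "D 0 \<le> c / 2")
    case True
    then show ?thesis using sumD by (intro IVT' Dc) auto
  next
    case False
    then show ?thesis using sumD by (intro IVT2' Dc) auto
  qed
  then obtain \<alpha> where \<alpha>: "0 \<le> \<alpha>" "\<alpha> \<le> 1/2" "D \<alpha> = c / 2" by blast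
  have "(\<I> t. indicator {\<alpha><..\<alpha> + 1/2} (\<theta> t) * (indicator E t * q t)) = D \<alpha>"
    unfolding D_def F_def Bochner_Integration.integral_diff[OF Iint[of "{..\<alpha> + 1/2}"] Iint[of "{..\<alpha>}"], simplified, symmetric]
    by (rule Bochner_Integration.integral_cong) (auto simp: indicator_def)
  then show ?thesis using \<alpha> by (intro that[of \<alpha>]) (simp_all add: c_def)
qed

lemma scale_AE_neq:
  assumes s: "scale Q E \<theta>" and one: "(\<lambda>_. 1) \<in> Q" and E: "E \<in> sets leb01" and x: "0 \<le> x" "x \<le> 1"
  shows "AE t in leb01. t \<in> E \<longrightarrow> \<theta> t \<noteq> x"
proof -
  have \<theta>[measurable]: "\<theta> \<in> borel_measurable leb01" using s by (auto simp: scale_def)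
  define c where "c = (\<I> t. indicator E t * 1 :: real)"
  have g: "(\<I> t. indicator {..y} (\<theta> t) * (indicator E t * 1)) = y * c" if "0 \<le> y" "y \<le> 1" for y
    unfolding c_def by (rule scaleD[OF s one that])
  have Iint: "integrable leb01 (\<lambda>t. indicator I (\<theta> t) * (indicator E t * 1) :: real)" if "I \<in> sets borel" for I :: "real set"
  proof (rule integrable_bounded_mult[OF _ integrable_indicator_mult[OF disjI2[OF E]]])
    show "L1_bounded 1 (\<lambda>t. indicator I (\<theta> t))" using that by (auto simp: indicator_def[abs_def])
  qed simp
  have c: "0 \<le> c" "c \<le> 1"
  proof -
    have "c = measure leb01 E" unfolding c_def using integral_indicator_leb01[OF E] by (simp only: mult_1_right)
    moreover have "measure leb01 E \<le> measure leb01 (space leb01)" by (rule leb01.bounded_measure)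
    ultimately show "0 \<le> c" "c \<le> 1" by (simp_all add: measure_restrict_space)
  qed
  define m where "m = (\<I> t. indicator {x} (\<theta> t) * (indicator E t * 1) :: real)"
  have m: "m \<le> e" if e: "e > 0" for e
  proof (cases "x = 0")
    case True
    have "m \<le> (\<I> t. indicator {..0} (\<theta> t) * (indicator E t * 1))"
      unfolding m_def by (rule integral_mono[OF Iint Iint]) (auto simp: indicator_def True)
    also have "\<dots> = 0" using g[of 0] by simp
    finally show ?thesis using e by simp
  next
    case False
    define y where "y = max 0 (x - e)"
    have y: "0 \<le> y" "y < x" "x - y \<le> e" using False x e by (auto simp: y_def)
    have "m \<le> (\<I> t. indicator {..x} (\<theta> t) * (indicator E t * 1) - indicator {..y} (\<theta> t) * (indicator E t * 1))"
      unfolding m_def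
      by (rule integral_mono[OF Iint Bochner_Integration.integrable_diff[OF Iint Iint]])
        (use y in \<open>auto simp: indicator_def\<close>)
    also have "\<dots> = (\<I> t. indicator {..x} (\<theta> t) * (indicator E t * 1)) - (\<I> t. indicator {..y} (\<theta> t) * (indicator E t * 1))"
      by (rule Bochner_Integration.integral_diff) (rule Iint, simp)+
    also have "\<dots> = x * c - y * c"
      using x y by (subst (1 2) g) auto
    also have "\<dots> \<le> (x - y) * 1" unfolding left_diff_distrib[symmetric] using c y by (intro mult_left_mono) auto
    finally show ?thesis using y by simp
  qed
  have m0: "m \<le> 0" by (rule field_le_epsilon) (use m in simp)
  have nn: "AE t in leb01. 0 \<le> indicator {x} (\<theta> t) * (indicator E t * 1 :: real)"
    by (intro AE_I2) (simp add: indicator_def)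
  have "m = 0" using m0 integral_nonneg_AE[OF nn] unfolding m_def by linarith
  then have "AE t in leb01. indicator {x} (\<theta> t) * (indicator E t * 1 :: real) = 0"
    unfolding m_def by (subst (asm) integral_nonneg_eq_0_iff_AE[OF Iint nn]) auto
  then show ?thesis by eventually_elim (auto simp: indicator_def)
qed

text \<open>
  Induction on the number of functions. If there is a scale for the old functions, the parts of a
  set between the levels $x$ and $x + 1/2$ halve all of these for each $x$, and some $x$ halves the
  new function too. The constant function is always included because it makes all level sets null,
  which gives the continuity. For it alone the identity can serve as level function.
\<close>

lemma scale_exists:
  assumes "finite Q" "\<And>q. q \<in> Q \<Longrightarrow> integrable leb01 q" "E \<in> sets leb01"
  shows "\<exists>\<theta>. scale (insert (\<lambda>_. 1) Q) E \<theta>"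
  using assms
proof (induction Q arbitrary: E rule: finite_induct)
  case empty
  show ?case
  proof (rule halving_imp_scale[OF _ _ empty(2)])
    fix A assume A: "A \<in> sets leb01"
    obtain \<alpha> where \<alpha>: "2 * (\<I> t. indicator {\<alpha><..\<alpha> + 1/2} t * (indicator A t * 1)) = (\<I> t. indicator A t * 1 :: real)"
    proof (rule halving_by_levels[OF _ A, where \<theta> = "\<lambda>t. t" and q = "\<lambda>_. 1"])
      show "(\<lambda>t::real. t) \<in> borel_measurable leb01" by (rule borel_measurable_leb01) simp
      show "AE t in leb01. 0 \<le> t \<and> t \<le> (1::real)" using AE_leb01_less_1 by eventually_elim simp
      show "AE t in leb01. t \<in> A \<longrightarrow> t \<noteq> x" for x
      proof -
        have "AE t in lebesgue. t \<noteq> x" by (intro AE_completion AE_lborel_singleton)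
        then have "AE t in lebesgue. t \<in> {0..1} \<longrightarrow> t \<in> A \<longrightarrow> t \<noteq> x" by eventually_elim simp
        then show ?thesis by (subst AE_restrict_space_iff) auto
      qed
      show "integrable leb01 (\<lambda>_. 1 :: real)" by simp
      fix \<alpha> assume 3: "2 * (\<I> t. indicator {\<alpha><..\<alpha> + 1/2} t * (indicator A t * 1)) = (\<I> t. indicator A t * 1 :: real)"
      show thesis by (rule that[OF 3])
    qed
    show "\<exists>H. H \<in> sets leb01 \<and> (\<forall>q\<in>{\<lambda>_. 1}. 2 * (\<I> t. indicator (A \<inter> H) t * q t) = (\<I> t. indicator A t * q t :: real))"
    proof (intro exI[of _ "{0..1} \<inter> {\<alpha><..\<alpha> + 1/2}"] conjI ballI)
      fix q :: "real \<Rightarrow> real" assume "q \<in> {\<lambda>_. 1}"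
      then have q: "q = (\<lambda>_. 1)" by simp
      have "(\<I> t. indicator (A \<inter> ({0..1} \<inter> {\<alpha><..\<alpha> + 1/2})) t * 1) = (\<I> t. indicator {\<alpha><..\<alpha> + 1/2} t * (indicator A t * 1) :: real)"
        by (rule Bochner_Integration.integral_cong) (auto simp: indicator_def)
      then show "2 * (\<I> t. indicator (A \<inter> ({0..1} \<inter> {\<alpha><..\<alpha> + 1/2})) t * q t) = (\<I> t. indicator A t * q t)"
        unfolding q using \<alpha> by (simp only:)
    qed (rule borel_sets_leb01, simp)
  qed simp
next
  case (insert q Q)
  have Q1: "integrable leb01 q'" if "q' \<in> insert (\<lambda>_. 1) (insert q Q)" for q'
    using that insert.prems(1) by auto
  show ?case
  proof (rule halving_imp_scale[OF Q1 _ insert.prems(2)])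
    fix A assume A: "A \<in> sets leb01"
    obtain \<theta> where \<theta>: "scale (insert (\<lambda>_. 1) Q) A \<theta>"
      using insert.IH[OF _ A] insert.prems(1) by blast
    then have \<theta>m[measurable]: "\<theta> \<in> borel_measurable leb01" and \<theta>01: "\<And>t. 0 \<le> \<theta> t \<and> \<theta> t \<le> 1"
      by (auto simp: scale_def)
    obtain \<alpha> where \<alpha>: "0 \<le> \<alpha>" "\<alpha> \<le> 1/2"
      "2 * (\<I> t. indicator {\<alpha><..\<alpha> + 1/2} (\<theta> t) * (indicator A t * q t)) = (\<I> t. indicator A t * q t)"
    proof (rule halving_by_levels[OF \<theta>m A])
      show "integrable leb01 q" using insert.prems(1) by blast
      show "AE t in leb01. t \<in> A \<longrightarrow> \<theta> t \<noteq> x" if "0 \<le> x" "x \<le> 1" for x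
        by (rule scale_AE_neq[OF \<theta> _ A that]) simp
    qed (use \<theta>01 in simp_all)
    define H where "H = {t \<in> space leb01. \<theta> t \<in> {\<alpha><..\<alpha> + 1/2}}"
    have H: "H \<in> sets leb01" unfolding H_def by measurable
    have eq: "(\<I> t. indicator (A \<inter> H) t * q' t) = (\<I> t. indicator {\<alpha><..\<alpha> + 1/2} (\<theta> t) * (indicator A t * q' t))" for q' :: "real \<Rightarrow> real"
      by (rule integral_congI) (auto simp: indicator_def H_def)
    have "2 * (\<I> t. indicator (A \<inter> H) t * q' t) = (\<I> t. indicator A t * q' t)"
      if q': "q' \<in> insert (\<lambda>_. 1) (insert q Q)" for q'
    proof (cases "q' = q")
      case True
      then show ?thesis unfolding eq using \<alpha>(3) by simp
    next
      case False
      then have q'': "q' \<in> insert (\<lambda>_. 1) Q" using q' by blast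
      have sc: "(\<I> t. indicator {..x} (\<theta> t) * (indicator A t * q' t)) = x * (\<I> t. indicator A t * q' t)"
        if "0 \<le> x" "x \<le> 1" for x by (rule scaleD[OF \<theta> q'' that])
      have Iint: "integrable leb01 (\<lambda>t. indicator {..x} (\<theta> t) * (indicator A t * q' t))" for x :: real
      proof (rule integrable_bounded_mult[OF _ integrable_indicator_mult[OF disjI2[OF A] Q1[OF q']]])
        show "L1_bounded 1 (\<lambda>t. indicator {..x} (\<theta> t))" by (auto simp: indicator_def[abs_def])
      qed
      have "(\<I> t. indicator {\<alpha><..\<alpha> + 1/2} (\<theta> t) * (indicator A t * q' t)) =
        (\<I> t. indicator {..\<alpha> + 1/2} (\<theta> t) * (indicator A t * q' t) - indicator {..\<alpha>} (\<theta> t) * (indicator A t * q' t))"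
        by (rule Bochner_Integration.integral_cong) (auto simp: indicator_def)
      also have "\<dots> = (\<alpha> + 1/2) * (\<I> t. indicator A t * q' t) - \<alpha> * (\<I> t. indicator A t * q' t)"
        unfolding Bochner_Integration.integral_diff[OF Iint Iint] using \<alpha> by (simp add: sc)
      finally show ?thesis unfolding eq by (simp add: algebra_simps)
    qed
    with H show "\<exists>H. H \<in> sets leb01 \<and> (\<forall>q'\<in>insert (\<lambda>_. 1) (insert q Q). 2 * (\<I> t. indicator (A \<inter> H) t * q' t) = (\<I> t. indicator A t * q' t))"
      by blast
  qed
qed

text \<open>
  Where $w$ has the value $c$, put the sign 1 on the fraction $(1+c)/2$ of the level set, measured by a
  scale for all restrictions of the members of $Q$ to level sets of $w$. Then the sign has mean $c$
  there with respect to each of them.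
\<close>

lemma lyapunov_sign_function:
  assumes Q: "finite Q" "\<And>q. q \<in> Q \<Longrightarrow> integrable leb01 q"
    and w: "w \<in> borel_measurable leb01" "finite C" "\<And>t. w t \<in> C" "\<And>t. \<bar>w t\<bar> \<le> 1"
  obtains \<sigma> where "sign_function \<sigma>" "\<And>q. q \<in> Q \<Longrightarrow> (\<I> t. \<sigma> t * q t) = (\<I> t. w t * q t)"
proof -
  note w(1)[measurable]
  let ?A = "\<lambda>c. {t \<in> space leb01. w t = c}"
  have A: "?A c \<in> sets leb01" for c by measurable
  define Q' where "Q' = (\<Union>c\<in>C. (\<lambda>q t. indicator (?A c) t * q t :: real) ` Q)"
  have "finite Q'" unfolding Q'_def by (intro finite_UN_I finite_imageI w(2) Q(1))
  moreover have "integrable leb01 q" if qQ: "q \<in> Q'" for q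
  proof -
    obtain c q0 where "q0 \<in> Q" "q = (\<lambda>t. indicator (?A c) t * q0 t)"
      using qQ unfolding Q'_def by blast
    then show ?thesis using integrable_indicator_mult[OF disjI2[OF A] Q(2)] by (simp only:)
  qed
  ultimately obtain \<theta> where \<theta>: "scale (insert (\<lambda>_. 1) Q') (space leb01) \<theta>"
    using scale_exists[of Q' "space leb01"] sets.top by blast
  then have \<theta>m[measurable]: "\<theta> \<in> borel_measurable leb01" by (simp add: scale_def)
  define \<sigma> where "\<sigma> t = (if \<theta> t \<le> (1 + w t) / 2 then 1 else -1 :: real)" for t
  have \<sigma>: "sign_function \<sigma>" unfolding sign_function_def
  proof
    show "\<sigma> \<in> borel_measurable leb01" unfolding \<sigma>_def[abs_def] by measurable
  qed (simp add: \<sigma>_def)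
  show ?thesis
  proof (rule that[OF \<sigma>])
    fix q assume q: "q \<in> Q"
    have qi: "integrable leb01 q" by (rule Q(2)[OF q])
    have \<sigma>q: "integrable leb01 (\<lambda>t. \<sigma> t * q t)" by (rule integrable_bounded_mult[OF sign_functionD(5)[OF \<sigma>] qi])
    have piece: "(\<I> t. indicator (?A c) t * (\<sigma> t * q t)) = c * (\<I> t. indicator (?A c) t * q t)"
      if c: "c \<in> C" for c
    proof (cases "\<bar>c\<bar> \<le> 1")
      case True
      define x where "x = (1 + c) / 2"
      have x: "0 \<le> x" "x \<le> 1" using True by (auto simp: x_def)
      let ?f = "\<lambda>t. indicator (?A c) t * q t"
      have fQ: "?f \<in> insert (\<lambda>_. 1) Q'" unfolding Q'_def using c q by blast
      have sc: "(\<I> t. indicator {..x} (\<theta> t) * (indicator (space leb01) t * ?f t)) = x * (\<I> t. indicator (space leb01) t * ?f t)"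
        by (rule scaleD[OF \<theta> fQ x])
      have "(\<I> t. indicator (space leb01) t * ?f t) = (\<I> t. ?f t)"
        by (rule integral_congI) (simp only: indicator_simps mult_1_left)
      moreover have "(\<I> t. indicator {..x} (\<theta> t) * (indicator (space leb01) t * ?f t)) = (\<I> t. indicator {..x} (\<theta> t) * ?f t)"
        by (rule integral_congI) (simp only: indicator_simps mult_1_left)
      ultimately have sc': "(\<I> t. indicator {..x} (\<theta> t) * ?f t) = x * (\<I> t. ?f t)"
        using sc by (simp only:)
      have fi: "integrable leb01 ?f" by (rule integrable_indicator_mult[OF disjI2[OF A] qi])
      have If: "integrable leb01 (\<lambda>t. indicator {..x} (\<theta> t) * ?f t)"
      proof (rule integrable_bounded_mult[OF _ fi])
        show "L1_bounded 1 (\<lambda>t. indicator {..x} (\<theta> t))" by (auto simp: indicator_def[abs_def])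
      qed
      have "(\<I> t. indicator (?A c) t * (\<sigma> t * q t)) = (\<I> t. 2 * (indicator {..x} (\<theta> t) * ?f t) - ?f t)"
        by (rule integral_congI) (auto simp: indicator_def \<sigma>_def x_def)
      also have "\<dots> = (\<I> t. 2 * (indicator {..x} (\<theta> t) * ?f t)) - (\<I> t. ?f t)"
        by (rule Bochner_Integration.integral_diff[OF integrable_mult_right[OF If] fi])
      also have "\<dots> = 2 * (x * (\<I> t. ?f t)) - (\<I> t. ?f t)"
        by (simp only: integral_mult_right_zero sc')
      also have "\<dots> = c * (\<I> t. ?f t)" by (simp add: x_def field_simps)
      finally show ?thesis .
    next
      case False
      then have "?A c = {}" using w(4) by auto
      then show ?thesis by simp
    qed
    have "(\<I> t. \<sigma> t * q t) = (\<Sum>c\<in>C. 1 * (\<I> t. indicator (?A c) t * (\<sigma> t * q t)))"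
      using integral_finite_partition[OF w(2,3) A \<sigma>q, of "\<lambda>_. 1"] by (simp only: mult_1_left)
    also have "\<dots> = (\<Sum>c\<in>C. c * (\<I> t. indicator (?A c) t * q t))"
      by (rule sum.cong[OF refl]) (simp only: piece mult_1_left)
    also have "\<dots> = (\<I> t. w t * q t)"
      by (rule integral_finite_partition[OF w(2,3) A qi, of "\<lambda>c. c", symmetric])
    finally show "(\<I> t. \<sigma> t * q t) = (\<I> t. w t * q t)" .
  qed
qed

section \<open>Splitting with exact integrals\<close>

text \<open>
  Finitely many null sequences can be annihilated exactly, from some index on, by subtracting from
  each term a combination of fixed earlier terms with coefficients tending to zero. Treating the
  sequences one at a time, if the corrected new one does not vanish from some index on, a
  single nonzero value of it can be used to cancel all later ones.
\<close>

lemma vanishing_recombination: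
  fixes e :: "'l \<Rightarrow> nat \<Rightarrow> real"
  assumes "finite L" "\<And>l. l \<in> L \<Longrightarrow> e l \<longlonglongrightarrow> 0"
  shows "\<exists>M c. (\<forall>i. (\<lambda>m. c m i) \<longlonglongrightarrow> (0::real)) \<and>
    (\<forall>m\<ge>M. \<forall>l\<in>L. e l m = (\<Sum>i<M. c m i * e l i))"
  using assms
proof (induction L rule: finite_induct)
  case empty
  show ?case by (rule exI[of _ 0], rule exI[of _ "\<lambda>_ _. 0"]) simp
next
  case (insert l0 L)
  have "\<exists>M c. (\<forall>i. (\<lambda>m. c m i) \<longlonglongrightarrow> (0::real)) \<and> (\<forall>m\<ge>M. \<forall>l\<in>L. e l m = (\<Sum>i<M. c m i * e l i))"
    by (rule insert.IH) (rule insert.prems[OF insertI2])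
  then obtain M c where Mc: "(\<forall>i. (\<lambda>m. c m i) \<longlonglongrightarrow> (0::real)) \<and> (\<forall>m\<ge>M. \<forall>l\<in>L. e l m = (\<Sum>i<M. c m i * e l i))"
    by (elim exE)
  note c0 = Mc[THEN conjunct1, rule_format] and c = Mc[THEN conjunct2, rule_format]
  define d where "d m = e l0 m - (\<Sum>i<M. c m i * e l0 i)" for m
  have "d \<longlonglongrightarrow> 0 - (\<Sum>i<M. 0 * e l0 i)"
    unfolding d_def using insert.prems c0 by (intro tendsto_diff tendsto_sum tendsto_mult tendsto_const) auto
  then have d0: "d \<longlonglongrightarrow> 0" by simp
  show ?case
  proof (cases "\<forall>m\<ge>M. d m = 0")
    case True
    then have "\<forall>m\<ge>M. \<forall>l\<in>insert l0 L. e l m = (\<Sum>i<M. c m i * e l i)"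
      using c by (simp add: d_def)
    then show ?thesis using c0 by blast
  next
    case False
    then obtain m0 where m0: "m0 \<ge> M" "d m0 \<noteq> 0" by blast
    define c' where "c' m i = (if i < M then c m i else 0) +
      d m / d m0 * ((if i = m0 then 1 else 0) - (if i < M then c m0 i else 0))" for m i
    have c'0: "(\<lambda>m. c' m i) \<longlonglongrightarrow> 0" for i
    proof -
      have "(\<lambda>m. if i < M then c m i else 0) \<longlonglongrightarrow> 0" using c0[of i] by (cases "i < M") simp_all
      moreover have "(\<lambda>m. d m / d m0 * ((if i = m0 then 1 else 0) - (if i < M then c m0 i else 0))) \<longlonglongrightarrow>
          0 / d m0 * ((if i = m0 then 1 else 0) - (if i < M then c m0 i else 0))"
        by (intro tendsto_mult tendsto_divide d0 tendsto_const m0(2))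
      ultimately show ?thesis unfolding c'_def using tendsto_add by fastforce
    qed
    have expand: "(\<Sum>i<Suc m0. c' m i * a i) = (\<Sum>i<M. c m i * a i) + d m / d m0 * (a m0 - (\<Sum>i<M. c m0 i * a i))"
      for m and a :: "nat \<Rightarrow> real"
    proof -
      have cut: "(\<Sum>i<Suc m0. (if i < M then h i else 0)) = (\<Sum>i<M. h i)" for h :: "nat \<Rightarrow> real"
        using m0(1) by (intro sum.mono_neutral_cong_right) auto
      have pick: "(\<Sum>i<Suc m0. (if i = m0 then a i else 0)) = a m0" by simp
      have "(\<Sum>i<Suc m0. c' m i * a i) = (\<Sum>i<Suc m0. (if i < M then c m i * a i else 0) +
          d m / d m0 * ((if i = m0 then a i else 0) - (if i < M then c m0 i * a i else 0)))"
        by (rule sum.cong[OF refl]) (simp add: c'_def algebra_simps)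
      also have "\<dots> = (\<Sum>i<M. c m i * a i) + d m / d m0 * (a m0 - (\<Sum>i<M. c m0 i * a i))"
        unfolding sum.distrib sum_distrib_left[symmetric] sum_subtractf cut pick ..
      finally show ?thesis .
    qed
    have "e l m = (\<Sum>i<Suc m0. c' m i * e l i)" if m: "m \<ge> Suc m0" and l: "l \<in> insert l0 L" for m l
    proof (cases "l = l0")
      case True
      have "(\<Sum>i<Suc m0. c' m i * e l0 i) = (\<Sum>i<M. c m i * e l0 i) + d m / d m0 * d m0"
        unfolding expand by (simp only: d_def[of m0])
      then show ?thesis using m0(2) True by (simp add: d_def[of m])
    next
      case False
      then have "l \<in> L" using l by simp
      then have "e l m = (\<Sum>i<M. c m i * e l i)" "e l m0 = (\<Sum>i<M. c m0 i * e l i)"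
        using c m m0(1) by auto
      then show ?thesis unfolding expand by simp
    qed
    then show ?thesis using c'0 by blast
  qed
qed

lemma finite_range_combine:
  assumes "finite (range f)" "finite (range g)"
  shows "finite (range (\<lambda>t. h (f t) (g t)))"
proof (rule finite_subset)
  show "range (\<lambda>t. h (f t) (g t)) \<subseteq> (\<lambda>(a, b). h a b) ` (range f \<times> range g)" by auto
qed (use assms in simp)

lemma finite_range_sum:
  fixes f :: "nat \<Rightarrow> 'a \<Rightarrow> real"
  assumes "\<And>i. finite (range (f i))"
  shows "finite (range (\<lambda>t. \<Sum>i<M. f i t))"
proof (induction M)
  case (Suc M)
  show ?case unfolding sum.lessThan_Suc by (rule finite_range_combine[OF Suc assms])
qed simp

lemma integral_combination:
  assumes f: "L1_bounded K f" and h: "\<And>i. L1_bounded K (h i)" and q: "integrable leb01 q"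
  shows "(\<I> t. (f t - (\<Sum>i<(M::nat). c i * h i t)) * q t) =
    (\<I> t. f t * q t) - (\<Sum>i<M. c i * (\<I> t. h i t * q t))"
proof -
  have "(\<I> t. (f t - (\<Sum>i<M. c i * h i t)) * q t) = (\<I> t. f t * q t - (\<Sum>i<M. c i * (h i t * q t)))"
    by (rule integral_congI) (simp add: left_diff_distrib sum_distrib_right mult.assoc)
  also have "\<dots> = (\<I> t. f t * q t) - (\<I> t. (\<Sum>i<M. c i * (h i t * q t)))"
    by (intro Bochner_Integration.integral_diff Bochner_Integration.integrable_sum integrable_mult_right
        integrable_bounded_mult[OF f q] integrable_bounded_mult[OF h q])
  also have "(\<I> t. (\<Sum>i<M. c i * (h i t * q t))) = (\<Sum>i<M. \<I> t. c i * (h i t * q t))"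
    by (intro Bochner_Integration.integral_sum integrable_mult_right integrable_bounded_mult[OF h q])
  finally show ?thesis by (simp only: integral_mult_right_zero)
qed

lemma L1_bounded_combination:
  assumes f: "L1_bounded K f" and h: "\<And>i. L1_bounded K (h i)"
  shows "L1_bounded (K + (\<Sum>i<(M::nat). \<bar>c i\<bar>) * K) (\<lambda>t. f t - (\<Sum>i<M. c i * h i t))"
proof
  have [measurable]: "f \<in> borel_measurable leb01" "\<And>i. h i \<in> borel_measurable leb01"
    using f h by (blast, blast)
  show "(\<lambda>t. f t - (\<Sum>i<M. c i * h i t)) \<in> borel_measurable leb01" by measurable
  show "\<forall>t. \<bar>f t - (\<Sum>i<M. c i * h i t)\<bar> \<le> K + (\<Sum>i<M. \<bar>c i\<bar>) * K"
  proof
    fix t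
    have "\<bar>\<Sum>i<M. c i * h i t\<bar> \<le> (\<Sum>i<M. \<bar>c i\<bar> * K)"
    proof (rule order_trans[OF sum_abs sum_mono])
      show "\<bar>c i * h i t\<bar> \<le> \<bar>c i\<bar> * K" for i
        unfolding abs_mult using h by (intro mult_left_mono) auto
    qed
    moreover have "\<bar>f t\<bar> \<le> K" using f by blast
    ultimately show "\<bar>f t - (\<Sum>i<M. c i * h i t)\<bar> \<le> K + (\<Sum>i<M. \<bar>c i\<bar>) * K"
      unfolding sum_distrib_right by linarith
  qed
qed

context norming_functionals
begin

lemma sgn_v_bounded: "L1_bounded 1 (\<lambda>t. sgn (v m t))"
proof
  have "v m \<in> borel_measurable leb01" using v_bounded by blast
  then show "(\<lambda>t. sgn (v m t)) \<in> borel_measurable leb01" by measurable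
qed (simp add: sgn_if)

text \<open>
  The new functional is a corrected $y_k$, so that its density $u$ has mean zero on the atoms of $p$.
  The sign comes from $w = (\mathrm{sgn}\, v_k - \mathrm{sgn}\, v_m)/2$ with $k$ much larger than
  $m$: as $k$ grows, $\int v_k\, \mathrm{sgn}\, v_m$ over an atom tends to zero, so $\int v_k w$ over the atom
  is about half of the integral of $|v_k|$, that is at least $b/2$ times its measure.
  Correction makes $w$ exactly orthogonal to the old functions at the cost of
  a bound slightly above 1. Rescaling on each atom, where there is room as only $b/8$ is
  wanted, brings $w$ back to $[-1,1]$, and Lyapunov's theorem turns it into a sign.
\<close>

lemma splitting_step:
  fixes p :: "real \<Rightarrow> 'k"
  assumes P: "finite P" and pP: "\<And>t. p t \<in> P"
    and pm: "\<And>e. {t \<in> space leb01. p t = e} \<in> sets leb01"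
    and V: "finite V" "\<And>u. u \<in> V \<Longrightarrow> integrable leb01 u" and eps: "eps > 0"
  obtains z u \<sigma> m where "m \<ge> N" "norm (z - y m) \<le> eps" "\<exists>K'. L1_bounded K' u" "sign_function \<sigma>"
    "\<And>f. integrable leb01 f \<Longrightarrow> blinfun_apply z (T (abs_L1 f)) = (\<I> t. u t * f t)"
    "\<And>G. (\<I> t. G (p t) * (indicator B t * u t)) = 0"
    "\<And>G. (\<I> t. G (p t) * (indicator B t * \<sigma> t)) = 0"
    "\<And>G u'. u' \<in> V \<Longrightarrow> (\<I> t. G (p t) * (indicator B t * (\<sigma> t * u' t))) = 0"
    "\<And>G. (\<I> t. G (p t) * (indicator B t * (\<sigma> t * u t))) = b / 8 * (\<I> t. G (p t) * indicator B t)"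
proof -
  define A where "A e = B \<inter> {t \<in> space leb01. p t = e}" for e
  have A: "A e \<in> sets leb01" "A e \<subseteq> B" for e
    unfolding A_def by (rule sets.Int[OF B_sets pm]) simp
  have Ai: "integrable leb01 (indicator (A e) :: real \<Rightarrow> real)" for e
    by (rule integrable_indicator_leb01[OF disjI2[OF A(1)]])
  from vanishing_recombination[OF P, of "\<lambda>e m. \<I> t. v m t * indicator (A e) t", OF v_null[OF Ai]]
  obtain M1 c1 where Mc1: "(\<forall>i. (\<lambda>m. c1 m i) \<longlonglongrightarrow> (0::real)) \<and> (\<forall>m\<ge>M1. \<forall>e\<in>P.
      (\<I> t. v m t * indicator (A e) t) = (\<Sum>i<M1. c1 m i * (\<I> t. v i t * indicator (A e) t)))"
    by (elim exE)
  note c1 = Mc1[THEN conjunct1, rule_format] and c1_eq = Mc1[THEN conjunct2, rule_format]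
  define z where "z m = y m - (\<Sum>i<M1. c1 m i *\<^sub>R y i)" for m
  define u where "u m t = v m t - (\<Sum>i<M1. c1 m i * v i t)" for m t
  have u_bounded: "L1_bounded (K + (\<Sum>i<M1. \<bar>c1 m i\<bar>) * K) (u m)" for m
    unfolding u_def[abs_def] by (rule L1_bounded_combination[OF v_bounded v_bounded])
  have u_int: "(\<I> t. u m t * f t) = (\<I> t. v m t * f t) - (\<Sum>i<M1. c1 m i * (\<I> t. v i t * f t))"
    if "integrable leb01 f" for m f
    unfolding u_def by (rule integral_combination[OF v_bounded v_bounded that])
  have z_T: "z m (T (abs_L1 f)) = (\<I> t. u m t * f t)" if "integrable leb01 f" for m f
    unfolding u_int[OF that] z_def
    by (simp add: blinfun.diff_left blinfun.sum_left blinfun.scaleR_left y_T[OF that])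
  have z_y: "(\<lambda>m. norm (z m - y m)) \<longlonglongrightarrow> 0"
  proof (rule tendsto_sandwich[of "\<lambda>_. 0" _ _ "\<lambda>m. \<Sum>i<M1. \<bar>c1 m i\<bar> * 2"])
    have "norm (z m - y m) \<le> (\<Sum>i<M1. \<bar>c1 m i\<bar> * 2)" for m
    proof -
      have "norm (z m - y m) = norm (\<Sum>i<M1. c1 m i *\<^sub>R y i)" by (simp add: z_def)
      also have "\<dots> \<le> (\<Sum>i<M1. \<bar>c1 m i\<bar> * 2)"
        by (rule order_trans[OF norm_sum sum_mono]) (simp add: mult_left_mono[OF y_le])
      finally show ?thesis .
    qed
    then show "\<forall>\<^sub>F m in sequentially. norm (z m - y m) \<le> (\<Sum>i<M1. \<bar>c1 m i\<bar> * 2)" by simp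
    have "(\<lambda>m. \<Sum>i<M1. \<bar>c1 m i\<bar> * 2) \<longlonglongrightarrow> (\<Sum>i<M1. 0 * 2)"
      by (intro tendsto_sum tendsto_mult tendsto_const tendsto_rabs_zero c1)
    then show "(\<lambda>m. \<Sum>i<M1. \<bar>c1 m i\<bar> * 2) \<longlonglongrightarrow> 0" by simp
  qed simp_all
  have u_null: "(\<lambda>m. \<I> t. u m t * f t) \<longlonglongrightarrow> 0" if f: "integrable leb01 f" for f
  proof -
    have "(\<lambda>m. \<I> t. u m t * f t) \<longlonglongrightarrow> 0 - (\<Sum>i<M1. 0 * (\<I> t. v i t * f t))"
      unfolding u_int[OF f] by (intro tendsto_diff tendsto_sum tendsto_mult tendsto_const c1 v_null[OF f])
    then show ?thesis by simp
  qed
  have "\<forall>m. \<exists>k. m \<le> k \<and> (\<forall>e\<in>P. \<bar>\<I> t. v k t * (sgn (v m t) * indicator (A e) t)\<bar> < 1 / Suc m)"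
  proof
    fix m
    have "\<forall>\<^sub>F k in sequentially. \<forall>e\<in>P. \<bar>\<I> t. v k t * (sgn (v m t) * indicator (A e) t)\<bar> < 1 / Suc m"
    proof (intro eventually_ball_finite[OF P] ballI)
      fix e
      have "integrable leb01 (\<lambda>t. sgn (v m t) * indicator (A e) t)"
        by (rule integrable_bounded_mult[OF sgn_v_bounded Ai])
      from order_tendstoD(2)[OF tendsto_rabs_zero[OF v_null[OF this]], of "1 / Suc m"]
      show "\<forall>\<^sub>F k in sequentially. \<bar>\<I> t. v k t * (sgn (v m t) * indicator (A e) t)\<bar> < 1 / Suc m" by simp
    qed
    from eventually_happens'[OF sequentially_bot eventually_conj[OF eventually_ge_at_top[of m] this]]
    show "\<exists>k. m \<le> k \<and> (\<forall>e\<in>P. \<bar>\<I> t. v k t * (sgn (v m t) * indicator (A e) t)\<bar> < 1 / Suc m)" .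
  qed
  from choice[OF this] obtain k where k: "\<And>m. m \<le> k m"
    and k_small: "\<And>m e. e \<in> P \<Longrightarrow> \<bar>\<I> t. v (k m) t * (sgn (v m t) * indicator (A e) t)\<bar> < 1 / Suc m" by blast
  have ktop: "filterlim k sequentially sequentially"
    by (rule filterlim_at_top_mono[OF filterlim_ident]) (simp add: k)
  define w where "w m t = (sgn (v (k m) t) - sgn (v m t)) / 2" for m t
  have w_bounded: "L1_bounded 1 (w m)" for m
  proof
    have [measurable]: "(\<lambda>t. sgn (v n t)) \<in> borel_measurable leb01" for n using sgn_v_bounded by blast
    show "w m \<in> borel_measurable leb01" unfolding w_def[abs_def] by measurable
  qed (simp add: w_def sgn_if)
  have w_int: "(\<I> t. w m t * f t) = ((\<I> t. sgn (v (k m) t) * f t) - (\<I> t. sgn (v m t) * f t)) / 2"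
    if f: "integrable leb01 f" for m f
  proof -
    note i = integrable_bounded_mult[OF sgn_v_bounded f]
    have "(\<I> t. w m t * f t) = (\<I> t. (sgn (v (k m) t) * f t - sgn (v m t) * f t) / 2)"
      by (rule integral_congI) (simp add: w_def field_simps)
    also have "\<dots> = (\<I> t. sgn (v (k m) t) * f t - sgn (v m t) * f t) / 2"
      by (rule integral_divide_zero)
    also have "(\<I> t. sgn (v (k m) t) * f t - sgn (v m t) * f t) = (\<I> t. sgn (v (k m) t) * f t) - (\<I> t. sgn (v m t) * f t)"
      by (rule Bochner_Integration.integral_diff[OF i i])
    finally show ?thesis .
  qed
  have w_null: "(\<lambda>m. \<I> t. w m t * f t) \<longlonglongrightarrow> 0" if f: "integrable leb01 f" for f
  proof -
    obtain l where l: "(\<lambda>m. \<I> t. sgn (v m t) * f t) \<longlonglongrightarrow> l"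
      using sgn_conv[OF f] unfolding convergent_def by blast
    have "(\<lambda>m. \<I> t. w m t * f t) \<longlonglongrightarrow> (l - l) / 2"
      unfolding w_int[OF f] by (intro tendsto_divide tendsto_diff filterlim_compose[OF l ktop] l tendsto_const) simp
    then show ?thesis by simp
  qed
  \<comment> \<open>The functions to which the sign has to be orthogonal: the old densities and 1, on each atom.\<close>
  define Q where "Q = (\<Union>e\<in>P. (\<lambda>q t. indicator (A e) t * q t :: real) ` insert (\<lambda>_. 1) V)"
  have Qfin: "finite Q" unfolding Q_def by (intro finite_UN_I finite_imageI finite.insertI P V(1))
  have Qint: "integrable leb01 q" if qQ: "q \<in> Q" for q
  proof -
    obtain e q0 where q0: "q0 \<in> insert (\<lambda>_. 1) V" "q = (\<lambda>t. indicator (A e) t * q0 t)"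
      using qQ unfolding Q_def by blast
    have "integrable leb01 q0" using q0(1) V(2) by auto
    then show ?thesis unfolding q0(2) by (rule integrable_indicator_mult[OF disjI2[OF A(1)]])
  qed
  have "\<exists>M c. (\<forall>i. (\<lambda>m. c m i) \<longlonglongrightarrow> (0::real)) \<and> (\<forall>m\<ge>M. \<forall>q\<in>Q.
      (\<I> t. w m t * q t) = (\<Sum>i<M. c m i * (\<I> t. w i t * q t)))"
    by (rule vanishing_recombination[OF Qfin]) (rule w_null[OF Qint])
  then obtain M2 c2 where Mc2: "(\<forall>i. (\<lambda>m. c2 m i) \<longlonglongrightarrow> (0::real)) \<and> (\<forall>m\<ge>M2. \<forall>q\<in>Q.
      (\<I> t. w m t * q t) = (\<Sum>i<M2. c2 m i * (\<I> t. w i t * q t)))"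
    by (elim exE)
  note c2 = Mc2[THEN conjunct1, rule_format] and c2_eq = Mc2[THEN conjunct2, rule_format]
  define x where "x m t = w m t - (\<Sum>i<M2. c2 m i * w i t)" for m t
  have x_int: "(\<I> t. x m t * f t) = (\<I> t. w m t * f t) - (\<Sum>i<M2. c2 m i * (\<I> t. w i t * f t))"
    if "integrable leb01 f" for m f
    unfolding x_def by (rule integral_combination[OF w_bounded w_bounded that])
  have x_bounded: "L1_bounded (1 + (\<Sum>i<M2. \<bar>c2 m i\<bar>) * 1) (x m)" for m
    unfolding x_def[abs_def] by (rule L1_bounded_combination[OF w_bounded w_bounded])
  have Au: "integrable leb01 (\<lambda>t. indicator (A e) t * u n t)" for e n
    by (rule integrable_indicator_mult[OF disjI2[OF A(1)] integrable_bounded[OF u_bounded]])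
  define g where "g e m = (\<I> t. x m t * (indicator (A e) t * u (k m) t))" for e m
  have g_lim: "\<exists>l. b * measure leb01 (A e) \<le> l \<and> g e \<longlonglongrightarrow> l / 2" if e: "e \<in> P" for e
  proof -
    obtain l where l: "b * measure leb01 (A e) \<le> l" "(\<lambda>m. \<I> t. \<bar>v m t\<bar> * indicator (A e) t) \<longlonglongrightarrow> l"
      using abs_lim[OF A] by blast
    have wA: "integrable leb01 (\<lambda>t. w j t * indicator (A e) t)" for j
      by (rule integrable_bounded_mult[OF w_bounded Ai])
    have vA: "integrable leb01 (\<lambda>t. v j t * indicator (A e) t)" for j
      by (rule integrable_bounded_mult[OF v_bounded Ai])
    have sA: "integrable leb01 (\<lambda>t. sgn (v j t) * indicator (A e) t)" for j
      by (rule integrable_bounded_mult[OF sgn_v_bounded Ai])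
    have main: "(\<I> t. v (k m) t * (w m t * indicator (A e) t)) =
      (\<I> t. \<bar>v (k m) t\<bar> * indicator (A e) t) / 2 - (\<I> t. v (k m) t * (sgn (v m t) * indicator (A e) t)) / 2" for m
    proof -
      have vsA: "integrable leb01 (\<lambda>t. v (k m) t * (sgn (v j t) * indicator (A e) t))" for j
        by (rule integrable_bounded_mult[OF v_bounded sA])
      have "(\<I> t. v (k m) t * (w m t * indicator (A e) t)) =
        (\<I> t. (v (k m) t * (sgn (v (k m) t) * indicator (A e) t) - v (k m) t * (sgn (v m t) * indicator (A e) t)) / 2)"
        by (rule integral_congI) (simp add: w_def field_simps)
      also have "\<dots> = (\<I> t. v (k m) t * (sgn (v (k m) t) * indicator (A e) t) - v (k m) t * (sgn (v m t) * indicator (A e) t)) / 2"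
        by (rule integral_divide_zero)
      also have "\<dots> = ((\<I> t. v (k m) t * (sgn (v (k m) t) * indicator (A e) t)) - (\<I> t. v (k m) t * (sgn (v m t) * indicator (A e) t))) / 2"
        by (subst Bochner_Integration.integral_diff[OF vsA vsA]) (rule refl)
      also have "(\<I> t. v (k m) t * (sgn (v (k m) t) * indicator (A e) t)) = (\<I> t. \<bar>v (k m) t\<bar> * indicator (A e) t)"
        by (rule integral_congI) (simp add: abs_sgn mult.assoc)
      finally show ?thesis by (simp only: diff_divide_distrib)
    qed
    have small: "(\<lambda>m. \<I> t. v (k m) t * (sgn (v m t) * indicator (A e) t)) \<longlonglongrightarrow> 0"
    proof (rule Lim_null_comparison[OF _ LIMSEQ_inverse_real_of_nat])
      show "\<forall>\<^sub>F m in sequentially. norm (\<I> t. v (k m) t * (sgn (v m t) * indicator (A e) t)) \<le> inverse (real (Suc m))"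
        using k_small[OF e] by (intro always_eventually allI less_imp_le) (simp only: real_norm_def inverse_eq_divide)
    qed
    have "(\<lambda>m. \<I> t. v (k m) t * (w m t * indicator (A e) t)) \<longlonglongrightarrow> l / 2 - 0 / 2"
      unfolding main by (intro tendsto_diff tendsto_divide filterlim_compose[OF l(2) ktop] small tendsto_const) simp_all
    then have t1: "(\<lambda>m. \<I> t. v (k m) t * (w m t * indicator (A e) t)) \<longlonglongrightarrow> l / 2" by simp
    have comm: "(\<I> t. v i t * (w m t * indicator (A e) t)) = (\<I> t. w m t * (v i t * indicator (A e) t))" for i m
      by (rule integral_congI) (simp only: mult.left_commute)
    have t2: "(\<lambda>m. \<I> t. v i t * (w m t * indicator (A e) t)) \<longlonglongrightarrow> 0" for i
      unfolding comm by (rule w_null[OF vA])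
    have comm': "(\<I> t. w j t * (indicator (A e) t * u n t)) = (\<I> t. u n t * (w j t * indicator (A e) t))" for j n
      by (rule integral_congI) (simp only: mult_ac)
    have g_eq: "g e m = ((\<I> t. v (k m) t * (w m t * indicator (A e) t)) -
        (\<Sum>i<M1. c1 (k m) i * (\<I> t. v i t * (w m t * indicator (A e) t)))) -
        (\<Sum>j<M2. c2 m j * (\<I> t. u (k m) t * (w j t * indicator (A e) t)))" for m
      unfolding g_def x_int[OF Au] comm' u_int[OF wA, of "k m" m] ..
    have "g e \<longlonglongrightarrow> (l / 2 - (\<Sum>i<M1. 0 * 0)) - (\<Sum>j<M2. 0 * 0)"
      unfolding g_eq
      by (intro tendsto_diff tendsto_sum tendsto_mult t1 t2 c2 filterlim_compose[OF c1 ktop]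
          filterlim_compose[OF u_null[OF wA] ktop])
    then show ?thesis using l(1) by auto
  qed
  have ev_g: "\<forall>\<^sub>F m in sequentially. \<forall>e\<in>P. measure leb01 (A e) > 0 \<longrightarrow> b / 4 * measure leb01 (A e) < g e m"
  proof (intro eventually_ball_finite[OF P] ballI)
    fix e assume e: "e \<in> P"
    obtain l where l: "b * measure leb01 (A e) \<le> l" "g e \<longlonglongrightarrow> l / 2" using g_lim[OF e] by blast
    show "\<forall>\<^sub>F m in sequentially. measure leb01 (A e) > 0 \<longrightarrow> b / 4 * measure leb01 (A e) < g e m"
    proof (cases "measure leb01 (A e) > 0")
      case True
      then have "b * measure leb01 (A e) > 0" using bpos by simp
      then have "b / 4 * measure leb01 (A e) < l / 2" using l(1) by simp
      from order_tendstoD(1)[OF l(2) this] show ?thesis by eventually_elim simp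
    qed simp
  qed
  have ev_z: "\<forall>\<^sub>F m in sequentially. norm (z (k m) - y (k m)) < eps"
    using order_tendstoD(2)[OF filterlim_compose[OF z_y ktop] eps] .
  have "(\<lambda>m. \<Sum>i<M2. \<bar>c2 m i\<bar>) \<longlonglongrightarrow> (\<Sum>i<M2. 0)" by (intro tendsto_sum tendsto_rabs_zero c2)
  then have "(\<lambda>m. \<Sum>i<M2. \<bar>c2 m i\<bar>) \<longlonglongrightarrow> 0" by simp
  from order_tendstoD(2)[OF this zero_less_one]
  have ev_c: "\<forall>\<^sub>F m in sequentially. (\<Sum>i<M2. \<bar>c2 m i\<bar>) < 1" .
  from eventually_happens'[OF sequentially_bot eventually_conj[OF eventually_ge_at_top[of "max N (max M1 M2)"]
        eventually_conj[OF ev_g eventually_conj[OF ev_z ev_c]]]]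
  obtain m where m: "m \<ge> max N (max M1 M2)" "(\<Sum>i<M2. \<bar>c2 m i\<bar>) < 1" "norm (z (k m) - y (k m)) < eps"
    and m_g: "\<And>e. e \<in> P \<Longrightarrow> measure leb01 (A e) > 0 \<Longrightarrow> b / 4 * measure leb01 (A e) < g e m"
    by blast
  \<comment> \<open>On a null atom the factor is 0, as it should be.\<close>
  define fac where "fac e = b / 8 * measure leb01 (A e) / g e m" for e
  have fac: "\<bar>fac e\<bar> \<le> 1/2" "fac e * g e m = b / 8 * measure leb01 (A e)" if e: "e \<in> P" for e
  proof -
    have "\<bar>fac e\<bar> \<le> 1/2 \<and> fac e * g e m = b / 8 * measure leb01 (A e)"
    proof (cases "measure leb01 (A e) > 0")
      case True
      have "b / 4 * measure leb01 (A e) > 0" using bpos True by simp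
      with m_g[OF e True] have "g e m > 0" "b / 4 * measure leb01 (A e) < g e m" by linarith+
      then show ?thesis using bpos unfolding fac_def by (simp add: abs_of_pos field_simps)
    next
      case False
      then have "measure leb01 (A e) = 0" using measure_nonneg[of leb01 "A e"] by linarith
      then show ?thesis unfolding fac_def by simp
    qed
    then show "\<bar>fac e\<bar> \<le> 1/2" "fac e * g e m = b / 8 * measure leb01 (A e)" by blast+
  qed
  define \<omega> where "\<omega> t = fac (p t) * x m t" for t
  have \<omega>_le: "\<bar>\<omega> t\<bar> \<le> 1" for t
  proof -
    have "\<bar>x m t\<bar> \<le> 1 + (\<Sum>i<M2. \<bar>c2 m i\<bar>) * 1" using x_bounded by blast
    then have "\<bar>x m t\<bar> \<le> 2" using m(2) by simp
    then have "\<bar>fac (p t)\<bar> * \<bar>x m t\<bar> \<le> 1/2 * 2" by (intro mult_mono fac(1)[OF pP]) auto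
    then show ?thesis by (simp add: \<omega>_def abs_mult)
  qed
  have fac_meas: "(\<lambda>t. fac (p t)) \<in> borel_measurable leb01"
  proof -
    have meas: "(\<lambda>t. \<Sum>e\<in>P. fac e * indicator {t \<in> space leb01. p t = e} t :: real) \<in> borel_measurable leb01"
      by (intro borel_measurable_sum borel_measurable_times borel_measurable_const borel_measurable_indicator pm)
    have eq: "(\<Sum>e\<in>P. fac e * indicator {t \<in> space leb01. p t = e} t) = fac (p t)" if t: "t \<in> space leb01" for t
    proof -
      have "(\<Sum>e\<in>P. fac e * indicator {t \<in> space leb01. p t = e} t) = (\<Sum>e\<in>P. if e = p t then fac (p t) else 0)"
        by (rule sum.cong[OF refl]) (use t in \<open>auto simp: indicator_def\<close>)
      then show ?thesis using P pP[of t] by simp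
    qed
    show ?thesis by (rule measurable_cong[OF eq, THEN iffD1, OF _ meas])
  qed
  have \<omega>_meas: "\<omega> \<in> borel_measurable leb01"
    unfolding \<omega>_def[abs_def] using x_bounded[of m] by (intro borel_measurable_times fac_meas) blast
  have sgn_fin: "finite (range (\<lambda>t. sgn (v n t)))" for n
    by (rule finite_subset[of _ "{-1, 0, 1}"]) (auto simp: sgn_if)
  have w_fin: "finite (range (w n))" for n
    unfolding w_def[abs_def] by (rule finite_range_combine[OF sgn_fin sgn_fin])
  have x_fin: "finite (range (x m))"
  proof -
    have "finite (range (\<lambda>t. c2 m i * w i t))" for i
      using finite_range_combine[OF w_fin w_fin, of "\<lambda>a _. c2 m i * a" i i] .
    then have "finite (range (\<lambda>t. \<Sum>i<M2. c2 m i * w i t))" by (rule finite_range_sum)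
    then show ?thesis unfolding x_def[abs_def] by (rule finite_range_combine[OF w_fin])
  qed
  have p_fin: "finite (range p)" by (rule finite_subset[OF _ P]) (use pP in auto)
  have \<omega>_fin: "finite (range \<omega>)"
    unfolding \<omega>_def[abs_def] by (rule finite_range_combine[OF p_fin x_fin])
  define Q' where "Q' = Q \<union> (\<lambda>e t. indicator (A e) t * u (k m) t) ` P"
  have Q'fin: "finite Q'" unfolding Q'_def by (intro finite_UnI Qfin finite_imageI P)
  have Q'int: "integrable leb01 q" if "q \<in> Q'" for q
    using that unfolding Q'_def
  proof (elim UnE imageE)
    fix e assume qe: "q = (\<lambda>t. indicator (A e) t * u (k m) t)"
    show "integrable leb01 q" unfolding qe by (rule Au)
  qed (rule Qint)
  obtain \<sigma> where \<sigma>: "sign_function \<sigma>"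
    and \<sigma>_int: "\<And>q. q \<in> Q' \<Longrightarrow> (\<I> t. \<sigma> t * q t) = (\<I> t. \<omega> t * q t)"
  proof (rule lyapunov_sign_function[OF Q'fin _ \<omega>_meas \<omega>_fin rangeI \<omega>_le])
    show "integrable leb01 q" if "q \<in> Q'" for q by (rule Q'int[OF that])
    fix \<sigma> assume 1: "sign_function \<sigma>"
      and 2: "\<And>q. q \<in> Q' \<Longrightarrow> (\<I> t. \<sigma> t * q t) = (\<I> t. \<omega> t * q t)"
    show thesis by (rule that[OF 1 2])
  qed
  have \<omega>_int: "(\<I> t. \<omega> t * (indicator (A e) t * f t)) = fac e * (\<I> t. x m t * (indicator (A e) t * f t))" for e f
    unfolding integral_mult_right_zero[symmetric]
    by (rule integral_congI) (auto simp: \<omega>_def indicator_def A_def)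
  have \<sigma>Q: "(\<I> t. \<sigma> t * (indicator (A e) t * q t)) = 0" if e: "e \<in> P" and q: "q \<in> insert (\<lambda>_. 1) V" for e q
  proof -
    have mem: "(\<lambda>t. indicator (A e) t * q t) \<in> Q" 
      unfolding Q_def by (rule UN_I[OF e], rule image_eqI[where x = q], rule refl, rule q)
    have mem': "(\<lambda>t. indicator (A e) t * q t) \<in> Q'" unfolding Q'_def using mem by (rule UnI1)
    have "(\<I> t. x m t * (indicator (A e) t * q t)) = 0"
      unfolding x_int[OF Qint[OF mem]] using c2_eq[OF _ mem, of m] m(1) by simp
    then show ?thesis using \<sigma>_int[OF mem'] \<omega>_int[of e q] by simp
  qed
  have \<sigma>u: "(\<I> t. \<sigma> t * (indicator (A e) t * u (k m) t)) = b / 8 * measure leb01 (A e)" if e: "e \<in> P" for e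
  proof -
    have mem: "(\<lambda>t. indicator (A e) t * u (k m) t) \<in> Q'" unfolding Q'_def using e by blast
    show ?thesis using \<sigma>_int[OF mem] \<omega>_int[of e "u (k m)"] fac(2)[OF e] by (simp only: g_def)
  qed
  have part: "(\<I> t. G (p t) * (indicator B t * f t)) = (\<Sum>e\<in>P. G e * (\<I> t. indicator (A e) t * f t))"
    if f: "integrable leb01 f" for G and f :: "real \<Rightarrow> real"
  proof -
    have "(\<I> t. indicator {t \<in> space leb01. p t = e} t * (indicator B t * f t)) = (\<I> t. indicator (A e) t * f t)" for e
      by (rule integral_congI) (auto simp: A_def indicator_def)
    then show ?thesis
      using integral_finite_partition[OF P pP pm integrable_indicator_mult[OF disjI2[OF B_sets] f], of G] by simp
  qed
  have \<sigma>b: "L1_bounded 1 \<sigma>" by (rule sign_functionD(5)[OF \<sigma>])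
  have km: "k m \<ge> N" "k m \<ge> M1" using m(1) k[of m] by auto
  show ?thesis
  proof (rule that[of "k m" "z (k m)" "u (k m)" \<sigma>])
    show "N \<le> k m" by (rule km)
    show "norm (z (k m) - y (k m)) \<le> eps" using m(3) by (rule less_imp_le)
    show "\<exists>K'. L1_bounded K' (u (k m))" by (rule exI) (rule u_bounded)
    show "sign_function \<sigma>" by (rule \<sigma>)
    show "z (k m) (T (abs_L1 f)) = (\<I> t. u (k m) t * f t)" if "integrable leb01 f" for f
      by (rule z_T[OF that])
    show "(\<I> t. G (p t) * (indicator B t * u (k m) t)) = 0" for G
    proof -
      have "(\<I> t. indicator (A e) t * u (k m) t) = 0" if e: "e \<in> P" for e
      proof -
        have "(\<I> t. indicator (A e) t * u (k m) t) = (\<I> t. u (k m) t * indicator (A e) t)"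
          by (simp only: mult.commute)
        also have "\<dots> = 0" unfolding u_int[OF Ai] using c1_eq[OF km(2) e] by simp
        finally show ?thesis .
      qed
      then show ?thesis unfolding part[OF integrable_bounded[OF u_bounded]] by simp
    qed
    show "(\<I> t. G (p t) * (indicator B t * \<sigma> t)) = 0" for G
    proof -
      have "(\<I> t. indicator (A e) t * \<sigma> t) = 0" if e: "e \<in> P" for e
        using \<sigma>Q[OF e insertI1] by (simp add: mult.commute)
      then show ?thesis unfolding part[OF integrable_bounded[OF \<sigma>b]] by simp
    qed
    show "(\<I> t. G (p t) * (indicator B t * (\<sigma> t * u' t))) = 0" if u': "u' \<in> V" for G u'
    proof -
      have "(\<I> t. indicator (A e) t * (\<sigma> t * u' t)) = 0" if e: "e \<in> P" for e
        using \<sigma>Q[OF e insertI2[OF u']] by (simp only: mult.left_commute)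
      then show ?thesis unfolding part[OF integrable_bounded_mult[OF \<sigma>b V(2)[OF u']]] by simp
    qed
    show "(\<I> t. G (p t) * (indicator B t * (\<sigma> t * u (k m) t))) = b / 8 * (\<I> t. G (p t) * indicator B t)" for G
    proof -
      have 1: "(\<I> t. indicator (A e) t * (\<sigma> t * u (k m) t)) = b / 8 * measure leb01 (A e)" if e: "e \<in> P" for e
        using \<sigma>u[OF e] by (simp only: mult.left_commute)
      have 2: "(\<I> t. G (p t) * indicator B t) = (\<Sum>e\<in>P. G e * measure leb01 (A e))"
        using part[of "\<lambda>_. 1" G] integral_indicator_leb01[OF A(1)]
        by (simp only: mult_1_right leb01.integrable_const simp_thms)
      show ?thesis unfolding part[OF integrable_bounded_mult[OF \<sigma>b integrable_bounded[OF u_bounded]]] 2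
        unfolding sum_distrib_left by (rule sum.cong[OF refl]) (subst 1, simp_all)
    qed
  qed
qed

end

section \<open>Isometries by weighted composition\<close>

lemma borel_representative:
  assumes f: "integrable leb01 f"
  obtains f' where "f' \<in> borel_measurable borel" "integrable leb01 f'" "abs_L1 f' = abs_L1 f"
proof -
  have fm: "f \<in> borel_measurable leb01" using f by (rule borel_measurable_integrable)
  then have "(\<lambda>t. if t \<in> {0..1} then f t else 0) \<in> borel_measurable lebesgue"
    by (rule borel_measurable_if_I) simp
  then obtain f' where f': "f' \<in> borel_measurable lborel" "AE t in lborel. (if t \<in> {0..1} then f t else 0) = f' t"
    using completion_ex_borel_measurable_real by blast
  have f'b: "f' \<in> borel_measurable borel" using f'(1) by simp
  have "AE t in lebesgue. t \<in> {0..1} \<longrightarrow> f t = f' t"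
    using AE_completion[OF f'(2)] by eventually_elim auto
  then have ae: "AE t in leb01. f t = f' t" by (subst AE_restrict_space_iff) auto
  have f'i: "integrable leb01 f'"
    using integrable_cong_AE[OF fm borel_measurable_leb01[OF f'b] ae] f by blast
  show ?thesis
    by (rule that[OF f'b f'i abs_L1_cong[OF f'i f]]) (use ae in eventually_elim, simp)
qed

text \<open>
  Two finite Borel measures on the line that agree on half-lines are equal.
\<close>

lemma pushforward_law:
  fixes \<phi> :: "real \<Rightarrow> real"
  assumes \<phi>: "\<phi> \<in> borel_measurable leb01" and B: "B \<in> sets leb01"
    and half: "\<And>x. (\<I> t. indicator {..x} (\<phi> t) * indicator B t) = c * (\<I> t. indicator {..x} t)"
    and c: "c \<ge> 0"
  shows "distr (density leb01 (\<lambda>t. ennreal (indicator B t))) borel \<phi> =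
    density (distr leb01 borel (\<lambda>t. t)) (\<lambda>_. ennreal c)" (is "?N1 = ?N2")
proof (rule measure_eqI_generator_eq[where E = "range (\<lambda>a::real. {..a})" and \<Omega> = UNIV and A = "\<lambda>n. {..real n}"])
  note \<phi>[measurable] B[measurable]
  have id[measurable]: "(\<lambda>t::real. t) \<in> borel_measurable leb01" by (rule borel_measurable_leb01) simp
  have Bm: "(\<lambda>t. ennreal (indicator B t)) \<in> borel_measurable leb01" by measurable
  have \<phi>': "\<phi> \<in> measurable (density leb01 (\<lambda>t. ennreal (indicator B t))) borel" using \<phi> by simp
  have N1: "emeasure ?N1 {..x} = ennreal (\<I> t. indicator {..x} (\<phi> t) * indicator B t)" for x
  proof -
    let ?X = "\<phi> -` {..x} \<inter> space leb01"
    have X: "?X \<in> sets leb01" using \<phi> by measurable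
    have "emeasure ?N1 {..x} = emeasure (density leb01 (\<lambda>t. ennreal (indicator B t))) ?X"
      using emeasure_distr[OF \<phi>', of "{..x}"] by simp
    also have "\<dots> = (\<integral>\<^sup>+t. ennreal (indicator B t) * indicator ?X t \<partial>leb01)"
      by (rule emeasure_density[OF Bm X])
    also have "\<dots> = (\<integral>\<^sup>+t. ennreal (indicator {..x} (\<phi> t) * indicator B t) \<partial>leb01)"
      by (rule nn_integral_cong) (auto simp: indicator_def)
    also have "\<dots> = ennreal (\<I> t. indicator {..x} (\<phi> t) * indicator B t)"
    proof (rule nn_integral_eq_integral)
      show "integrable leb01 (\<lambda>t. indicator {..x} (\<phi> t) * indicator B t :: real)"
      proof (rule integrable_bounded_mult[OF _ integrable_indicator_leb01[OF disjI2[OF B]]])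
        show "L1_bounded 1 (\<lambda>t. indicator {..x} (\<phi> t))" by (auto simp: indicator_def[abs_def])
      qed
    qed simp
    finally show ?thesis .
  qed
  have N2: "emeasure ?N2 {..x} = ennreal (c * (\<I> t. indicator {..x} t))" for x
  proof -
    have "emeasure ?N2 {..x} = ennreal c * emeasure (distr leb01 borel (\<lambda>t. t)) {..x}"
      by (subst emeasure_density) (simp_all add: nn_integral_cmult)
    also have "emeasure (distr leb01 borel (\<lambda>t. t)) {..x} = emeasure leb01 ({..x} \<inter> space leb01)"
      using emeasure_distr[OF id, of "{..x}"] by (simp add: vimage_def)
    also have "\<dots> = ennreal (\<I> t. indicator {..x} t)"
      by (simp only: leb01.emeasure_eq_measure Bochner_Integration.integral_indicator)
    finally show ?thesis using c by (simp add: ennreal_mult')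
  qed
  show "emeasure ?N1 X = emeasure ?N2 X" if "X \<in> range (\<lambda>a::real. {..a})" for X
    using that N1 N2 half by auto
  show "sets ?N1 = sigma_sets UNIV (range (\<lambda>a::real. {..a}))" "sets ?N2 = sigma_sets UNIV (range (\<lambda>a::real. {..a}))"
    by (simp_all add: borel_eq_atMost)
  show "emeasure ?N1 {..real i} \<noteq> \<infinity>" for i by (simp only: N1 infinity_ennreal_def ennreal_neq_top not_False_eq_True)
  show "Int_stable (range (\<lambda>a::real. {..a}))"
    by (auto simp: Int_stable_def intro!: image_eqI[of _ _ "min _ _"])
  show "(\<Union>i. {..real i}) = UNIV" using real_arch_simple by auto
qed auto

lemma pushforward_integral:
  fixes \<phi> f :: "real \<Rightarrow> real"
  assumes \<phi>: "\<phi> \<in> borel_measurable leb01" and B: "B \<in> sets leb01"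
    and half: "\<And>x. (\<I> t. indicator {..x} (\<phi> t) * indicator B t) = c * (\<I> t. indicator {..x} t)"
    and c: "c \<ge> 0" and f: "f \<in> borel_measurable borel" "integrable leb01 f"
  shows "integrable leb01 (\<lambda>t. indicator B t * f (\<phi> t))"
    and "(\<I> t. indicator B t * f (\<phi> t)) = c * (\<I> t. f t)"
proof -
  let ?N1 = "distr (density leb01 (\<lambda>t. ennreal (indicator B t))) borel \<phi>"
  let ?N2 = "density (distr leb01 borel (\<lambda>t. t)) (\<lambda>_. ennreal c)"
  have eq: "?N1 = ?N2" by (rule pushforward_law[OF \<phi> B half c])
  have id: "(\<lambda>t::real. t) \<in> measurable leb01 borel" by (rule borel_measurable_leb01) simp
  have \<phi>': "\<phi> \<in> measurable (density leb01 (\<lambda>t. ennreal (indicator B t))) borel" using \<phi> by simp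
  have Bm: "(indicator B :: real \<Rightarrow> real) \<in> borel_measurable leb01" using B by simp
  have f\<phi>: "(\<lambda>t. f (\<phi> t)) \<in> borel_measurable leb01" by (rule measurable_compose[OF \<phi> f(1)])
  have fd: "f \<in> borel_measurable (distr leb01 borel (\<lambda>t. t))" using f(1) by simp
  have N2i: "integrable ?N2 f"
    using f c by (subst integrable_density) (auto simp: integrable_distr_eq[OF id f(1)] fd)
  show int: "integrable leb01 (\<lambda>t. indicator B t * f (\<phi> t))"
    using N2i unfolding eq[symmetric] integrable_distr_eq[OF \<phi>' f(1)]
    by (subst (asm) integrable_density[OF f\<phi> Bm]) auto
  have "(\<I> t. indicator B t * f (\<phi> t)) = (\<integral>t. f t \<partial>?N1)"
    unfolding integral_distr[OF \<phi>' f(1)]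
    by (subst integral_density[OF f\<phi> Bm]) auto
  also have "\<dots> = (\<integral>t. f t \<partial>?N2)" by (simp only: eq)
  also have "\<dots> = c * (\<I> t. f t)"
    using c by (subst integral_density[OF fd]) (auto simp: integral_distr[OF id f(1)])
  finally show "(\<I> t. indicator B t * f (\<phi> t)) = c * (\<I> t. f t)" .
qed

text \<open>
  Composition is applied to Borel representatives, for which measurability is clear. The norm identity, applied to differences, also shows
  that the choice of the representative does not matter.
\<close>

lemma weighted_composition_isometry:
  fixes \<phi> s :: "real \<Rightarrow> real"
  assumes \<phi>: "\<phi> \<in> borel_measurable leb01" and B: "B \<in> sets leb01" and s: "sign_function s"
    and half: "\<And>x. (\<I> t. indicator {..x} (\<phi> t) * indicator B t) = c * (\<I> t. indicator {..x} t)"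
    and c: "c > 0"
  obtains A :: "L1 \<Rightarrow> L1" where "linear_isometry A"
    "\<And>f. f \<in> borel_measurable borel \<Longrightarrow> integrable leb01 f \<Longrightarrow>
      integrable leb01 (\<lambda>t. s t * (indicator B t * f (\<phi> t))) \<and>
      A (abs_L1 f) = abs_L1 (\<lambda>t. (1 / c) * (s t * (indicator B t * f (\<phi> t))))"
proof -
  note push = pushforward_integral[OF \<phi> B half less_imp_le[OF c]]
  define W where "W f = (\<lambda>t. (1 / c) * (s t * (indicator B t * f (\<phi> t))))" for f :: "real \<Rightarrow> real"
  have int0: "integrable leb01 (\<lambda>t. s t * (indicator B t * f (\<phi> t)))"
    if "f \<in> borel_measurable borel" "integrable leb01 f" for f
    by (rule integrable_bounded_mult[OF sign_functionD(5)[OF s] push(1)[OF that]])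
  have int: "integrable leb01 (W f)" if "f \<in> borel_measurable borel" "integrable leb01 f" for f
    unfolding W_def by (rule integrable_mult_right[OF int0[OF that]])
  have normW: "norm (abs_L1 (W f)) = norm (abs_L1 f)" if f: "f \<in> borel_measurable borel" "integrable leb01 f" for f
  proof -
    have fa: "(\<lambda>t. \<bar>f t\<bar>) \<in> borel_measurable borel" "integrable leb01 (\<lambda>t. \<bar>f t\<bar>)"
      using f(1) integrable_abs[OF f(2)] by simp_all
    have "norm (abs_L1 (W f)) = (\<I> t. (1 / c) * (indicator B t * \<bar>f (\<phi> t)\<bar>))"
      unfolding L1_simps(1)[OF int[OF f]]
      by (rule integral_congI)
        (use c in \<open>simp add: W_def abs_mult sign_functionD(3)[OF s] indicator_def\<close>)
    also have "\<dots> = (1 / c) * (c * (\<I> t. \<bar>f t\<bar>))"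
      unfolding integral_mult_right_zero push(2)[OF fa] ..
    also have "\<dots> = norm (abs_L1 f)" using c by (simp add: L1_simps(1)[OF f(2)])
    finally show ?thesis .
  qed
  have Wdiff: "abs_L1 (W f) - abs_L1 (W g) = abs_L1 (W (\<lambda>t. f t - g t))"
    if "f \<in> borel_measurable borel" "integrable leb01 f" "g \<in> borel_measurable borel" "integrable leb01 g" for f g
    unfolding L1_simps(4)[OF int[OF that(1,2)] int[OF that(3,4)]] by (simp add: W_def algebra_simps)
  have W_cong: "abs_L1 (W f) = abs_L1 (W g)"
    if f: "f \<in> borel_measurable borel" "integrable leb01 f" and g: "g \<in> borel_measurable borel" "integrable leb01 g"
      and eq: "abs_L1 f = abs_L1 g" for f g
  proof -
    have "norm (abs_L1 (W f) - abs_L1 (W g)) = norm (abs_L1 (\<lambda>t. f t - g t))"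
      unfolding Wdiff[OF f g] by (rule normW) (use f g in auto)
    also have "\<dots> = norm (abs_L1 f - abs_L1 g)" by (simp add: L1_simps(4)[OF f(2) g(2)])
    finally show ?thesis using eq by simp
  qed
  have "\<forall>x. \<exists>f. f \<in> borel_measurable borel \<and> integrable leb01 f \<and> abs_L1 f = x"
  proof
    fix x
    obtain f0 where f0: "integrable leb01 f0" "x = abs_L1 f0" by (rule L1_cases)
    obtain f' where "f' \<in> borel_measurable borel" "integrable leb01 f'" "abs_L1 f' = abs_L1 f0"
      by (rule borel_representative[OF f0(1)])
    then show "\<exists>f. f \<in> borel_measurable borel \<and> integrable leb01 f \<and> abs_L1 f = x" using f0(2) by blast
  qed
  from choice[OF this] obtain r where r: "\<forall>x. r x \<in> borel_measurable borel \<and> integrable leb01 (r x) \<and> abs_L1 (r x) = x"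
    by (elim exE)
  then have r1: "r x \<in> borel_measurable borel" and r2: "integrable leb01 (r x)" and r3: "abs_L1 (r x) = x" for x
    by blast+
  define A where "A x = abs_L1 (W (r x))" for x
  have A: "A (abs_L1 f) = abs_L1 (W f)" if "f \<in> borel_measurable borel" "integrable leb01 f" for f
    unfolding A_def by (rule W_cong[OF r1 r2 that r3])
  have "linear_isometry A"
    unfolding linear_isometry_def
  proof (intro conjI allI linearI)
    fix x z :: L1 and a :: real
    have sum: "(\<lambda>t. r x t + r z t) \<in> borel_measurable borel" "integrable leb01 (\<lambda>t. r x t + r z t)"
      using r1[of x] r1[of z] r2[of x] r2[of z] by simp_all
    have "A (x + z) = A (abs_L1 (\<lambda>t. r x t + r z t))"
      by (simp only: L1_simps(3)[OF r2 r2, symmetric] r3)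
    also have "\<dots> = abs_L1 (\<lambda>t. W (r x) t + W (r z) t)"
      unfolding A[OF sum] by (simp add: W_def algebra_simps)
    also have "\<dots> = A x + A z"
      unfolding A_def L1_simps(3)[OF int[OF r1 r2] int[OF r1 r2]] ..
    finally show "A (x + z) = A x + A z" .
    have scl: "(\<lambda>t. a * r x t) \<in> borel_measurable borel" "integrable leb01 (\<lambda>t. a * r x t)"
      using r1[of x] r2[of x] by simp_all
    have "A (a *\<^sub>R x) = A (abs_L1 (\<lambda>t. a * r x t))"
      by (simp only: L1_simps(2)[OF r2, symmetric] r3)
    also have "\<dots> = abs_L1 (\<lambda>t. a * W (r x) t)"
      unfolding A[OF scl] by (simp add: W_def mult.left_commute)
    also have "\<dots> = a *\<^sub>R A x"
      unfolding A_def L1_simps(2)[OF int[OF r1 r2]] ..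
    finally show "A (a *\<^sub>R x) = a *\<^sub>R A x" .
    show "norm (A x) = norm x" unfolding A_def normW[OF r1 r2] r3 ..
  qed
  then show ?thesis using that A int0 by (simp add: W_def)
qed

section \<open>The factorization\<close>

context norming_functionals
begin

text \<open>
  Iterating the step along the history of signs. The Walsh moments follow by looking at the largest
  index that occurs: it decides which of the four relations of the step applies.
\<close>

lemma sign_system:
  obtains z :: "nat \<Rightarrow> 'a \<Rightarrow>\<^sub>L real" and u \<sigma> k where
    "\<And>n. n \<le> k n" "\<And>n. norm (z n - y (k n)) \<le> (1/2) ^ n"
    "\<And>n. \<exists>K'. L1_bounded K' (u n)" "\<And>n. sign_function (\<sigma> n)"
    "\<And>n f. integrable leb01 f \<Longrightarrow> z n (T (abs_L1 f)) = (\<I> t. u n t * f t)"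
    "\<And>S. finite S \<Longrightarrow> (\<I> t. walsh \<sigma> S t * indicator B t) = (if S = {} then measure leb01 B else 0)"
    "\<And>n S. finite S \<Longrightarrow> (\<I> t. walsh \<sigma> S t * (indicator B t * u n t)) = (if S = {n} then b / 8 * measure leb01 B else 0)"
proof -
  define R where "R w \<longleftrightarrow> (\<exists>K'. L1_bounded K' (fst (snd w))) \<and> sign_function (snd (snd w))"
    for w :: "('a \<Rightarrow>\<^sub>L real) \<times> (real \<Rightarrow> real) \<times> (real \<Rightarrow> real)"
  define hist where "hist h t = map (\<lambda>w. w t) (map (\<lambda>w. snd (snd w)) h)"
    for h :: "(('a \<Rightarrow>\<^sub>L real) \<times> (real \<Rightarrow> real) \<times> (real \<Rightarrow> real)) list" and t
  define Good where "Good h w \<longleftrightarrow>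
    (\<exists>m\<ge>length h. norm (fst w - y m) \<le> (1/2) ^ length h) \<and>
    (\<forall>f. integrable leb01 f \<longrightarrow> blinfun_apply (fst w) (T (abs_L1 f)) = (\<I> t. fst (snd w) t * f t)) \<and>
    (\<forall>G. (\<I> t. G (hist h t) * (indicator B t * fst (snd w) t)) = 0) \<and>
    (\<forall>G. (\<I> t. G (hist h t) * (indicator B t * snd (snd w) t)) = 0) \<and>
    (\<forall>G. \<forall>w'\<in>set h. (\<I> t. G (hist h t) * (indicator B t * (snd (snd w) t * fst (snd w') t))) = 0) \<and>
    (\<forall>G. (\<I> t. G (hist h t) * (indicator B t * (snd (snd w) t * fst (snd w) t))) =
      b / 8 * (\<I> t. G (hist h t) * indicator B t))"
    for h and w :: "('a \<Rightarrow>\<^sub>L real) \<times> (real \<Rightarrow> real) \<times> (real \<Rightarrow> real)"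
  obtain s where sR: "\<And>n. R (s n)" and sG: "\<And>n. Good (map s [0..<n]) (s n)"
  proof (rule history_choice[of R Good])
    fix h assume h: "\<forall>w\<in>set h. R w"
    then have "\<forall>w\<in>set (map (\<lambda>w. snd (snd w)) h). sign_function w" by (auto simp: R_def)
    note hp = history_partition[OF this, folded hist_def]
    let ?V = "(\<lambda>w. fst (snd w)) ` set h"
    have V: "integrable leb01 u" if uV: "u \<in> ?V" for u
    proof -
      obtain w where "w \<in> set h" "u = fst (snd w)" using uV by blast
      with h obtain K' where "L1_bounded K' u" unfolding R_def by blast
      then show ?thesis by (rule integrable_bounded)
    qed
    have e: "(1/2 :: real) ^ length h > 0" by simp
    show "\<exists>w. R w \<and> Good h w"
    proof (rule splitting_step[OF hp finite_imageI[OF finite_set] V e])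
      fix z u \<sigma> m
      assume 1: "length h \<le> m" "norm (z - y m) \<le> (1/2) ^ length h" "\<exists>K'. L1_bounded K' u" "sign_function \<sigma>"
        and 2: "\<And>f. integrable leb01 f \<Longrightarrow> blinfun_apply z (T (abs_L1 f)) = (\<I> t. u t * f t)"
        and 3: "\<And>G. (\<I> t. G (hist h t) * (indicator B t * u t)) = 0"
        and 4: "\<And>G. (\<I> t. G (hist h t) * (indicator B t * \<sigma> t)) = 0"
        and 5: "\<And>G u'. u' \<in> ?V \<Longrightarrow> (\<I> t. G (hist h t) * (indicator B t * (\<sigma> t * u' t))) = 0"
        and 6: "\<And>G. (\<I> t. G (hist h t) * (indicator B t * (\<sigma> t * u t))) = b / 8 * (\<I> t. G (hist h t) * indicator B t)"
      have "R (z, u, \<sigma>)" unfolding R_def fst_conv snd_conv by (intro conjI 1)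
      moreover have "Good h (z, u, \<sigma>)"
        unfolding Good_def fst_conv snd_conv
        by (intro conjI allI impI ballI exI[of _ m] 1 2 3 4 5 6 imageI)
      ultimately show ?thesis by blast
    qed
  next
    fix s assume "\<And>n. R (s n)" "\<And>n. Good (map s [0..<n]) (s n)"
    then show thesis by (rule that)
  qed
  define z where "z n = fst (s n)" for n
  define u where "u n = fst (snd (s n))" for n
  define \<sigma> where "\<sigma> n = snd (snd (s n))" for n
  have ub: "\<exists>K'. L1_bounded K' (u n)" and sg: "sign_function (\<sigma> n)" for n
    using sR[of n] unfolding R_def u_def \<sigma>_def by blast+
  define hs where "hs n t = map (\<lambda>i. \<sigma> i t) [0..<n]" for n t
  have hs: "hist (map s [0..<n]) t = hs n t" for n t
    by (simp add: hist_def hs_def \<sigma>_def)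
  have G1: "\<exists>m\<ge>n. norm (z n - y m) \<le> (1/2) ^ n" for n
    using sG[of n] unfolding Good_def z_def by simp
  have G2: "z n (T (abs_L1 f)) = (\<I> t. u n t * f t)" if "integrable leb01 f" for n f
    using sG[of n] that unfolding Good_def z_def u_def by blast
  have G3: "(\<I> t. G (hs n t) * (indicator B t * u n t)) = 0" for n G
    using sG[of n] unfolding Good_def u_def hs by blast
  have G4: "(\<I> t. G (hs n t) * (indicator B t * \<sigma> n t)) = 0" for n G
    using sG[of n] unfolding Good_def \<sigma>_def hs by blast
  have G5: "(\<I> t. G (hs n t) * (indicator B t * (\<sigma> n t * u j t))) = 0" if "j < n" for n j G
  proof -
    have "s j \<in> set (map s [0..<n])" using that by simp
    then show ?thesis using sG[of n] unfolding Good_def \<sigma>_def u_def hs by blast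
  qed
  have G6: "(\<I> t. G (hs n t) * (indicator B t * (\<sigma> n t * u n t))) = b / 8 * (\<I> t. G (hs n t) * indicator B t)" for n G
    using sG[of n] unfolding Good_def \<sigma>_def u_def hs by blast
  have W: "walsh \<sigma> S t = (\<Prod>i\<in>S. hs n t ! i)" if "S \<subseteq> {..<n}" for S n t
    unfolding walsh_def hs_def using that by (intro prod.cong) auto
  have top: "N \<in> S \<and> S - {N} \<subseteq> {..<N} \<and> (\<forall>t. walsh \<sigma> S t = \<sigma> N t * walsh \<sigma> (S - {N}) t)"
    if S: "finite S" "S \<noteq> {}" "N = Max S" for S N
  proof (intro conjI allI)
    show N: "N \<in> S" using S by simp
    show "S - {N} \<subseteq> {..<N}" using S Max_ge[OF S(1)] by (auto simp: le_less)
    show "walsh \<sigma> S t = \<sigma> N t * walsh \<sigma> (S - {N}) t" for t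
      using walsh_insert[of "S - {N}" N \<sigma> t] S(1) N by (simp add: insert_absorb)
  qed
  have mom1: "(\<I> t. walsh \<sigma> S t * indicator B t) = (if S = {} then measure leb01 B else 0)" if S: "finite S" for S
  proof (cases "S = {}")
    case True
    then show ?thesis using integral_indicator_leb01[OF B_sets] by (simp only: walsh_def prod.empty mult_1_left if_True simp_thms)
  next
    case False
    define N where "N = Max S"
    note t = top[OF S False N_def]
    have "(\<I> t. walsh \<sigma> S t * indicator B t) = (\<I> t. (\<Prod>i\<in>S - {N}. hs N t ! i) * (indicator B t * \<sigma> N t))"
      using t W[of "S - {N}" N] by (intro integral_congI) simp
    then show ?thesis using G4[of "\<lambda>l. \<Prod>i\<in>S - {N}. l ! i" N] False by simp
  qed
  have mom2: "(\<I> t. walsh \<sigma> S t * (indicator B t * u n t)) = (if S = {n} then b / 8 * measure leb01 B else 0)"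
    if S: "finite S" for n S
  proof (cases "S \<subseteq> {..<n}")
    case True
    then show ?thesis using G3[of "\<lambda>l. \<Prod>i\<in>S. l ! i" n] by (auto simp: W[OF True])
  next
    case False
    then have ne: "S \<noteq> {}" by blast
    define N where "N = Max S"
    note t = top[OF S ne N_def]
    have Nn: "n \<le> N" using False Max_ge[OF S] unfolding N_def by (meson lessThan_iff not_le order_trans subsetI less_imp_le)
    have "(\<I> t. walsh \<sigma> S t * (indicator B t * u n t)) = (\<I> t. (\<Prod>i\<in>S - {N}. hs N t ! i) * (indicator B t * (\<sigma> N t * u n t)))"
      using t W[of "S - {N}" N] by (intro integral_congI) simp
    also have "\<dots> = (if S = {n} then b / 8 * measure leb01 B else 0)"
    proof (cases "n = N")
      case True
      have "(\<I> t. (\<Prod>i\<in>S - {N}. hs N t ! i) * (indicator B t * (\<sigma> N t * u n t))) =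
        b / 8 * (\<I> t. (\<Prod>i\<in>S - {N}. hs N t ! i) * indicator B t)"
        unfolding True by (rule G6[of "\<lambda>l. \<Prod>i\<in>S - {N}. l ! i" N])
      also have "(\<I> t. (\<Prod>i\<in>S - {N}. hs N t ! i) * indicator B t) = (\<I> t. walsh \<sigma> (S - {N}) t * indicator B t)"
        using t W[of "S - {N}" N] by simp
      also have "\<dots> = (if S - {N} = {} then measure leb01 B else 0)" using S by (intro mom1) simp
      finally show ?thesis using t True by (auto split: if_splits)
    next
      case False
      then show ?thesis using G5[of n N "\<lambda>l. \<Prod>i\<in>S - {N}. l ! i"] Nn t by auto
    qed
    finally show ?thesis .
  qed
  have "\<forall>n. \<exists>m. n \<le> m \<and> norm (z n - y m) \<le> (1/2) ^ n" using G1 by blast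
  from choice[OF this] obtain k where k: "\<forall>n. n \<le> k n \<and> norm (z n - y (k n)) \<le> (1/2) ^ n" by (elim exE)
  show ?thesis
    by (rule that[of k z u \<sigma>]) (use k ub sg in \<open>blast intro: G2 mom1 mom2\<close>)+
qed

end

text \<open>
  Passing from the signs $s_n$ to $s_0 s_{i+1}$ only reindexes Walsh products, because even powers of
  $s_0$ disappear. An additional factor $s_0$ changes the parity.
\<close>

lemma walsh_product_signs:
  assumes \<sigma>: "\<And>i. sign_function (\<sigma> i)" and S: "finite S"
  shows "walsh (\<lambda>i t. \<sigma> 0 t * \<sigma> (Suc i) t) S t =
      walsh \<sigma> (if even (card S) then Suc ` S else insert 0 (Suc ` S)) t"
    and "\<sigma> 0 t * walsh (\<lambda>i t. \<sigma> 0 t * \<sigma> (Suc i) t) S t =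
      walsh \<sigma> (if even (card S) then insert 0 (Suc ` S) else Suc ` S) t"
proof -
  have base: "walsh (\<lambda>i t. \<sigma> 0 t * \<sigma> (Suc i) t) S t = \<sigma> 0 t ^ card S * walsh \<sigma> (Suc ` S) t"
    unfolding walsh_def prod.distrib by (subst prod.reindex) auto
  have ins: "walsh \<sigma> (insert 0 (Suc ` S)) t = \<sigma> 0 t * walsh \<sigma> (Suc ` S) t"
    using S by (intro walsh_insert) auto
  have sq: "\<sigma> 0 t * \<sigma> 0 t = 1" by (rule sign_functionD(4)[OF \<sigma>])
  have pow: "\<sigma> 0 t ^ card S = (if even (card S) then 1 else \<sigma> 0 t)"
    using sign_functionD(2)[OF \<sigma>, of 0 t] by auto
  show "walsh (\<lambda>i t. \<sigma> 0 t * \<sigma> (Suc i) t) S t =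
      walsh \<sigma> (if even (card S) then Suc ` S else insert 0 (Suc ` S)) t"
    unfolding base pow using ins by simp
  show "\<sigma> 0 t * walsh (\<lambda>i t. \<sigma> 0 t * \<sigma> (Suc i) t) S t =
      walsh \<sigma> (if even (card S) then insert 0 (Suc ` S) else Suc ` S) t"
    unfolding base pow using ins sq by (simp add: mult.assoc[symmetric])
qed

text \<open>
  Both sides of $z_n(T(A f)) = a \int r_n f$ are bounded functionals of $f$, so they need to be
  compared on half-lines only, where the transfer lemma for binary points applies.
\<close>

lemma factorization_through_T0:
  fixes T :: "L1 \<Rightarrow> 'a::real_normed_vector"
  assumes T: "bounded_linear T" and ncc: "\<not> completely_continuous T" and S: "countable S"
  obtains A :: "L1 \<Rightarrow> L1" and C :: "'a \<Rightarrow> linf" where "linear_isometry A" "bounded_linear C"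
    "C \<circ> T \<circ> A = T0" "\<And>x. x \<in> closure S \<Longrightarrow> C x \<in> c0"
proof -
  obtain y :: "nat \<Rightarrow> 'a \<Rightarrow>\<^sub>L real" and v K b B where data: "norming_functionals T y v K b B"
    and y0: "\<And>x. x \<in> closure S \<Longrightarrow> (\<lambda>m. y m x) \<longlonglongrightarrow> 0"
    by (rule weak_star_null_functionals_localized[OF T ncc S]) blast
  interpret norming_functionals T y v K b B by (rule data)
  obtain z :: "nat \<Rightarrow> 'a \<Rightarrow>\<^sub>L real" and u \<sigma> k where k: "\<And>n. n \<le> k n"
    and zy: "\<And>n. norm (z n - y (k n)) \<le> (1/2) ^ n"
    and ub: "\<And>n. \<exists>K'. L1_bounded K' (u n)" and \<sigma>: "\<And>n. sign_function (\<sigma> n)"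
    and zT: "\<And>n f. integrable leb01 f \<Longrightarrow> z n (T (abs_L1 f)) = (\<I> t. u n t * f t)"
    and mom1: "\<And>S. finite S \<Longrightarrow> (\<I> t. walsh \<sigma> S t * indicator B t) = (if S = {} then measure leb01 B else 0)"
    and mom2: "\<And>n S. finite S \<Longrightarrow> (\<I> t. walsh \<sigma> S t * (indicator B t * u n t)) = (if S = {n} then b / 8 * measure leb01 B else 0)"
  proof (rule sign_system)
    fix z :: "nat \<Rightarrow> 'a \<Rightarrow>\<^sub>L real" and u \<sigma> k
    assume "\<And>n. n \<le> k n" "\<And>n. norm (z n - y (k n)) \<le> (1/2) ^ n"
      "\<And>n. \<exists>K'. L1_bounded K' (u n)" "\<And>n. sign_function (\<sigma> n)"
      "\<And>n f. integrable leb01 f \<Longrightarrow> z n (T (abs_L1 f)) = (\<I> t. u n t * f t)"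
      "\<And>S. finite S \<Longrightarrow> (\<I> t. walsh \<sigma> S t * indicator B t) = (if S = {} then measure leb01 B else 0)"
      "\<And>n S. finite S \<Longrightarrow> (\<I> t. walsh \<sigma> S t * (indicator B t * u n t)) = (if S = {n} then b / 8 * measure leb01 B else 0)"
    then show thesis by (rule that)
  qed
  define \<mu> where "\<mu> = measure leb01 B"
  have \<mu>: "\<mu> > 0" using B_pos by (simp only: \<mu>_def)
  define a where "a = b / 8"
  have a: "a > 0" using bpos by (simp add: a_def)
  define \<tau> where "\<tau> i t = \<sigma> 0 t * \<sigma> (Suc i) t" for i t
  have \<tau>: "sign_function (\<tau> i)" for i unfolding \<tau>_def[abs_def] by (rule sign_function_mult[OF \<sigma> \<sigma>])
  note wp = walsh_product_signs[of \<sigma>, OF \<sigma>, folded \<tau>_def]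
  have iB: "integrable leb01 (indicator B :: real \<Rightarrow> real)" by (rule integrable_indicator_leb01[OF disjI2[OF B_sets]])
  have ui: "integrable leb01 (u n)" for n using ub[of n] integrable_bounded by blast
  have iBu: "integrable leb01 (\<lambda>t. indicator B t * u n t)" for n
    by (rule integrable_indicator_mult[OF disjI2[OF B_sets] ui])
  have iBsu: "integrable leb01 (\<lambda>t. \<sigma> 0 t * (indicator B t * u n t))" for n
    by (rule integrable_bounded_mult[OF sign_functionD(5)[OF \<sigma>] iBu])
  define \<phi> where "\<phi> = binary_point \<tau>"
  have \<phi>m: "\<phi> \<in> borel_measurable leb01" unfolding \<phi>_def by (rule binary_point_measurable[OF \<tau>])
  have dy: "(\<I> t. indicator {..x} (binary_point dyadic_sign t) * q t) = (\<I> t. indicator {..x} t * q t)"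
    if q: "integrable leb01 q" for x :: real and q :: "real \<Rightarrow> real"
  proof (rule integral_cong_AE)
    show "AE t in leb01. indicator {..x} (binary_point dyadic_sign t) * q t = indicator {..x} t * q t"
      using AE_leb01_less_1 by eventually_elim (simp add: binary_point_dyadic)
    have [measurable]: "binary_point dyadic_sign \<in> borel_measurable leb01" "q \<in> borel_measurable leb01"
      using binary_point_measurable[OF sign_function_dyadic] q by auto
    show "(\<lambda>t. indicator {..x} (binary_point dyadic_sign t) * q t) \<in> borel_measurable leb01" by measurable
    show "(\<lambda>t. indicator {..x} t * q t) \<in> borel_measurable leb01"
      by (rule borel_measurable_integrable[OF integrable_indicator_mult[OF _ q]]) simp
  qed
  have law: "(\<I> t. indicator {..x} (\<phi> t) * indicator B t) = \<mu> * (\<I> t. indicator {..x} t)" for x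
  proof -
    have "(\<I> t. indicator {..x} (\<phi> t) * indicator B t) = \<mu> * (\<I> t. indicator {..x} (binary_point dyadic_sign t) * 1)"
      unfolding \<phi>_def
    proof (rule binary_point_halfline_transfer[OF \<tau> sign_function_dyadic iB])
      fix S :: "nat set" assume S: "finite S"
      have "finite (if even (card S) then Suc ` S else insert 0 (Suc ` S))" using S by simp
      from mom1[OF this]
      show "(\<I> t. walsh \<tau> S t * indicator B t) = \<mu> * (\<I> t. walsh dyadic_sign S t * 1)"
        using integral_walsh_dyadic[OF S] by (simp add: wp(1)[OF S] \<mu>_def)
    qed simp
    also have "(\<I> t. indicator {..x} (binary_point dyadic_sign t) * 1) = (\<I> t. indicator {..x} t * 1 :: real)"
      by (rule dy) simp
    finally show ?thesis by (simp only: mult_1_right)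
  qed
  obtain A :: "L1 \<Rightarrow> L1" where A: "linear_isometry A"
    and Aeq: "\<And>f. f \<in> borel_measurable borel \<Longrightarrow> integrable leb01 f \<Longrightarrow>
      integrable leb01 (\<lambda>t. \<sigma> 0 t * (indicator B t * f (\<phi> t))) \<and>
      A (abs_L1 f) = abs_L1 (\<lambda>t. (1 / \<mu>) * (\<sigma> 0 t * (indicator B t * f (\<phi> t))))"
  proof (rule weighted_composition_isometry[OF \<phi>m B_sets \<sigma> law \<mu>])
    fix A :: "L1 \<Rightarrow> L1"
    assume "linear_isometry A" "\<And>f. f \<in> borel_measurable borel \<Longrightarrow> integrable leb01 f \<Longrightarrow>
      integrable leb01 (\<lambda>t. \<sigma> 0 t * (indicator B t * f (\<phi> t))) \<and>
      A (abs_L1 f) = abs_L1 (\<lambda>t. (1 / \<mu>) * (\<sigma> 0 t * (indicator B t * f (\<phi> t))))"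
    then show thesis by (rule that)
  qed
  \<comment> \<open>The Rademacher functions up to null sets; the index shift comes from the extra function 1.\<close>
  define q where "q n = (if n = 0 then (\<lambda>_. 1) else dyadic_sign (n - 1))" for n
  have qi: "integrable leb01 (q n)" for n
    unfolding q_def using integrable_bounded[OF sign_functionD(5)[OF sign_function_dyadic]] by simp
  have qmom: "(\<I> t. walsh \<tau> S t * (\<sigma> 0 t * (indicator B t * u n t))) = (a * \<mu>) * (\<I> t. walsh dyadic_sign S t * q n t)"
    if S: "finite S" for S n
  proof -
    let ?X = "if even (card S) then insert 0 (Suc ` S) else Suc ` S"
    have fX: "finite ?X" using S by simp
    have "(\<I> t. walsh \<tau> S t * (\<sigma> 0 t * (indicator B t * u n t))) = (\<I> t. walsh \<sigma> ?X t * (indicator B t * u n t))"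
      unfolding wp(2)[OF S, symmetric] by (simp only: mult_ac)
    also have "\<dots> = (if ?X = {n} then a * \<mu> else 0)" unfolding mom2[OF fX] a_def \<mu>_def ..
    also have "\<dots> = (a * \<mu>) * (\<I> t. walsh dyadic_sign S t * q n t)"
    proof (cases n)
      case 0
      have "?X = {0} \<longleftrightarrow> S = {}"
      proof
        assume X: "?X = {0}"
        show "S = {}"
        proof (rule ccontr)
          assume "S \<noteq> {}"
          then obtain i where "i \<in> S" by blast
          then have "Suc i \<in> ?X" by simp
          then show False unfolding X by simp
        qed
      qed simp
      then show ?thesis using integral_walsh_dyadic[OF S] by (simp add: 0 q_def)
    next
      case (Suc j)
      have "?X = {Suc j} \<longleftrightarrow> S = {j}"
      proof
        assume X: "?X = {Suc j}"
        have "odd (card S)"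
        proof (rule ccontr)
          assume "\<not> odd (card S)"
          then have "0 \<in> ?X" by simp
          then show False unfolding X by simp
        qed
        then have "Suc ` S = Suc ` {j}" using X by simp
        then show "S = {j}" by (simp only: inj_image_eq_iff[OF inj_Suc])
      qed simp
      then show ?thesis using integral_walsh_mult_dyadic[OF S, of j] by (simp add: Suc q_def)
    qed
    finally show ?thesis .
  qed
  have coef: "(\<I> t. indicator {..x} (\<phi> t) * (\<sigma> 0 t * (indicator B t * u n t))) = (a * \<mu>) * (\<I> t. indicator {..x} t * q n t)" for x n
    unfolding \<phi>_def dy[OF qi, symmetric]
    by (rule binary_point_halfline_transfer[OF \<tau> sign_function_dyadic iBsu qi qmom])
  have q_rad: "(\<I> t. indicator {..x} t * q n t) = rademacher_coeff (abs_L1 (indicator {..x})) n" for x n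
  proof -
    have ix: "integrable leb01 (indicator {..x} :: real \<Rightarrow> real)" by (rule integrable_indicator_leb01) simp
    show ?thesis
      unfolding L1_simps(5)[OF ix]
    proof (rule integral_cong_AE)
      show "AE t in leb01. indicator {..x} t * q n t = rademacher n t * indicator {..x} t"
        using AE_leb01_less_1
      proof eventually_elim
        case (elim t)
        have "q n t = rademacher n t"
          using rademacher_eq_dyadic_sign[of t "n - 1"] elim by (cases n) (simp_all add: q_def rademacher_def[of 0])
        then show ?case by simp
      qed
      show "(\<lambda>t. indicator {..x} t * q n t) \<in> borel_measurable leb01"
        by (rule borel_measurable_integrable[OF integrable_indicator_mult[OF _ qi]]) simp
      show "(\<lambda>t. rademacher n t * indicator {..x} t) \<in> borel_measurable leb01"
        by (rule borel_measurable_integrable[OF integrable_rademacher_mult[OF ix]])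
    qed
  qed
  have A_bl: "bounded_linear A"
    using A unfolding linear_isometry_def
    by (intro bounded_linear_intro[where K = 1]) (auto simp: linear_add linear_scale)
  have coefficient: "z n (T (A f)) = a * rademacher_coeff f n" for n f
  proof -
    have zTA: "bounded_linear (\<lambda>f. z n (T (A f)))"
      by (rule bounded_linear_compose[OF blinfun.bounded_linear_right bounded_linear_compose[OF T A_bl]])
    have rb: "L1_bounded 1 (rademacher n)" using rademacher_measurable abs_rademacher_le_1 by blast
    obtain F :: "L1 \<Rightarrow>\<^sub>L real" where F: "\<And>f. integrable leb01 f \<Longrightarrow> F (abs_L1 f) = (\<I> t. rademacher n t * f t)"
      using L1_pairing_blinfun[OF rb zero_le_one] by blast
    have Fr: "F f = rademacher_coeff f n" for f
    proof -
      obtain g where g: "integrable leb01 g" "f = abs_L1 g" by (rule L1_cases)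
      show ?thesis unfolding g(2) by (simp only: F[OF g(1)] L1_simps(5)[OF g(1)])
    qed
    have "Blinfun (\<lambda>f. z n (T (A f))) = a *\<^sub>R F"
    proof (rule blinfun_eq_on_L1)
      fix x :: real
      have ix: "integrable leb01 (indicator {..x} :: real \<Rightarrow> real)" by (rule integrable_indicator_leb01) simp
      have bx: "(indicator {..x} :: real \<Rightarrow> real) \<in> borel_measurable borel" by measurable
      note Ax = Aeq[OF bx ix]
      have "z n (T (A (abs_L1 (indicator {..x})))) = (\<I> t. u n t * ((1 / \<mu>) * (\<sigma> 0 t * (indicator B t * indicator {..x} (\<phi> t)))))"
        unfolding Ax[THEN conjunct2] by (rule zT[OF integrable_mult_right[OF Ax[THEN conjunct1]]])
      also have "\<dots> = (\<I> t. (1 / \<mu>) * (indicator {..x} (\<phi> t) * (\<sigma> 0 t * (indicator B t * u n t))))"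
        by (rule integral_congI) (simp only: mult_ac)
      also have "\<dots> = (1 / \<mu>) * ((a * \<mu>) * rademacher_coeff (abs_L1 (indicator {..x})) n)"
        by (simp only: integral_mult_right_zero coef q_rad)
      also have "\<dots> = a * rademacher_coeff (abs_L1 (indicator {..x})) n" using \<mu> by simp
      finally show "Blinfun (\<lambda>f. z n (T (A f))) (abs_L1 (indicator {..x})) = (a *\<^sub>R F) (abs_L1 (indicator {..x}))"
        by (simp add: bounded_linear_Blinfun_apply[OF zTA] blinfun.scaleR_left Fr)
    qed
    then have "Blinfun (\<lambda>f. z n (T (A f))) f = (a *\<^sub>R F) f" by (rule arg_cong)
    then show ?thesis by (simp add: bounded_linear_Blinfun_apply[OF zTA] blinfun.scaleR_left Fr)
  qed
  have z3: "norm (z n) \<le> 3" for n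
  proof -
    have "norm (z n) \<le> norm (z n - y (k n)) + norm (y (k n))" using norm_triangle_ineq[of "z n - y (k n)" "y (k n)"] by simp
    also have "\<dots> \<le> (1/2)^n + 2" by (intro add_mono zy y_le)
    also have "(1/2 :: real)^n \<le> 1" by (rule power_le_one) auto
    finally show ?thesis by simp
  qed
  have zb: "\<bar>z n x / a\<bar> \<le> 3 / a * norm x" for n x
    using order_trans[OF norm_blinfun mult_right_mono[OF z3 norm_ge_zero], of n x] a
    by (simp add: field_simps)
  define C where "C x = Bcontfun (\<lambda>n. z n x / a)" for x
  have C: "apply_bcontfun (C x) = (\<lambda>n. z n x / a)" for x
    unfolding C_def
  proof (intro Bcontfun_inverse bcontfun_normI[where b = "3 / a * norm x"])
    show "norm (z n x / a) \<le> 3 / a * norm x" for n unfolding real_norm_def by (rule zb)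
  qed (simp add: continuous_on_discrete)
  show ?thesis
  proof (rule that[OF A])
    show "bounded_linear C"
    proof (rule bounded_linear_intro[where K = "3 / a"])
      show "C (x + x') = C x + C x'" for x x'
        by (rule bcontfun_eqI) (simp add: C plus_bcontfun.rep_eq blinfun.add_right add_divide_distrib)
      show "C (r *\<^sub>R x) = r *\<^sub>R C x" for r x
        by (rule bcontfun_eqI) (simp add: C blinfun.scaleR_right)
      show "norm (C x) \<le> norm x * (3 / a)" for x
        by (rule norm_bound) (use zb in \<open>simp add: C mult.commute\<close>)
    qed
    show "C \<circ> T \<circ> A = T0"
    proof
      fix f
      show "(C \<circ> T \<circ> A) f = T0 f"
        by (rule bcontfun_eqI) (use a in \<open>simp add: C apply_T0 coefficient\<close>)
    qed
    show "C x \<in> c0" if x: "x \<in> closure S" for x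
    proof -
      have ktop: "filterlim k sequentially sequentially"
        by (rule filterlim_at_top_mono[OF filterlim_ident]) (simp add: k)
      have "(\<lambda>n. z n x - y (k n) x) \<longlonglongrightarrow> 0"
      proof (rule Lim_null_comparison)
        have "norm (z n x - y (k n) x) \<le> (1/2)^n * norm x" for n
          using order_trans[OF norm_blinfun mult_right_mono[OF zy norm_ge_zero], of n x]
          by (simp add: blinfun.diff_left)
        then show "\<forall>\<^sub>F n in sequentially. norm (z n x - y (k n) x) \<le> (1/2)^n * norm x" by simp
        have "(\<lambda>n. (1/2)^n * norm x) \<longlonglongrightarrow> 0 * norm x"
          by (intro tendsto_mult tendsto_const LIMSEQ_power_zero) simp
        then show "(\<lambda>n. (1/2)^n * norm x) \<longlonglongrightarrow> 0" by simp
      qed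
      from tendsto_add[OF this filterlim_compose[OF y0[OF x] ktop]]
      have "(\<lambda>n. z n x) \<longlonglongrightarrow> 0" by simp
      then have "(\<lambda>n. z n x / a) \<longlonglongrightarrow> 0 / a" by (intro tendsto_divide tendsto_const) (use a in auto)
      then show ?thesis by (simp add: c0_def C)
    qed
  qed
qed

theorem corollary4:
  fixes T :: "L1 \<Rightarrow> 'a::banach"
  assumes "bounded_linear T"
    and "\<not> completely_continuous T"
  shows "(\<exists>(A :: L1 \<Rightarrow> L1) (B :: 'a \<Rightarrow> linf).
            linear_isometry A \<and> bounded_linear B \<and> B \<circ> T \<circ> A = T0) \<and>
         (separable_space (euclidean :: 'a topology) \<longrightarrow>
            range T0 \<subseteq> c0 \<and>
            (\<exists>(A :: L1 \<Rightarrow> L1) (B :: 'a \<Rightarrow> linf).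
               linear_isometry A \<and> bounded_linear B \<and> range B \<subseteq> c0 \<and> B \<circ> T \<circ> A = T0))"
proof (intro conjI impI)
  show "\<exists>(A :: L1 \<Rightarrow> L1) (B :: 'a \<Rightarrow> linf). linear_isometry A \<and> bounded_linear B \<and> B \<circ> T \<circ> A = T0"
    \<comment> \<open>Without separability nothing is asked of the limit of the functionals, so no points are prescribed.\<close>
    by (rule factorization_through_T0[OF assms countable_empty]) blast
next
  assume "separable_space (euclidean :: 'a topology)"
  then obtain S :: "'a set" where S: "countable S" "closure S = UNIV"
    unfolding separable_space_def by auto
  obtain A :: "L1 \<Rightarrow> L1" and B :: "'a \<Rightarrow> linf" where AB: "linear_isometry A" "bounded_linear B"
    "B \<circ> T \<circ> A = T0" "\<And>x. x \<in> closure S \<Longrightarrow> B x \<in> c0"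
    by (rule factorization_through_T0[OF assms S(1)]) blast
  have B: "range B \<subseteq> c0" using AB(4) S(2) by auto
  show "range T0 \<subseteq> c0" unfolding AB(3)[symmetric] using B by auto
  show "\<exists>(A :: L1 \<Rightarrow> L1) (B :: 'a \<Rightarrow> linf).
      linear_isometry A \<and> bounded_linear B \<and> range B \<subseteq> c0 \<and> B \<circ> T \<circ> A = T0"
    using AB B by blast
qed

end
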